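(* Let $\mathcal C$ be a category. The zigzag double category $\mathbb Z(\mathcal C)$ is the free fibrant double category over $\mathcal C$. That is: $\mathbb Z(\mathcal C)$ is a fibrant double category with underlying horizontal category $\mathcal C$ (with the companions and conjoints specified in the context), and for every fibrant double category $\mathbb E$ with underlying horizontal category $\mathcal C$, equipped with chosen companions and conjoints, there is a unique double functor $\mathbb Z(\mathcal C)\to\mathbb E$ that is the identity on $\mathcal C$ and preserves the chosen companions and conjoints together with their structure cells.
   Context: Composition is in diagrammatic order. All double categories are strict (internal categories in $\mathrm{Cat}$) and double functors are strict. A double category has objects, horizontal arrows (forming its underlying horizontal category), vertical arrows, and cells. For a cell we list its left and right boundaries (vertical arrows) and its top and bottom boundaries (horizontal arrows). Write $\cdot$ for horizontal composition of cells, $\odot$ for vertical composition (top to bottom), $U_f$ for the vertical identity cell on a horizontal arrow $f$. A double category is fibrant if every horizontal arrow $f:A\to B$ has a companion and a conjoint. A companion is a vertical arrow $F_f:A\to B$ with a cell $\alpha_f$ (left: identity on $A$, right $F_f$, top $\mathrm{id}_A$, bottom $f$) for which there exists a (necessarily unique) cell $\alpha'_f$ (left $F_f$, right: identity on $B$, top $f$, bottom $\mathrm{id}_B$) with $\alpha_f\cdot\alpha'_f=U_f$ and $\alpha_f\odot\alpha'_f$ the horizontal identity cell on $F_f$. A conjoint is a vertical arrow $G_f:B\to A$ with a cell $\beta_f$ (left $G_f$, right: identity on $B$, top $\mathrm{id}_B$, bottom $f$) for which there exists a (necessarily unique) cell $\beta'_f$ (left: identity on $A$, right $G_f$, top $f$,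 bottom $\mathrm{id}_A$) with $\beta'_f\cdot\beta_f=U_f$ and $\beta_f\odot\beta'_f$ the horizontal identity cell on $G_f$. (Equivalently, the pairing of source and target functors is a bifibration.) The double category $\mathbb Z(\mathcal C)$. Zigzag formulas are generated by: for each object $A$ of $\mathcal C$ an atom $A:A\rightsquigarrow A$; if $Z:A\rightsquigarrow B$ and $f:B\to C$ then $f^+Z:A\rightsquigarrow C$; if $Z:A\rightsquigarrow C$ and $g:B\to C$ then $g^-Z:A\rightsquigarrow B$. For $Z:A\rightsquigarrow B$, $Z':A'\rightsquigarrow B'$ and $h:B\to B'$, derivations $\zeta:Z\Rightarrow_h Z'$ are generated by: - each arrow $f:A\to A'$ of $\mathcal C$ is an axiom $f:A\Rightarrow_f A'$; - if $\alpha:S\Rightarrow_{fg}T$ then $\mathsf L^+_{f,g}(\alpha):f^+S\Rightarrow_g T$; - if $\alpha:S'\Rightarrow_{f'}S$ then $\mathsf R^+_f(\alpha):S'\Rightarrow_{f'f}f^+S$; - if $\alpha:T\Rightarrow_{g'}T'$ then $\mathsf L^-_g(\alpha):g^-T\Rightarrow_{gg'}T'$; - if $\alpha:S\Rightarrow_{fg}T$ then $\mathsf R^-_{f,g}(\alpha):S\Rightarrow_f g^-T$. Permutation equivalence $\sim$ is the least equivalence relation on derivations of each sequent, closed under these rules, containing (whenever both sides are valid) $\mathsf R^+_h\mathsf L^-_f\alpha\sim\mathsf L^-_f\mathsf R^+_h\alpha$ ($\alpha$ over $g$); $\mathsf R^+_h\mathsf L^+_{f,g}\alpha\sim\mathsf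 L^+_{f,gh}\mathsf R^+_h\alpha$ ($\alpha$ over $fg$); $\mathsf R^-_{fg,h}\mathsf L^-_f\alpha\sim\mathsf L^-_f\mathsf R^-_{g,h}\alpha$ ($\alpha$ over $gh$); $\mathsf R^-_{g,h}\mathsf L^+_{f,gh}\alpha\sim\mathsf L^+_{f,g}\mathsf R^-_{fg,h}\alpha$ ($\alpha$ over $fgh$). Identities: $\mathrm{id}_A$ on an atom is the axiom $\mathrm{id}_A$; $\mathrm{id}_{f^+S}=\mathsf L^+_{f,\mathrm{id}}\mathsf R^+_f(\mathrm{id}_S)$; $\mathrm{id}_{g^-T}=\mathsf R^-_{\mathrm{id},g}\mathsf L^-_g(\mathrm{id}_T)$. Cut $\alpha\cdot\beta$ is defined recursively (up to $\sim$) by: composition in $\mathcal C$ on axioms; $\mathsf R^+_f(\alpha)\cdot\mathsf L^+_{f,h}(\beta)=\alpha\cdot\beta$; $\mathsf R^-_{g,f}(\alpha)\cdot\mathsf L^-_f(\beta)=\alpha\cdot\beta$; $\mathsf L^-_f(\alpha)\cdot\beta=\mathsf L^-_f(\alpha\cdot\beta)$; $\mathsf L^+_{f,g}(\alpha)\cdot\beta=\mathsf L^+_{f,gh}(\alpha\cdot\beta)$ ($\beta$ over $h$); $\alpha\cdot\mathsf R^+_f(\beta)=\mathsf R^+_f(\alpha\cdot\beta)$; $\alpha\cdot\mathsf R^-_{h,f}(\beta)=\mathsf R^-_{gh,f}(\alpha\cdot\beta)$ ($\alpha$ over $g$). $\mathbb Z(\mathcal C)$ has the objects and arrows of $\mathcal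 C$ as objects and horizontal arrows; vertical arrows $A\to B$ are zigzag formulas $Z:A\rightsquigarrow B$; a cell with left $Z$, right $Z'$, top $f$ and bottom $g$ is a $\sim$-class of derivations $Z\Rightarrow_g Z'$ whose unique axiom is $f$. Horizontal composition is cut. Vertical composition $Z\odot Z'$ substitutes $Z$ for the unique atom of $Z'$, and on cells $\zeta\odot\zeta'$ substitutes $\zeta$ for the unique axiom of $\zeta'$; vertical identities are the atoms and the axioms. The chosen companion of $f:A\to B$ is $f^+A:A\rightsquigarrow B$ with cell $\mathsf R^+_f(\mathrm{id}_A)$, and the chosen conjoint is $f^-B:B\rightsquigarrow A$ with cell $\mathsf L^-_f(\mathrm{id}_B)$. *)

theory Defs
  imports Main
begin

section \<open>Categories and functors\<close>

text \<open>Composition is written in diagrammatic order. The operations are total functions whose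
  values outside the carriers (or on non-composable arrows) are irrelevant.\<close>

record ('o, 'a) cat =
  Obj :: "'o set"
  Arr :: "'a set"
  Dom :: "'a \<Rightarrow> 'o"
  Cod :: "'a \<Rightarrow> 'o"
  Ident :: "'o \<Rightarrow> 'a"
  Comp :: "'a \<Rightarrow> 'a \<Rightarrow> 'a"  (infixl "\<cdot>\<index>" 70)

definition hom :: "('o, 'a) cat \<Rightarrow> 'o \<Rightarrow> 'o \<Rightarrow> 'a set" where
  "hom C A B = {f \<in> Arr C. Dom C f = A \<and> Cod C f = B}"

definition seq :: "('o, 'a) cat \<Rightarrow> 'a \<Rightarrow> 'a \<Rightarrow> bool" where
  "seq C f g \<longleftrightarrow> f \<in> Arr C \<and> g \<in> Arr C \<and> Cod C f = Dom C g"

locale category =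
  fixes C :: "('o, 'a) cat" (structure)
  assumes Dom_closed: "f \<in> Arr C \<Longrightarrow> Dom C f \<in> Obj C"
    and Cod_closed: "f \<in> Arr C \<Longrightarrow> Cod C f \<in> Obj C"
    and Ident_closed: "A \<in> Obj C \<Longrightarrow> Ident C A \<in> hom C A A"
    and Comp_closed: "seq C f g \<Longrightarrow> f \<cdot> g \<in> hom C (Dom C f) (Cod C g)"
    and Ident_left: "f \<in> Arr C \<Longrightarrow> Ident C (Dom C f) \<cdot> f = f"
    and Ident_right: "f \<in> Arr C \<Longrightarrow> f \<cdot> Ident C (Cod C f) = f"
    and Comp_assoc: "seq C f g \<Longrightarrow> seq C g h \<Longrightarrow> (f \<cdot> g) \<cdot> h = f \<cdot> (g \<cdot> h)"

definition is_functor ::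
  "('o, 'a) cat \<Rightarrow> ('p, 'b) cat \<Rightarrow> ('o \<Rightarrow> 'p) \<Rightarrow> ('a \<Rightarrow> 'b) \<Rightarrow> bool" where
  "is_functor C D Fo Fa \<longleftrightarrow>
     (\<forall>A \<in> Obj C. Fo A \<in> Obj D) \<and>
     (\<forall>f \<in> Arr C. Fa f \<in> hom D (Fo (Dom C f)) (Fo (Cod C f))) \<and>
     (\<forall>A \<in> Obj C. Fa (Ident C A) = Ident D (Fo A)) \<and>
     (\<forall>f g. seq C f g \<longrightarrow> Fa (f \<cdot>\<^bsub>C\<^esub> g) = Fa f \<cdot>\<^bsub>D\<^esub> Fa g)"


section \<open>Double categories as internal categories in Cat\<close>

text \<open>\<open>D0\<close> is the underlying horizontal category. The objects of \<open>D1\<close> are the vertical arrows,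
  its arrows are the cells, and its composition is horizontal composition of cells; so the left
  and right boundaries of a cell are its domain and codomain in \<open>D1\<close>, and its top and bottom
  boundaries are its images under the source and target functors. The suffix \<open>V\<close> (resp. \<open>C\<close>) marks
  the action of a structure functor on vertical arrows (resp. cells); for the unit functor, it
  marks the sort of the value.\<close>

record ('o, 'a, 'v, 'c) dblcat =
  D0 :: "('o, 'a) cat"
  D1 :: "('v, 'c) cat"
  SrcV :: "'v \<Rightarrow> 'o"
  SrcC :: "'c \<Rightarrow> 'a"
  TgtV :: "'v \<Rightarrow> 'o"
  TgtC :: "'c \<Rightarrow> 'a"
  UnitV :: "'o \<Rightarrow> 'v"
  UnitC :: "'a \<Rightarrow> 'c"
  VcompV :: "'v \<Rightarrow> 'v \<Rightarrow> 'v"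
  VcompC :: "'c \<Rightarrow> 'c \<Rightarrow> 'c"

definition vseqV :: "('o, 'a, 'v, 'c) dblcat \<Rightarrow> 'v \<Rightarrow> 'v \<Rightarrow> bool" where
  "vseqV D v w \<longleftrightarrow> v \<in> Obj (D1 D) \<and> w \<in> Obj (D1 D) \<and> TgtV D v = SrcV D w"

definition vseqC :: "('o, 'a, 'v, 'c) dblcat \<Rightarrow> 'c \<Rightarrow> 'c \<Rightarrow> bool" where
  "vseqC D x y \<longleftrightarrow> x \<in> Arr (D1 D) \<and> y \<in> Arr (D1 D) \<and> TgtC D x = SrcC D y"

text \<open>The pullback of \<open>D1\<close> with itself over \<open>D0\<close>, i.e. the category of vertically composable
  pairs.\<close>

definition vpairs :: "('o, 'a, 'v, 'c) dblcat \<Rightarrow> ('v \<times> 'v, 'c \<times> 'c) cat" where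
  "vpairs D =
     \<lparr> Obj = {(v, w). vseqV D v w},
       Arr = {(x, y). vseqC D x y},
       Dom = (\<lambda>(x, y). (Dom (D1 D) x, Dom (D1 D) y)),
       Cod = (\<lambda>(x, y). (Cod (D1 D) x, Cod (D1 D) y)),
       Ident = (\<lambda>(v, w). (Ident (D1 D) v, Ident (D1 D) w)),
       Comp = (\<lambda>(x, y) (x', y'). (x \<cdot>\<^bsub>D1 D\<^esub> x', y \<cdot>\<^bsub>D1 D\<^esub> y')) \<rparr>"

locale double_category =
  fixes D :: "('o, 'a, 'v, 'c) dblcat"
  assumes D0_category: "category (D0 D)"
    and D1_category: "category (D1 D)"
    and Src_functor: "is_functor (D1 D) (D0 D) (SrcV D) (SrcC D)"
    and Tgt_functor: "is_functor (D1 D) (D0 D) (TgtV D) (TgtC D)"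
    and Unit_functor: "is_functor (D0 D) (D1 D) (UnitV D) (UnitC D)"
    and Vcomp_functor: "is_functor (vpairs D) (D1 D)
          (\<lambda>(v, w). VcompV D v w) (\<lambda>(x, y). VcompC D x y)"
    and UnitV_bounds: "A \<in> Obj (D0 D) \<Longrightarrow> SrcV D (UnitV D A) = A \<and> TgtV D (UnitV D A) = A"
    and UnitC_bounds: "f \<in> Arr (D0 D) \<Longrightarrow> SrcC D (UnitC D f) = f \<and> TgtC D (UnitC D f) = f"
    and VcompV_bounds: "vseqV D v w \<Longrightarrow>
          SrcV D (VcompV D v w) = SrcV D v \<and> TgtV D (VcompV D v w) = TgtV D w"
    and VcompC_bounds: "vseqC D x y \<Longrightarrow>
          SrcC D (VcompC D x y) = SrcC D x \<and> TgtC D (VcompC D x y) = TgtC D y"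
    and VcompV_unit: "v \<in> Obj (D1 D) \<Longrightarrow>
          VcompV D (UnitV D (SrcV D v)) v = v \<and> VcompV D v (UnitV D (TgtV D v)) = v"
    and VcompC_unit: "x \<in> Arr (D1 D) \<Longrightarrow>
          VcompC D (UnitC D (SrcC D x)) x = x \<and> VcompC D x (UnitC D (TgtC D x)) = x"
    and VcompV_assoc: "vseqV D u v \<Longrightarrow> vseqV D v w \<Longrightarrow>
          VcompV D (VcompV D u v) w = VcompV D u (VcompV D v w)"
    and VcompC_assoc: "vseqC D x y \<Longrightarrow> vseqC D y z \<Longrightarrow>
          VcompC D (VcompC D x y) z = VcompC D x (VcompC D y z)"

definition ver :: "('o, 'a, 'v, 'c) dblcat \<Rightarrow> 'o \<Rightarrow> 'o \<Rightarrow> 'v set" where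
  "ver D A B = {v \<in> Obj (D1 D). SrcV D v = A \<and> TgtV D v = B}"

text \<open>\<open>cells D l r t b\<close>: cells with left, right, top and bottom boundary \<open>l\<close>, \<open>r\<close>, \<open>t\<close>, \<open>b\<close>.\<close>

definition cells :: "('o, 'a, 'v, 'c) dblcat \<Rightarrow> 'v \<Rightarrow> 'v \<Rightarrow> 'a \<Rightarrow> 'a \<Rightarrow> 'c set" where
  "cells D l r t b = {x \<in> hom (D1 D) l r. SrcC D x = t \<and> TgtC D x = b}"

record ('o, 'a, 'v, 'c, 'o2, 'a2, 'v2, 'c2) dblmap =
  mapO :: "'o \<Rightarrow> 'o2"
  mapH :: "'a \<Rightarrow> 'a2"
  mapV :: "'v \<Rightarrow> 'v2"
  mapC :: "'c \<Rightarrow> 'c2"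

definition double_functor ::
  "('o, 'a, 'v, 'c) dblcat \<Rightarrow> ('o2, 'a2, 'v2, 'c2) dblcat \<Rightarrow>
   ('o, 'a, 'v, 'c, 'o2, 'a2, 'v2, 'c2) dblmap \<Rightarrow> bool" where
  "double_functor D E F \<longleftrightarrow>
     is_functor (D0 D) (D0 E) (mapO F) (mapH F) \<and>
     is_functor (D1 D) (D1 E) (mapV F) (mapC F) \<and>
     (\<forall>v \<in> Obj (D1 D). SrcV E (mapV F v) = mapO F (SrcV D v) \<and>
                       TgtV E (mapV F v) = mapO F (TgtV D v)) \<and>
     (\<forall>x \<in> Arr (D1 D). SrcC E (mapC F x) = mapH F (SrcC D x) \<and>
                       TgtC E (mapC F x) = mapH F (TgtC D x)) \<and>
     (\<forall>A \<in> Obj (D0 D). mapV F (UnitV D A) = UnitV E (mapO F A)) \<and>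
     (\<forall>f \<in> Arr (D0 D). mapC F (UnitC D f) = UnitC E (mapH F f)) \<and>
     (\<forall>v w. vseqV D v w \<longrightarrow> mapV F (VcompV D v w) = VcompV E (mapV F v) (mapV F w)) \<and>
     (\<forall>x y. vseqC D x y \<longrightarrow> mapC F (VcompC D x y) = VcompC E (mapC F x) (mapC F y))"

text \<open>Equality of double functors out of \<open>D\<close>: values outside the carriers of \<open>D\<close> are ignored.\<close>

definition dblmap_eq ::
  "('o, 'a, 'v, 'c) dblcat \<Rightarrow>
   ('o, 'a, 'v, 'c, 'o2, 'a2, 'v2, 'c2) dblmap \<Rightarrow>
   ('o, 'a, 'v, 'c, 'o2, 'a2, 'v2, 'c2) dblmap \<Rightarrow> bool" where
  "dblmap_eq D F G \<longleftrightarrow>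
     (\<forall>A \<in> Obj (D0 D). mapO F A = mapO G A) \<and>
     (\<forall>f \<in> Arr (D0 D). mapH F f = mapH G f) \<and>
     (\<forall>v \<in> Obj (D1 D). mapV F v = mapV G v) \<and>
     (\<forall>x \<in> Arr (D1 D). mapC F x = mapC G x)"


section \<open>Companions and conjoints\<close>

definition is_companion :: "('o, 'a, 'v, 'c) dblcat \<Rightarrow> 'a \<Rightarrow> 'v \<Rightarrow> 'c \<Rightarrow> bool" where
  "is_companion D f v \<alpha> \<longleftrightarrow>
     (let A = Dom (D0 D) f; B = Cod (D0 D) f in
       v \<in> ver D A B \<and>
       \<alpha> \<in> cells D (UnitV D A) v (Ident (D0 D) A) f \<and>
       (\<exists>\<alpha>' \<in> cells D v (UnitV D B) f (Ident (D0 D) B).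
          \<alpha> \<cdot>\<^bsub>D1 D\<^esub> \<alpha>' = UnitC D f \<and> VcompC D \<alpha> \<alpha>' = Ident (D1 D) v))"

definition is_conjoint :: "('o, 'a, 'v, 'c) dblcat \<Rightarrow> 'a \<Rightarrow> 'v \<Rightarrow> 'c \<Rightarrow> bool" where
  "is_conjoint D f v \<beta> \<longleftrightarrow>
     (let A = Dom (D0 D) f; B = Cod (D0 D) f in
       v \<in> ver D B A \<and>
       \<beta> \<in> cells D v (UnitV D B) (Ident (D0 D) B) f \<and>
       (\<exists>\<beta>' \<in> cells D (UnitV D A) v f (Ident (D0 D) A).
          \<beta>' \<cdot>\<^bsub>D1 D\<^esub> \<beta> = UnitC D f \<and> VcompC D \<beta> \<beta>' = Ident (D1 D) v))"

locale fibrant_double_category = double_category D for D :: "('o, 'a, 'v, 'c) dblcat" +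
  assumes has_companion: "f \<in> Arr (D0 D) \<Longrightarrow> \<exists>v \<alpha>. is_companion D f v \<alpha>"
    and has_conjoint: "f \<in> Arr (D0 D) \<Longrightarrow> \<exists>v \<beta>. is_conjoint D f v \<beta>"

record ('a, 'v, 'c) fib_choice =
  cmpV :: "'a \<Rightarrow> 'v"
  cmpC :: "'a \<Rightarrow> 'c"
  cnjV :: "'a \<Rightarrow> 'v"
  cnjC :: "'a \<Rightarrow> 'c"

definition choice_of_fibrancy ::
  "('o, 'a, 'v, 'c) dblcat \<Rightarrow> ('a, 'v, 'c) fib_choice \<Rightarrow> bool" where
  "choice_of_fibrancy D K \<longleftrightarrow>
     (\<forall>f \<in> Arr (D0 D). is_companion D f (cmpV K f) (cmpC K f) \<and>
                       is_conjoint D f (cnjV K f) (cnjC K f))"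

text \<open>The complementary cells (the existential witnesses in the two definitions above) are
  determined by the data, so a double functor preserving the data preserves them as well.\<close>

definition preserves_choice ::
  "('o, 'a, 'v, 'c) dblcat \<Rightarrow> ('a, 'v, 'c) fib_choice \<Rightarrow> ('a2, 'v2, 'c2) fib_choice \<Rightarrow>
   ('o, 'a, 'v, 'c, 'o2, 'a2, 'v2, 'c2) dblmap \<Rightarrow> bool" where
  "preserves_choice D K L F \<longleftrightarrow>
     (\<forall>f \<in> Arr (D0 D).
        mapV F (cmpV K f) = cmpV L (mapH F f) \<and> mapC F (cmpC K f) = cmpC L (mapH F f) \<and>
        mapV F (cnjV K f) = cnjV L (mapH F f) \<and> mapC F (cnjC K f) = cnjC L (mapH F f))"


section \<open>Zigzag formulas and derivations\<close>

datatype ('o, 'a) zz =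
    Atom 'o
  | Plus 'a "('o, 'a) zz"
  | Minus 'a "('o, 'a) zz"

text \<open>\<open>zform C A Z B\<close>: \<open>Z\<close> is a zigzag formula from \<open>A\<close> to \<open>B\<close>.\<close>

inductive zform :: "('o, 'a) cat \<Rightarrow> 'o \<Rightarrow> ('o, 'a) zz \<Rightarrow> 'o \<Rightarrow> bool" for C where
  atom: "A \<in> Obj C \<Longrightarrow> zform C A (Atom A) A"
| plus: "zform C A Z B \<Longrightarrow> f \<in> hom C B B' \<Longrightarrow> zform C A (Plus f Z) B'"
| minus: "zform C A Z B' \<Longrightarrow> g \<in> hom C B B' \<Longrightarrow> zform C A (Minus g Z) B"

fun zsrc :: "('o, 'a) zz \<Rightarrow> 'o" where
  "zsrc (Atom A) = A"
| "zsrc (Plus f Z) = zsrc Z"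
| "zsrc (Minus g Z) = zsrc Z"

fun ztgt :: "('o, 'a) cat \<Rightarrow> ('o, 'a) zz \<Rightarrow> 'o" where
  "ztgt C (Atom A) = A"
| "ztgt C (Plus f Z) = Cod C f"
| "ztgt C (Minus g Z) = Dom C g"

lemma zform_iff: "zform C A Z B \<longleftrightarrow> (\<exists>A' B'. zform C A' Z B') \<and> zsrc Z = A \<and> ztgt C Z = B"
proof -
  have "zsrc Z = A \<and> ztgt C Z = B" if "zform C A Z B" for A B
    using that by (induction rule: zform.induct) (auto simp: hom_def)
  then show ?thesis by blast
qed

text \<open>Derivation terms carry the index arrows of the rules, so that a term determines its
  sequent.\<close>

datatype 'a drv =
    Ax 'a
  | Lp 'a 'a "'a drv"
  | Rp 'a "'a drv"
  | Lm 'a "'a drv"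
  | Rm 'a 'a "'a drv"

text \<open>\<open>deriv C Z h Z' a\<close>: \<open>a\<close> is a derivation of the sequent from \<open>Z\<close> to \<open>Z'\<close> over \<open>h\<close>. The
  well-formedness of the formulas that occur follows, see lemma \<open>deriv_formulas\<close>.\<close>

inductive deriv ::
  "('o, 'a) cat \<Rightarrow> ('o, 'a) zz \<Rightarrow> 'a \<Rightarrow> ('o, 'a) zz \<Rightarrow> 'a drv \<Rightarrow> bool" for C where
  ax: "f \<in> hom C A A' \<Longrightarrow> deriv C (Atom A) f (Atom A') (Ax f)"
| lp: "seq C f g \<Longrightarrow> deriv C S (f \<cdot>\<^bsub>C\<^esub> g) T a \<Longrightarrow> deriv C (Plus f S) g T (Lp f g a)"
| rp: "seq C f' f \<Longrightarrow> deriv C S' f' S a \<Longrightarrow> deriv C S' (f' \<cdot>\<^bsub>C\<^esub> f) (Plus f S) (Rp f a)"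
| lm: "seq C g g' \<Longrightarrow> deriv C T g' T' a \<Longrightarrow> deriv C (Minus g T) (g \<cdot>\<^bsub>C\<^esub> g') T' (Lm g a)"
| rm: "seq C f g \<Longrightarrow> deriv C S (f \<cdot>\<^bsub>C\<^esub> g) T a \<Longrightarrow> deriv C S f (Minus g T) (Rm f g a)"

lemma deriv_formulas:
  assumes "category C" "deriv C Z h Z' a"
  shows "h \<in> Arr C \<and> zform C (zsrc Z) Z (Dom C h) \<and> zform C (zsrc Z') Z' (Cod C h)"
  using assms(2)
proof (induction rule: deriv.induct)
  case (ax f A A')
  then show ?case
    using category.Dom_closed[OF assms(1)] category.Cod_closed[OF assms(1)]
    by (auto simp: hom_def intro: zform.atom)
qed (use category.Comp_closed[OF assms(1)] in
      \<open>auto simp: hom_def seq_def intro!: zform.plus zform.minus\<close>)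

fun axiom_of :: "'a drv \<Rightarrow> 'a" where
  "axiom_of (Ax f) = f"
| "axiom_of (Lp f g a) = axiom_of a"
| "axiom_of (Rp f a) = axiom_of a"
| "axiom_of (Lm g a) = axiom_of a"
| "axiom_of (Rm f g a) = axiom_of a"

text \<open>Permutation equivalence of derivations of the sequent from \<open>Z\<close> to \<open>Z'\<close> over \<open>h\<close>.\<close>

inductive perm ::
  "('o, 'a) cat \<Rightarrow> ('o, 'a) zz \<Rightarrow> 'a \<Rightarrow> ('o, 'a) zz \<Rightarrow> 'a drv \<Rightarrow> 'a drv \<Rightarrow> bool" for C where
  refl: "deriv C Z h Z' a \<Longrightarrow> perm C Z h Z' a a"
| sym: "perm C Z h Z' a b \<Longrightarrow> perm C Z h Z' b a"
| trans: "perm C Z h Z' a b \<Longrightarrow> perm C Z h Z' b c \<Longrightarrow> perm C Z h Z' a c"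
| cong_lp: "seq C f g \<Longrightarrow> perm C S (f \<cdot>\<^bsub>C\<^esub> g) T a b \<Longrightarrow>
    perm C (Plus f S) g T (Lp f g a) (Lp f g b)"
| cong_rp: "seq C f' f \<Longrightarrow> perm C S' f' S a b \<Longrightarrow>
    perm C S' (f' \<cdot>\<^bsub>C\<^esub> f) (Plus f S) (Rp f a) (Rp f b)"
| cong_lm: "seq C g g' \<Longrightarrow> perm C T g' T' a b \<Longrightarrow>
    perm C (Minus g T) (g \<cdot>\<^bsub>C\<^esub> g') T' (Lm g a) (Lm g b)"
| cong_rm: "seq C f g \<Longrightarrow> perm C S (f \<cdot>\<^bsub>C\<^esub> g) T a b \<Longrightarrow>
    perm C S f (Minus g T) (Rm f g a) (Rm f g b)"
| rp_lm: "deriv C Z k Z' (Rp h (Lm f a)) \<Longrightarrow> deriv C Z k Z' (Lm f (Rp h a)) \<Longrightarrow>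
    perm C Z k Z' (Rp h (Lm f a)) (Lm f (Rp h a))"
| rp_lp: "deriv C Z k Z' (Rp h (Lp f g a)) \<Longrightarrow>
    deriv C Z k Z' (Lp f (g \<cdot>\<^bsub>C\<^esub> h) (Rp h a)) \<Longrightarrow>
    perm C Z k Z' (Rp h (Lp f g a)) (Lp f (g \<cdot>\<^bsub>C\<^esub> h) (Rp h a))"
| rm_lm: "deriv C Z k Z' (Rm (f \<cdot>\<^bsub>C\<^esub> g) h (Lm f a)) \<Longrightarrow>
    deriv C Z k Z' (Lm f (Rm g h a)) \<Longrightarrow>
    perm C Z k Z' (Rm (f \<cdot>\<^bsub>C\<^esub> g) h (Lm f a)) (Lm f (Rm g h a))"
| rm_lp: "deriv C Z k Z' (Rm g h (Lp f (g \<cdot>\<^bsub>C\<^esub> h) a)) \<Longrightarrow>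
    deriv C Z k Z' (Lp f g (Rm (f \<cdot>\<^bsub>C\<^esub> g) h a)) \<Longrightarrow>
    perm C Z k Z' (Rm g h (Lp f (g \<cdot>\<^bsub>C\<^esub> h) a)) (Lp f g (Rm (f \<cdot>\<^bsub>C\<^esub> g) h a))"

fun ident_drv :: "('o, 'a) cat \<Rightarrow> ('o, 'a) zz \<Rightarrow> 'a drv" where
  "ident_drv C (Atom A) = Ax (Ident C A)"
| "ident_drv C (Plus f S) = Lp f (Ident C (Cod C f)) (Rp f (ident_drv C S))"
| "ident_drv C (Minus g T) = Rm (Ident C (Dom C g)) g (Lm g (ident_drv C T))"

text \<open>The recursive clauses for cut overlap and agree only up to permutation equivalence, so cut
  is a relation on derivations: \<open>cut C a b c\<close> means that some way of applying the clauses to the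
  cut of \<open>a\<close> and \<open>b\<close> yields \<open>c\<close>.\<close>

inductive cut :: "('o, 'a) cat \<Rightarrow> 'a drv \<Rightarrow> 'a drv \<Rightarrow> 'a drv \<Rightarrow> bool" for C where
  axioms: "seq C f g \<Longrightarrow> cut C (Ax f) (Ax g) (Ax (f \<cdot>\<^bsub>C\<^esub> g))"
| rp_lp: "cut C a b c \<Longrightarrow> cut C (Rp f a) (Lp f h b) c"
| rm_lm: "cut C a b c \<Longrightarrow> cut C (Rm g f a) (Lm f b) c"
| lm: "cut C a b c \<Longrightarrow> cut C (Lm f a) b (Lm f c)"
| lp: "cut C a b c \<Longrightarrow> deriv C Z h Z' b \<Longrightarrow> cut C (Lp f g a) b (Lp f (g \<cdot>\<^bsub>C\<^esub> h) c)"
| rp: "cut C a b c \<Longrightarrow> cut C a (Rp f b) (Rp f c)"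
| rm: "cut C a b c \<Longrightarrow> deriv C Z g Z' a \<Longrightarrow> cut C a (Rm h f b) (Rm (g \<cdot>\<^bsub>C\<^esub> h) f c)"

text \<open>\<open>zsubst Z Z'\<close> substitutes \<open>Z\<close> for the atom of \<open>Z'\<close>, and \<open>dsubst a a'\<close> substitutes \<open>a\<close> for the
  axiom of \<open>a'\<close>.\<close>

fun zsubst :: "('o, 'a) zz \<Rightarrow> ('o, 'a) zz \<Rightarrow> ('o, 'a) zz" where
  "zsubst Z (Atom A) = Z"
| "zsubst Z (Plus f S) = Plus f (zsubst Z S)"
| "zsubst Z (Minus g T) = Minus g (zsubst Z T)"

fun dsubst :: "'a drv \<Rightarrow> 'a drv \<Rightarrow> 'a drv" where
  "dsubst a (Ax f) = a"
| "dsubst a (Lp f g b) = Lp f g (dsubst a b)"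
| "dsubst a (Rp f b) = Rp f (dsubst a b)"
| "dsubst a (Lm g b) = Lm g (dsubst a b)"
| "dsubst a (Rm f g b) = Rm f g (dsubst a b)"


section \<open>The zigzag double category\<close>

text \<open>A cell carries its left, right, top and bottom boundaries together with a permutation class
  of derivations.\<close>

datatype ('o, 'a) zcell =
  ZCell (zleft: "('o, 'a) zz") (zright: "('o, 'a) zz") (ztop: 'a) (zbot: 'a) (zcls: "'a drv set")

definition perm_class ::
  "('o, 'a) cat \<Rightarrow> ('o, 'a) zz \<Rightarrow> 'a \<Rightarrow> ('o, 'a) zz \<Rightarrow> 'a drv \<Rightarrow> 'a drv set" where
  "perm_class C Z h Z' a = {b. perm C Z h Z' a b}"

definition zcell_of ::
  "('o, 'a) cat \<Rightarrow> ('o, 'a) zz \<Rightarrow> 'a \<Rightarrow> ('o, 'a) zz \<Rightarrow> 'a drv \<Rightarrow> ('o, 'a) zcell" where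
  "zcell_of C Z h Z' a = ZCell Z Z' (axiom_of a) h (perm_class C Z h Z' a)"

text \<open>Composites of classes are formed from all representatives and all results of cut, closed
  under permutation equivalence; that the outcome is a single class is part of the closure
  conditions for a double category.\<close>

fun zhcomp ::
  "('o, 'a) cat \<Rightarrow> ('o, 'a) zcell \<Rightarrow> ('o, 'a) zcell \<Rightarrow> ('o, 'a) zcell" where
  "zhcomp C (ZCell Z Z' f g X) (ZCell W W' f' g' Y) =
     ZCell Z W' (f \<cdot>\<^bsub>C\<^esub> f') (g \<cdot>\<^bsub>C\<^esub> g')
       (\<Union>a \<in> X. \<Union>b \<in> Y. \<Union>c \<in> {c. cut C a b c}. perm_class C Z (g \<cdot>\<^bsub>C\<^esub> g') W' c)"

fun zvcomp ::
  "('o, 'a) cat \<Rightarrow> ('o, 'a) zcell \<Rightarrow> ('o, 'a) zcell \<Rightarrow> ('o, 'a) zcell" where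
  "zvcomp C (ZCell Z Z' f g X) (ZCell W W' g' h Y) =
     ZCell (zsubst Z W) (zsubst Z' W') f h
       (\<Union>a \<in> X. \<Union>b \<in> Y. perm_class C (zsubst Z W) h (zsubst Z' W') (dsubst a b))"

definition ZZ1 :: "('o, 'a) cat \<Rightarrow> (('o, 'a) zz, ('o, 'a) zcell) cat" where
  "ZZ1 C =
     \<lparr> Obj = {Z. \<exists>A B. zform C A Z B},
       Arr = {zcell_of C Z h Z' a | Z h Z' a. deriv C Z h Z' a},
       Dom = zleft,
       Cod = zright,
       Ident = (\<lambda>Z. zcell_of C Z (Ident C (ztgt C Z)) Z (ident_drv C Z)),
       Comp = zhcomp C \<rparr>"

definition ZZ :: "('o, 'a) cat \<Rightarrow> ('o, 'a, ('o, 'a) zz, ('o, 'a) zcell) dblcat" where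
  "ZZ C =
     \<lparr> D0 = C,
       D1 = ZZ1 C,
       SrcV = zsrc,
       SrcC = ztop,
       TgtV = ztgt C,
       TgtC = zbot,
       UnitV = Atom,
       UnitC = (\<lambda>f. zcell_of C (Atom (Dom C f)) f (Atom (Cod C f)) (Ax f)),
       VcompV = zsubst,
       VcompC = zvcomp C \<rparr>"

definition ZZ_choice :: "('o, 'a) cat \<Rightarrow> ('a, ('o, 'a) zz, ('o, 'a) zcell) fib_choice" where
  "ZZ_choice C =
     \<lparr> cmpV = (\<lambda>f. Plus f (Atom (Dom C f))),
       cmpC = (\<lambda>f. zcell_of C (Atom (Dom C f)) f (Plus f (Atom (Dom C f)))
                     (Rp f (Ax (Ident C (Dom C f))))),
       cnjV = (\<lambda>f. Minus f (Atom (Cod C f))),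
       cnjC = (\<lambda>f. zcell_of C (Minus f (Atom (Cod C f))) f (Atom (Cod C f))
                     (Lm f (Ax (Ident C (Cod C f))))) \<rparr>"

end

theory Submission
  imports Defs
begin

text \<open>The proof has a syntactic and a semantic half.

  For the syntactic half, the overlapping clauses for cut are resolved by a recursive function
  \<open>cut_drv\<close> that removes left rules of the first argument before right rules of the
  second. The four generating permutations say precisely that right rules of the second argument may
  equally be removed first (\<open>cut_drv_rp\<close>, \<open>cut_drv_rm\<close>). Hence, up to
  permutation equivalence, left rules on the far left and right rules on the far right can always be
  pulled out of a cut, and what remains are principal cuts and cuts of axioms. By this stripping
  argument \<open>cut_drv\<close> respects permutation equivalence (\<open>cut_drv_cong\<close>), is
  associative (\<open>cut_drv_assoc\<close>) and unital (\<open>cut_drv_ident_left\<close>,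
  \<open>cut_drv_ident_right\<close>), and every result of the relation \<open>cut\<close> is
  equivalent to its value (\<open>cut_sound\<close>). Substitution is strictly associative and
  unital on terms, and satisfies the interchange law with cut (\<open>dsubst_interchange\<close>).
  So the zigzag construction is a double category; companions and conjoints are checked directly.

  For the semantic half, each of the four rules corresponds to one cell in a double category with
  chosen companions and conjoints: the composite of a unit cell with a companion or conjoint cell,
  or with a complementary one. A derivation is interpreted by composing vertically, from its axiom
  downwards, the cells of its rules (\<open>cint\<close>). Substitution then becomes vertical
  composition by associativity; the permutations hold because the two vertical composites involved
  both equal one and the same three-cell horizontal composite (\<open>cells_exchange\<close>);
  principal cuts are the equations \<open>\<alpha> \<cdot> \<alpha>' = U\<close> and \<open>\<beta>'
  \<cdot> \<beta> = U\<close> (\<open>cint_cut_drv\<close>); and identity derivations are the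
  equations \<open>\<alpha> \<odot> \<alpha>' = id\<close> and \<open>\<beta> \<odot> \<beta>' =
  id\<close> (\<open>cint_ident\<close>).

  Uniqueness holds because every derivation is built by substitution and cut from axioms, companion
  and conjoint cells and their complementary cells. Any double functor preserves complementary
  cells, since these are determined by the companion or conjoint cell
  (\<open>companion_pair_unique\<close>, \<open>conjoint_pair_unique\<close>).\<close>

section \<open>Sequents and their boundaries\<close>

context category
begin

lemma seqD: "seq C f g \<Longrightarrow> f \<in> Arr C \<and> g \<in> Arr C \<and> Cod C f = Dom C g"
  by (simp add: seq_def)

lemma comp_arr: "seq C f g \<Longrightarrow>
    f \<cdot> g \<in> Arr C \<and> Dom C (f \<cdot> g) = Dom C f \<and> Cod C (f \<cdot> g) = Cod C g"
  using Comp_closed[of f g] by (simp add: hom_def)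

lemma seq_comp_left: "seq C f g \<Longrightarrow> seq C (f \<cdot> g) h \<longleftrightarrow> seq C g h"
  using comp_arr by (auto simp: seq_def)

lemma seq_comp_right: "seq C g h \<Longrightarrow> seq C f (g \<cdot> h) \<longleftrightarrow> seq C f g"
  using comp_arr by (auto simp: seq_def)

lemma ident_arr: "A \<in> Obj C \<Longrightarrow>
    Ident C A \<in> Arr C \<and> Dom C (Ident C A) = A \<and> Cod C (Ident C A) = A"
  using Ident_closed[of A] by (simp add: hom_def)

lemma deriv_bounds:
  assumes "deriv C Z h W a"
  shows "h \<in> Arr C" "Dom C h = ztgt C Z" "Cod C h = ztgt C W"
    "axiom_of a \<in> Arr C" "Dom C (axiom_of a) = zsrc Z" "Cod C (axiom_of a) = zsrc W"
proof -
  have *: "h \<in> Arr C \<and> Dom C h = ztgt C Z \<and> Cod C h = ztgt C W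
    \<and> axiom_of a \<in> Arr C \<and> Dom C (axiom_of a) = zsrc Z \<and> Cod C (axiom_of a) = zsrc W"
    using assms by (induction rule: deriv.induct) (auto simp: hom_def dest: seqD comp_arr)
  show "h \<in> Arr C" "Dom C h = ztgt C Z" "Cod C h = ztgt C W"
    "axiom_of a \<in> Arr C" "Dom C (axiom_of a) = zsrc Z" "Cod C (axiom_of a) = zsrc W"
    using * by blast+
qed

lemma deriv_seq: "deriv C Z h W a \<Longrightarrow> deriv C W k Y b \<Longrightarrow> seq C h k"
  by (simp add: seq_def deriv_bounds)

inductive_cases deriv_AxE: "deriv C Z h W (Ax f)"
inductive_cases deriv_LpE: "deriv C Z h W (Lp f g a)"
inductive_cases deriv_RpE: "deriv C Z h W (Rp f a)"
inductive_cases deriv_LmE: "deriv C Z h W (Lm g a)"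
inductive_cases deriv_RmE: "deriv C Z h W (Rm f g a)"
lemmas deriv_termE = deriv_AxE deriv_LpE deriv_RpE deriv_LmE deriv_RmE

lemma perm_deriv: "perm C Z h W a b \<Longrightarrow> deriv C Z h W a \<and> deriv C Z h W b"
  by (induction rule: perm.induct) (auto intro: deriv.intros)

lemma perm_axiom: "perm C Z h W a b \<Longrightarrow> axiom_of a = axiom_of b"
  by (induction rule: perm.induct) auto

end

section \<open>Cut as an operation on derivations\<close>

text \<open>Whether the last rule of a derivation is a left rule; \<open>ends_right\<close> asks the
  same for right rules. For axioms both are false.\<close>
fun ends_left :: "'a drv \<Rightarrow> bool" where
  "ends_left (Lp f g a) = True" | "ends_left (Lm g a) = True" | "ends_left _ = False"

fun ends_right :: "'a drv \<Rightarrow> bool" where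
  "ends_right (Rp f a) = True" | "ends_right (Rm f g a) = True" | "ends_right _ = False"

text \<open>The arrow that a derivation lies over, computed from the term. It agrees with the index
  of the sequent for derivations (\<open>over_deriv\<close>).\<close>
fun over :: "('o, 'a) cat \<Rightarrow> 'a drv \<Rightarrow> 'a" where
  "over C (Ax f) = f"
| "over C (Lp f g a) = g"
| "over C (Rp f a) = over C a \<cdot>\<^bsub>C\<^esub> f"
| "over C (Lm g a) = g \<cdot>\<^bsub>C\<^esub> over C a"
| "over C (Rm f g a) = f"

text \<open>The result of one particular strategy for cut: left rules of the first derivation are
  moved out first, then right rules of the second. The last clause is a default value, reached only
  by terms whose middle formulas do not match.\<close>
function (sequential) cut_drv :: "('o, 'a) cat \<Rightarrow> 'a drv \<Rightarrow> 'a drv \<Rightarrow> 'a drv" where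
  "cut_drv C (Lp f g a) b = Lp f (g \<cdot>\<^bsub>C\<^esub> over C b) (cut_drv C a b)"
| "cut_drv C (Lm f a) b = Lm f (cut_drv C a b)"
| "cut_drv C a (Rp f b) = Rp f (cut_drv C a b)"
| "cut_drv C a (Rm h f b) = Rm (over C a \<cdot>\<^bsub>C\<^esub> h) f (cut_drv C a b)"
| "cut_drv C (Rp f a) (Lp f' h b) = cut_drv C a b"
| "cut_drv C (Rm g f a) (Lm f' b) = cut_drv C a b"
| "cut_drv C (Ax f) (Ax g) = Ax (f \<cdot>\<^bsub>C\<^esub> g)"
| "cut_drv C a b = a"
  by pat_completeness auto
termination by (relation "measure (\<lambda>(C, a, b). size a + size b)") auto

lemma cut_drv_right:
  assumes "\<not> ends_left a"
  shows "cut_drv C a (Rp f b) = Rp f (cut_drv C a b)"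
    and "cut_drv C a (Rm h f b) = Rm (over C a \<cdot>\<^bsub>C\<^esub> h) f (cut_drv C a b)"
  using assms by (cases a; simp)+

context category
begin

lemma over_deriv: "deriv C Z h W a \<Longrightarrow> over C a = h"
  by (induction rule: deriv.induct) auto

lemma deriv_from_plus:
  assumes "deriv C (Plus f S) k Y b" "\<not> ends_right b"
  obtains b' where "b = Lp f k b'" "seq C f k" "deriv C S (f \<cdot> k) Y b'"
  using assms by (cases b) (auto elim!: deriv_termE)

lemma deriv_from_minus:
  assumes "deriv C (Minus g T) k Y b" "\<not> ends_right b"
  obtains k' b' where "b = Lm g b'" "k = g \<cdot> k'" "seq C g k'" "deriv C T k' Y b'"
  using assms by (cases b) (auto elim!: deriv_termE)

lemma deriv_from_atom:
  assumes "deriv C (Atom A) k Y b" "\<not> ends_right b"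
  obtains "b = Ax k" "k \<in> Arr C" "Dom C k = A" "Y = Atom (Cod C k)"
  using assms by (cases b) (auto simp: hom_def elim!: deriv_termE)

lemma deriv_to_plus:
  assumes "deriv C Z k (Plus f S) b" "\<not> ends_left b"
  obtains k' b' where "b = Rp f b'" "k = k' \<cdot> f" "seq C k' f" "deriv C Z k' S b'"
  using assms by (cases b) (auto elim!: deriv_termE)

lemma deriv_to_minus:
  assumes "deriv C Z k (Minus g T) b" "\<not> ends_left b"
  obtains b' where "b = Rm k g b'" "seq C k g" "deriv C Z (k \<cdot> g) T b'"
  using assms by (cases b) (auto elim!: deriv_termE)

lemma deriv_to_atom:
  assumes "deriv C Z k (Atom A) b" "\<not> ends_left b"
  obtains "b = Ax k" "k \<in> Arr C" "Cod C k = A" "Z = Atom (Dom C k)"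
  using assms by (cases b) (auto simp: hom_def elim!: deriv_termE)

text \<open>Induction along the recursion of \<open>cut_drv\<close>, restricted to derivations that
  share a middle formula. The cases \<open>rp_lp\<close> and \<open>rm_lm\<close> are the principal
  cuts.\<close>
lemma cut_induct [consumes 2, case_names ax lp lm rp rm rp_lp rm_lm]:
  assumes "deriv C Z h W a" "deriv C W k Y b"
    and "\<And>f g. seq C f g \<Longrightarrow>
      P (Atom (Dom C f)) f (Atom (Cod C f)) g (Atom (Cod C g)) (Ax f) (Ax g)"
    and "\<And>S f g W a k Y b. \<lbrakk>seq C f g; deriv C S (f \<cdot> g) W a; deriv C W k Y b;
      P S (f \<cdot> g) W k Y a b\<rbrakk> \<Longrightarrow> P (Plus f S) g W k Y (Lp f g a) b"
    and "\<And>T g h W a k Y b. \<lbrakk>seq C g h; deriv C T h W a; deriv C W k Y b;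
      P T h W k Y a b\<rbrakk> \<Longrightarrow> P (Minus g T) (g \<cdot> h) W k Y (Lm g a) b"
    and "\<And>Z h W a k S f b. \<lbrakk>\<not> ends_left a; seq C k f; deriv C Z h W a; deriv C W k S b;
      P Z h W k S a b\<rbrakk> \<Longrightarrow> P Z h W (k \<cdot> f) (Plus f S) a (Rp f b)"
    and "\<And>Z h W a k g T b. \<lbrakk>\<not> ends_left a; seq C k g; deriv C Z h W a; deriv C W (k \<cdot> g) T b;
      P Z h W (k \<cdot> g) T a b\<rbrakk> \<Longrightarrow> P Z h W k (Minus g T) a (Rm k g b)"
    and "\<And>Z h f S a k Y b. \<lbrakk>seq C h f; seq C f k; deriv C Z h S a; deriv C S (f \<cdot> k) Y b;
      P Z h S (f \<cdot> k) Y a b\<rbrakk> \<Longrightarrow> P Z (h \<cdot> f) (Plus f S) k Y (Rp f a) (Lp f k b)"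
    and "\<And>Z h g T a k Y b. \<lbrakk>seq C h g; seq C g k; deriv C Z (h \<cdot> g) T a; deriv C T k Y b;
      P Z (h \<cdot> g) T k Y a b\<rbrakk> \<Longrightarrow> P Z h (Minus g T) (g \<cdot> k) Y (Rm h g a) (Lm g b)"
  shows "P Z h W k Y a b"
  using assms(1,2)
proof (induction "size a + size b" arbitrary: Z h W k Y a b rule: less_induct)
  case less
  note IH = less.hyps and a = less.prems(1) and b = less.prems(2)
  consider "ends_left a" | "\<not> ends_left a" "ends_right b" | "\<not> ends_left a" "\<not> ends_right b"
    by blast
  then show ?case
  proof cases
    case 1
    from a show ?thesis
    proof cases
      case (lp f S a')
      then show ?thesis using IH[of a' b] b by (auto intro!: assms(4))
    next
      case (lm g g' T a')
      then show ?thesis using IH[of a' b] b by (auto intro!: assms(5))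
    qed (use 1 in auto)
  next
    case 2
    from b show ?thesis
    proof cases
      case (rp k' f S b')
      then show ?thesis using IH[of a b'] a 2 by (auto intro!: assms(6))
    next
      case (rm g T b')
      then show ?thesis using IH[of a b'] a 2 by (auto intro!: assms(7))
    qed (use 2 in auto)
  next
    case 3
    show ?thesis
    proof (cases W)
      case (Atom A)
      have 1: "a = Ax h" "Z = Atom (Dom C h)" "h \<in> Arr C" "Cod C h = A"
        using deriv_to_atom[OF a[unfolded Atom] 3(1)] by blast+
      have 2: "b = Ax k" "Y = Atom (Cod C k)" "k \<in> Arr C" "Dom C k = A"
        using deriv_from_atom[OF b[unfolded Atom] 3(2)] by blast+
      show ?thesis using assms(3)[of h k] 1 2 Atom by (simp add: seq_def)
    next
      case (Plus f S)
      obtain h' a' where 1: "a = Rp f a'" "h = h' \<cdot> f" "seq C h' f" "deriv C Z h' S a'"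
        using deriv_to_plus[OF a[unfolded Plus] 3(1)] by blast
      obtain b' where 2: "b = Lp f k b'" "seq C f k" "deriv C S (f \<cdot> k) Y b'"
        using deriv_from_plus[OF b[unfolded Plus] 3(2)] by blast
      show ?thesis using assms(8) 1 2 Plus IH[OF _ 1(4) 2(3)] by simp
    next
      case (Minus g T)
      obtain a' where 1: "a = Rm h g a'" "seq C h g" "deriv C Z (h \<cdot> g) T a'"
        using deriv_to_minus[OF a[unfolded Minus] 3(1)] by blast
      obtain k' b' where 2: "b = Lm g b'" "k = g \<cdot> k'" "seq C g k'" "deriv C T k' Y b'"
        using deriv_from_minus[OF b[unfolded Minus] 3(2)] by blast
      show ?thesis using assms(9) 1 2 Minus IH[OF _ 1(3) 2(4)] by simp
    qed
  qed
qed

lemma cut_drv_deriv: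
  "deriv C Z h W a \<Longrightarrow> deriv C W k Y b \<Longrightarrow> deriv C Z (h \<cdot> k) Y (cut_drv C a b)"
proof (induction rule: cut_induct)
  case (ax f g)
  then show ?case using comp_arr[OF ax] by (auto simp: hom_def seq_def intro!: deriv.ax)
next
  case (lp S f g W a k Y b)
  then have "seq C g k" using deriv_seq seq_comp_left by blast
  then show ?case using lp
    by (auto simp: over_deriv Comp_assoc seq_comp_right seq_comp_left intro!: deriv.lp)
next
  case (lm T g h W a k Y b)
  then have "seq C h k" using deriv_seq by blast
  then show ?case using lm
    by (auto simp: over_deriv Comp_assoc seq_comp_right seq_comp_left intro!: deriv.lm)
next
  case (rp Z h W a k S f b)
  then have s: "seq C h k" using deriv_seq by blast
  show ?case using rp s deriv.rp[of C "h \<cdot> k" f Z S "cut_drv C a b"]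
    by (simp add: cut_drv_right Comp_assoc seq_comp_left)
next
  case (rm Z h W a k g T b)
  then have "seq C h k" using deriv_seq seq_comp_right by blast
  then show ?case using rm
    by (auto simp: cut_drv_right over_deriv Comp_assoc seq_comp_right seq_comp_left intro!: deriv.rm)
qed (auto simp: Comp_assoc)

section \<open>Cut and permutation equivalence\<close>

text \<open>In each of the four permutations below, the hypotheses are exactly what makes both sides
  derivable.\<close>
lemma perm_rp_lm:
  assumes "seq C f g" "seq C g h" "deriv C T g W a"
  shows "perm C (Minus f T) (f \<cdot> (g \<cdot> h)) (Plus h W) (Rp h (Lm f a)) (Lm f (Rp h a))"
proof (rule perm.rp_lm)
  show "deriv C (Minus f T) (f \<cdot> (g \<cdot> h)) (Plus h W) (Lm f (Rp h a))"
    using assms by (auto simp: seq_comp_right intro!: deriv.intros)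
  have "deriv C (Minus f T) ((f \<cdot> g) \<cdot> h) (Plus h W) (Rp h (Lm f a))"
    using assms by (auto simp: seq_comp_left intro!: deriv.intros)
  then show "deriv C (Minus f T) (f \<cdot> (g \<cdot> h)) (Plus h W) (Rp h (Lm f a))"
    using assms by (simp add: Comp_assoc)
qed

lemma perm_rp_lp:
  assumes "seq C f g" "seq C g h" "deriv C S (f \<cdot> g) W a"
  shows "perm C (Plus f S) (g \<cdot> h) (Plus h W) (Rp h (Lp f g a)) (Lp f (g \<cdot> h) (Rp h a))"
proof (rule perm.rp_lp)
  show "deriv C (Plus f S) (g \<cdot> h) (Plus h W) (Rp h (Lp f g a))"
    using assms by (auto intro!: deriv.intros)
  have "deriv C S ((f \<cdot> g) \<cdot> h) (Plus h W) (Rp h a)"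
    using assms by (auto simp: seq_comp_left intro!: deriv.rp)
  then show "deriv C (Plus f S) (g \<cdot> h) (Plus h W) (Lp f (g \<cdot> h) (Rp h a))"
    using assms by (auto simp: seq_comp_right Comp_assoc intro!: deriv.lp)
qed

lemma perm_rm_lm:
  assumes "seq C f g" "seq C g h" "deriv C T (g \<cdot> h) W a"
  shows "perm C (Minus f T) (f \<cdot> g) (Minus h W) (Rm (f \<cdot> g) h (Lm f a)) (Lm f (Rm g h a))"
proof (rule perm.rm_lm)
  show "deriv C (Minus f T) (f \<cdot> g) (Minus h W) (Lm f (Rm g h a))"
    using assms by (auto intro!: deriv.intros)
  have "deriv C (Minus f T) (f \<cdot> (g \<cdot> h)) W (Lm f a)"
    using assms by (auto simp: seq_comp_right intro!: deriv.lm)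
  then show "deriv C (Minus f T) (f \<cdot> g) (Minus h W) (Rm (f \<cdot> g) h (Lm f a))"
    using assms by (auto simp: seq_comp_left Comp_assoc intro!: deriv.rm)
qed

lemma perm_rm_lp:
  assumes "seq C f g" "seq C g h" "deriv C S (f \<cdot> (g \<cdot> h)) W a"
  shows "perm C (Plus f S) g (Minus h W)
    (Rm g h (Lp f (g \<cdot> h) a)) (Lp f g (Rm (f \<cdot> g) h a))"
proof (rule perm.rm_lp)
  show "deriv C (Plus f S) g (Minus h W) (Rm g h (Lp f (g \<cdot> h) a))"
    using assms by (auto simp: seq_comp_right intro!: deriv.intros)
  show "deriv C (Plus f S) g (Minus h W) (Lp f g (Rm (f \<cdot> g) h a))"
    using assms by (auto simp: seq_comp_left Comp_assoc intro!: deriv.intros)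
qed

text \<open>Induction on permutation equivalence with the sequents of the four permutations spelled
  out.\<close>
lemma perm_induct [consumes 1, case_names refl sym trans cong_lp cong_rp cong_lm cong_rm
    rp_lm rp_lp rm_lm rm_lp]:
  assumes "perm C Z k W a b"
    and "\<And>Z k W a. deriv C Z k W a \<Longrightarrow> P Z k W a a"
    and "\<And>Z k W a b. \<lbrakk>perm C Z k W a b; P Z k W a b\<rbrakk> \<Longrightarrow> P Z k W b a"
    and "\<And>Z k W a b c. \<lbrakk>perm C Z k W a b; perm C Z k W b c; P Z k W a b; P Z k W b c\<rbrakk>
      \<Longrightarrow> P Z k W a c"
    and "\<And>f g S W a b. \<lbrakk>seq C f g; perm C S (f \<cdot> g) W a b; P S (f \<cdot> g) W a b\<rbrakk>
      \<Longrightarrow> P (Plus f S) g W (Lp f g a) (Lp f g b)"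
    and "\<And>k f Z S a b. \<lbrakk>seq C k f; perm C Z k S a b; P Z k S a b\<rbrakk>
      \<Longrightarrow> P Z (k \<cdot> f) (Plus f S) (Rp f a) (Rp f b)"
    and "\<And>g k T W a b. \<lbrakk>seq C g k; perm C T k W a b; P T k W a b\<rbrakk>
      \<Longrightarrow> P (Minus g T) (g \<cdot> k) W (Lm g a) (Lm g b)"
    and "\<And>f g Z T a b. \<lbrakk>seq C f g; perm C Z (f \<cdot> g) T a b; P Z (f \<cdot> g) T a b\<rbrakk>
      \<Longrightarrow> P Z f (Minus g T) (Rm f g a) (Rm f g b)"
    and "\<And>f g h T W a. \<lbrakk>seq C f g; seq C g h; deriv C T g W a\<rbrakk>
      \<Longrightarrow> P (Minus f T) (f \<cdot> (g \<cdot> h)) (Plus h W) (Rp h (Lm f a)) (Lm f (Rp h a))"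
    and "\<And>f g h S W a. \<lbrakk>seq C f g; seq C g h; deriv C S (f \<cdot> g) W a\<rbrakk>
      \<Longrightarrow> P (Plus f S) (g \<cdot> h) (Plus h W) (Rp h (Lp f g a)) (Lp f (g \<cdot> h) (Rp h a))"
    and "\<And>f g h T W a. \<lbrakk>seq C f g; seq C g h; deriv C T (g \<cdot> h) W a\<rbrakk>
      \<Longrightarrow> P (Minus f T) (f \<cdot> g) (Minus h W) (Rm (f \<cdot> g) h (Lm f a)) (Lm f (Rm g h a))"
    and "\<And>f g h S W a. \<lbrakk>seq C f g; seq C g h; deriv C S (f \<cdot> (g \<cdot> h)) W a\<rbrakk>
      \<Longrightarrow> P (Plus f S) g (Minus h W) (Rm g h (Lp f (g \<cdot> h) a)) (Lp f g (Rm (f \<cdot> g) h a))"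
  shows "P Z k W a b"
  using assms(1)
proof (induction rule: perm.induct)
  case (rp_lm Z k W h f a)
  from rp_lm(1) obtain g T S where "Z = Minus f T" "W = Plus h S" "k = (f \<cdot> g) \<cdot> h"
    "seq C f g" "seq C (f \<cdot> g) h" "deriv C T g S a"
    by (auto elim!: deriv_RpE deriv_LmE)
  then show ?case using assms(9)[of f g h T S a] by (simp add: seq_comp_left Comp_assoc)
next
  case (rp_lp Z k W h f g a)
  from rp_lp(1) obtain T S where "Z = Plus f S" "W = Plus h T" "k = g \<cdot> h"
    "seq C f g" "seq C g h" "deriv C S (f \<cdot> g) T a"
    by (auto elim!: deriv_RpE deriv_LpE)
  then show ?case using assms(10)[of f g h S T a] by simp
next
  case (rm_lm Z k W f g h a)
  from rm_lm(2) obtain T S where "Z = Minus f T" "W = Minus h S" "k = f \<cdot> g"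
    "seq C f g" "seq C g h" "deriv C T (g \<cdot> h) S a"
    by (auto elim!: deriv_RmE deriv_LmE)
  then show ?case using assms(11)[of f g h T S a] by simp
next
  case (rm_lp Z k W g h f a)
  from rm_lp(1) obtain T S where "Z = Plus f S" "W = Minus h T" "k = g"
    "seq C f (g \<cdot> h)" "seq C g h" "deriv C S (f \<cdot> (g \<cdot> h)) T a"
    by (auto elim!: deriv_RmE deriv_LpE)
  then show ?case using assms(12)[of f g h S T a] by (simp add: seq_comp_right)
next
  case refl then show ?case by (rule assms(2))
next
  case sym then show ?case by (rule assms(3))
next
  case trans then show ?case by (rule assms(4))
next
  case cong_lp then show ?case by (rule assms(5))
next
  case cong_rp then show ?case by (rule assms(6))
next
  case cong_lm then show ?case by (rule assms(7))
next
  case cong_rm then show ?case by (rule assms(8))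
qed

text \<open>A right rule of the second derivation may be moved out of a cut even when the first
  derivation ends with left rules. This lemma and the next are where the permutations are
  needed.\<close>
lemma cut_drv_rp:
  "deriv C Z h W a \<Longrightarrow> deriv C W k S b \<Longrightarrow> seq C k f \<Longrightarrow>
    perm C Z (h \<cdot> (k \<cdot> f)) (Plus f S) (cut_drv C a (Rp f b)) (Rp f (cut_drv C a b))"
proof (induction rule: deriv.induct)
  case (lp f' g Z W a)
  have d: "deriv C (Plus f' Z) g W (Lp f' g a)" using lp by (auto intro: deriv.lp)
  have s: "seq C g k" using deriv_seq[OF d] lp by blast
  have "perm C Z (f' \<cdot> (g \<cdot> (k \<cdot> f))) (Plus f S) (cut_drv C a (Rp f b)) (Rp f (cut_drv C a b))"
    using lp s by (simp add: Comp_assoc seq_comp_right)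
  then have 1: "perm C (Plus f' Z) (g \<cdot> (k \<cdot> f)) (Plus f S)
      (Lp f' (g \<cdot> (k \<cdot> f)) (cut_drv C a (Rp f b))) (Lp f' (g \<cdot> (k \<cdot> f)) (Rp f (cut_drv C a b)))"
    using lp s by (intro perm.cong_lp) (auto simp: seq_comp_right)
  have "deriv C Z (f' \<cdot> (g \<cdot> k)) S (cut_drv C a b)"
    using cut_drv_deriv[OF lp(2,4)] lp s by (simp add: Comp_assoc)
  then have 2: "perm C (Plus f' Z) (g \<cdot> (k \<cdot> f)) (Plus f S)
      (Rp f (Lp f' (g \<cdot> k) (cut_drv C a b))) (Lp f' (g \<cdot> (k \<cdot> f)) (Rp f (cut_drv C a b)))"
    using perm_rp_lp[of f' "g \<cdot> k" f Z S "cut_drv C a b"] lp s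
    by (simp add: Comp_assoc seq_comp_right seq_comp_left)
  show ?case using perm.trans[OF 1 perm.sym[OF 2]] lp(4,5)
    by (simp add: over_deriv)
next
  case (lm g g' Z W a)
  have s: "seq C g' k" using deriv_seq lm by blast
  have 1: "perm C (Minus g Z) (g \<cdot> (g' \<cdot> (k \<cdot> f))) (Plus f S)
      (Lm g (cut_drv C a (Rp f b))) (Lm g (Rp f (cut_drv C a b)))"
    using lm s by (intro perm.cong_lm) (auto simp: seq_comp_right)
  have 2: "perm C (Minus g Z) (g \<cdot> (g' \<cdot> (k \<cdot> f))) (Plus f S)
      (Rp f (Lm g (cut_drv C a b))) (Lm g (Rp f (cut_drv C a b)))"
    using perm_rp_lm[OF _ _ cut_drv_deriv[OF lm(2,4)], of g f] lm s
    by (simp add: Comp_assoc seq_comp_right seq_comp_left)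
  show ?case using perm.trans[OF 1 perm.sym[OF 2]] lm s
    by (simp add: Comp_assoc seq_comp_right)
next
  case (ax f' A A')
  have "deriv C (Atom A) f' (Atom A') (Ax f')" using ax by (auto intro: deriv.ax)
  then show ?case using cut_drv_deriv[OF _ deriv.rp[of C k f "Atom A'" S b]] ax
    by (fastforce intro!: perm.refl)
next
  case (rp k' f' Z S' a)
  have "deriv C Z (k' \<cdot> f') (Plus f' S') (Rp f' a)" using rp by (auto intro: deriv.rp)
  from cut_drv_deriv[OF this deriv.rp[of C k f _ S b]] rp show ?case
    by (fastforce intro!: perm.refl)
next
  case (rm k' g' Z T a)
  have "deriv C Z k' (Minus g' T) (Rm k' g' a)" using rm by (auto intro: deriv.rm)
  from cut_drv_deriv[OF this deriv.rp[of C k f _ S b]] rm show ?case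
    by (fastforce intro!: perm.refl)
qed

lemma cut_drv_rm:
  "deriv C Z h W a \<Longrightarrow> seq C k f \<Longrightarrow> deriv C W (k \<cdot> f) S b \<Longrightarrow>
    perm C Z (h \<cdot> k) (Minus f S) (cut_drv C a (Rm k f b)) (Rm (h \<cdot> k) f (cut_drv C a b))"
proof (induction rule: deriv.induct)
  case (lp f' g Z W a)
  have d: "deriv C (Plus f' Z) g W (Lp f' g a)" using lp by (auto intro: deriv.lp)
  have s: "seq C g k" using deriv_seq[OF d] lp seq_comp_right by blast
  have "perm C Z (f' \<cdot> (g \<cdot> k)) (Minus f S) (cut_drv C a (Rm k f b))
      (Rm ((f' \<cdot> (g \<cdot> k))) f (cut_drv C a b))"
    using lp s by (simp add: Comp_assoc seq_comp_right)
  then have 1: "perm C (Plus f' Z) (g \<cdot> k) (Minus f S)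
      (Lp f' (g \<cdot> k) (cut_drv C a (Rm k f b))) (Lp f' (g \<cdot> k) (Rm (f' \<cdot> (g \<cdot> k)) f (cut_drv C a b)))"
    using lp s by (intro perm.cong_lp) (auto simp: seq_comp_right)
  have "deriv C Z (f' \<cdot> (g \<cdot> (k \<cdot> f))) S (cut_drv C a b)"
    using cut_drv_deriv[OF lp(2,5)] lp s by (simp add: Comp_assoc seq_comp_right)
  then have 2: "perm C (Plus f' Z) (g \<cdot> k) (Minus f S)
      (Rm (g \<cdot> k) f (Lp f' (g \<cdot> (k \<cdot> f)) (cut_drv C a b)))
      (Lp f' (g \<cdot> k) (Rm (f' \<cdot> (g \<cdot> k)) f (cut_drv C a b)))"
    using perm_rm_lp[of f' "g \<cdot> k" f Z S "cut_drv C a b"] lp s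
    by (simp add: Comp_assoc seq_comp_right seq_comp_left)
  show ?case using perm.trans[OF 1 perm.sym[OF 2]] lp(4,5)
    by (simp add: over_deriv)
next
  case (lm g g' Z W a)
  have s: "seq C g' k" using deriv_seq lm seq_comp_right by blast
  have 1: "perm C (Minus g Z) (g \<cdot> (g' \<cdot> k)) (Minus f S)
      (Lm g (cut_drv C a (Rm k f b))) (Lm g (Rm (g' \<cdot> k) f (cut_drv C a b)))"
    using lm s by (intro perm.cong_lm) (auto simp: seq_comp_right)
  have "deriv C Z ((g' \<cdot> k) \<cdot> f) S (cut_drv C a b)"
    using cut_drv_deriv[OF lm(2,5)] lm s by (simp add: Comp_assoc)
  then have 2: "perm C (Minus g Z) (g \<cdot> (g' \<cdot> k)) (Minus f S)
      (Rm (g \<cdot> (g' \<cdot> k)) f (Lm g (cut_drv C a b))) (Lm g (Rm (g' \<cdot> k) f (cut_drv C a b)))"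
    using perm_rm_lm[of g "g' \<cdot> k" f] lm s
    by (simp add: seq_comp_right seq_comp_left)
  show ?case using perm.trans[OF 1 perm.sym[OF 2]] lm s
    by (simp add: Comp_assoc over_deriv)
next
  case (ax f' A A')
  have d: "deriv C (Atom A) f' (Atom A') (Ax f')" using ax by (auto intro: deriv.ax)
  show ?case using cut_drv_deriv[OF d deriv.rm[of C k f _ S b]] ax
    by (fastforce intro!: perm.refl)
next
  case (rp k' f' Z S' a)
  have d: "deriv C Z (k' \<cdot> f') (Plus f' S') (Rp f' a)" using rp by (auto intro: deriv.rp)
  from cut_drv_deriv[OF d deriv.rm[of C k f _ S b]] rp over_deriv[OF d] show ?case
    by (fastforce intro!: perm.refl)
next
  case (rm k' g' Z T a)
  have d: "deriv C Z k' (Minus g' T) (Rm k' g' a)" using rm by (auto intro: deriv.rm)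
  from cut_drv_deriv[OF d deriv.rm[of C k f _ S b]] rm over_deriv[OF d] show ?case
    by (fastforce intro!: perm.refl)
qed

text \<open>To compare cuts of two derivations with the same third, it suffices to consider a third
  derivation that does not end with a right rule. It is then an axiom or ends with the left rule
  determined by the middle formula.\<close>
lemma cut_strip_right:
  assumes a: "deriv C Z h W a" and a': "deriv C Z h W a'"
    and base: "\<And>k Y b. deriv C W k Y b \<Longrightarrow> \<not> ends_right b \<Longrightarrow>
      perm C Z (h \<cdot> k) Y (cut_drv C a b) (cut_drv C a' b)"
    and b: "deriv C W k Y b"
  shows "perm C Z (h \<cdot> k) Y (cut_drv C a b) (cut_drv C a' b)"
  using b a a' base
proof (induction rule: deriv.induct)
  case (rp k f W S b)
  have s: "seq C h k" using deriv_seq rp by blast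
  have "perm C Z (h \<cdot> k) S (cut_drv C a b) (cut_drv C a' b)" using rp by blast
  then have "perm C Z (h \<cdot> k \<cdot> f) (Plus f S) (Rp f (cut_drv C a b)) (Rp f (cut_drv C a' b))"
    using rp(1) s by (intro perm.cong_rp) (auto simp: seq_comp_left)
  then show ?case
    using cut_drv_rp[OF rp(4,2,1)] cut_drv_rp[OF rp(5,2,1)] rp(1) s
    by (metis Comp_assoc perm.sym perm.trans)
next
  case (rm k g W T b)
  have s: "seq C h k" using deriv_seq rm seq_comp_right by blast
  have "perm C Z (h \<cdot> (k \<cdot> g)) T (cut_drv C a b) (cut_drv C a' b)" using rm by blast
  then have "perm C Z (h \<cdot> k) (Minus g T) (Rm (h \<cdot> k) g (cut_drv C a b)) (Rm (h \<cdot> k) g (cut_drv C a' b))"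
    using rm(1) s by (intro perm.cong_rm) (auto simp: seq_comp_left Comp_assoc)
  then show ?case
    using cut_drv_rm[OF rm(4,1,2)] cut_drv_rm[OF rm(5,1,2)]
    by (metis perm.sym perm.trans)
next
  case ax
  show ?case by (rule ax(4)[OF deriv.ax[OF ax(1)]]) simp
next
  case lp
  show ?case by (rule lp(6)[OF deriv.lp[OF lp(1,2)]]) simp
next
  case lm
  show ?case by (rule lm(6)[OF deriv.lm[OF lm(1,2)]]) simp
qed

lemma cut_drv_cong_left:
  "perm C Z h W a a' \<Longrightarrow> deriv C W k Y b \<Longrightarrow>
    perm C Z (h \<cdot> k) Y (cut_drv C a b) (cut_drv C a' b)"
proof (induction arbitrary: k Y b rule: perm_induct)
  case (refl Z k W a)
  then show ?case by (auto intro: perm.refl cut_drv_deriv)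
next
  case sym then show ?case by (blast intro: perm.sym)
next
  case trans then show ?case by (blast intro: perm.trans)
next
  case (cong_lp f g S W a a')
  have d: "deriv C (Plus f S) g W (Lp f g a)" using cong_lp perm_deriv by (blast intro: deriv.lp)
  have "seq C g k" using deriv_seq[OF d] cong_lp by blast
  then show ?case using cong_lp(1,2) cong_lp.prems cong_lp.IH[OF cong_lp.prems]
    by (auto simp: over_deriv Comp_assoc seq_comp_right intro!: perm.cong_lp)
next
  case (cong_lm g h T W a a')
  have "seq C h k" using deriv_seq cong_lm perm_deriv by blast
  then show ?case using cong_lm(1,2) cong_lm.prems cong_lm.IH[OF cong_lm.prems]
    by (auto simp: Comp_assoc seq_comp_right intro!: perm.cong_lm)
next
  case (cong_rp h f Z S a a')
  show ?case
  proof (rule cut_strip_right[OF _ _ _ cong_rp.prems])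
    fix k Y b assume "deriv C (Plus f S) k Y b" "\<not> ends_right b"
    then obtain b' where "b = Lp f k b'" "seq C f k" "deriv C S (f \<cdot> k) Y b'"
      using deriv_from_plus by blast
    then show "perm C Z (h \<cdot> f \<cdot> k) Y (cut_drv C (Rp f a) b) (cut_drv C (Rp f a') b)"
      using cong_rp by (simp add: Comp_assoc)
  qed (use cong_rp perm_deriv in \<open>blast intro: deriv.rp\<close>)+
next
  case (cong_rm h f Z S a a')
  show ?case
  proof (rule cut_strip_right[OF _ _ _ cong_rm.prems])
    fix k Y b assume "deriv C (Minus f S) k Y b" "\<not> ends_right b"
    then obtain k' b' where "b = Lm f b'" "k = f \<cdot> k'" "seq C f k'" "deriv C S k' Y b'"
      using deriv_from_minus by blast
    then show "perm C Z (h \<cdot> k) Y (cut_drv C (Rm h f a) b) (cut_drv C (Rm h f a') b)"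
      using cong_rm by (simp add: Comp_assoc[symmetric])
  qed (use cong_rm perm_deriv in \<open>blast intro: deriv.rm\<close>)+
next
  case (rp_lm f g h T W a)
  note d = perm_deriv[OF perm_rp_lm[OF rp_lm(1-3)]]
  show ?case
  proof (rule cut_strip_right[OF _ _ _ rp_lm.prems])
    fix k Y b assume b: "deriv C (Plus h W) k Y b" "\<not> ends_right b"
    then obtain b' where "b = Lp h k b'" using deriv_from_plus by blast
    then have eq: "cut_drv C (Rp h (Lm f a)) b = cut_drv C (Lm f (Rp h a)) b" by simp
    show "perm C (Minus f T) (f \<cdot> (g \<cdot> h) \<cdot> k) Y
      (cut_drv C (Rp h (Lm f a)) b) (cut_drv C (Lm f (Rp h a)) b)"
      unfolding eq using cut_drv_deriv d b by (blast intro: perm.refl)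
  qed (use d in blast)+
next
  case (rp_lp f g h S W a)
  note d = perm_deriv[OF perm_rp_lp[OF rp_lp(1-3)]]
  show ?case
  proof (rule cut_strip_right[OF _ _ _ rp_lp.prems])
    fix k Y b assume b: "deriv C (Plus h W) k Y b" "\<not> ends_right b"
    then obtain b' where "b = Lp h k b'" "seq C h k" "deriv C W (h \<cdot> k) Y b'"
      using deriv_from_plus by blast
    then have eq: "cut_drv C (Rp h (Lp f g a)) b = cut_drv C (Lp f (g \<cdot> h) (Rp h a)) b"
      using rp_lp by (simp add: over_deriv Comp_assoc)
    show "perm C (Plus f S) (g \<cdot> h \<cdot> k) Y
      (cut_drv C (Rp h (Lp f g a)) b) (cut_drv C (Lp f (g \<cdot> h) (Rp h a)) b)"
      unfolding eq using cut_drv_deriv d b by (blast intro: perm.refl)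
  qed (use d in blast)+
next
  case (rm_lm f g h T W a)
  note d = perm_deriv[OF perm_rm_lm[OF rm_lm(1-3)]]
  show ?case
  proof (rule cut_strip_right[OF _ _ _ rm_lm.prems])
    fix k Y b assume b: "deriv C (Minus h W) k Y b" "\<not> ends_right b"
    then obtain b' where "b = Lm h b'" using deriv_from_minus by blast
    then have eq: "cut_drv C (Rm (f \<cdot> g) h (Lm f a)) b = cut_drv C (Lm f (Rm g h a)) b" by simp
    show "perm C (Minus f T) (f \<cdot> g \<cdot> k) Y
      (cut_drv C (Rm (f \<cdot> g) h (Lm f a)) b) (cut_drv C (Lm f (Rm g h a)) b)"
      unfolding eq using cut_drv_deriv d b by (blast intro: perm.refl)
  qed (use d in blast)+
next
  case (rm_lp f g h S W a)
  note d = perm_deriv[OF perm_rm_lp[OF rm_lp(1-3)]]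
  show ?case
  proof (rule cut_strip_right[OF _ _ _ rm_lp.prems])
    fix k Y b assume b: "deriv C (Minus h W) k Y b" "\<not> ends_right b"
    then obtain k' b' where "b = Lm h b'" "k = h \<cdot> k'" "seq C h k'" "deriv C W k' Y b'"
      using deriv_from_minus by blast
    then have eq: "cut_drv C (Rm g h (Lp f (g \<cdot> h) a)) b = cut_drv C (Lp f g (Rm (f \<cdot> g) h a)) b"
      using rm_lp by (simp add: over_deriv Comp_assoc)
    show "perm C (Plus f S) (g \<cdot> k) Y
      (cut_drv C (Rm g h (Lp f (g \<cdot> h) a)) b) (cut_drv C (Lp f g (Rm (f \<cdot> g) h a)) b)"
      unfolding eq using cut_drv_deriv d b by (blast intro: perm.refl)
  qed (use d in blast)+
qed

lemma cut_strip_left: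
  assumes b: "deriv C W k Y b" and b': "deriv C W k Y b'"
    and base: "\<And>Z h a. deriv C Z h W a \<Longrightarrow> \<not> ends_left a \<Longrightarrow>
      perm C Z (h \<cdot> k) Y (cut_drv C a b) (cut_drv C a b')"
    and a: "deriv C Z h W a"
  shows "perm C Z (h \<cdot> k) Y (cut_drv C a b) (cut_drv C a b')"
  using a b b' base
proof (induction rule: deriv.induct)
  case (lp f g Z W a)
  have d: "deriv C (Plus f Z) g W (Lp f g a)" using lp by (blast intro: deriv.lp)
  have "seq C g k" using deriv_seq[OF d] lp by blast
  then show ?case using lp
    by (auto simp: over_deriv Comp_assoc seq_comp_right intro!: perm.cong_lp)
next
  case (lm g h T W a)
  have "seq C h k" using deriv_seq lm by blast
  then show ?case using lm
    by (auto simp: Comp_assoc seq_comp_right intro!: perm.cong_lm)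
next
  case ax
  show ?case by (rule ax(4)[OF deriv.ax[OF ax(1)]]) simp
next
  case rp
  show ?case by (rule rp(6)[OF deriv.rp[OF rp(1,2)]]) simp
next
  case rm
  show ?case by (rule rm(6)[OF deriv.rm[OF rm(1,2)]]) simp
qed

lemma cut_drv_cong_right:
  "perm C W k Y b b' \<Longrightarrow> deriv C Z h W a \<Longrightarrow>
    perm C Z (h \<cdot> k) Y (cut_drv C a b) (cut_drv C a b')"
proof (induction arbitrary: h Z a rule: perm_induct)
  case (refl W k Y b)
  then show ?case by (auto intro: perm.refl cut_drv_deriv)
next
  case sym then show ?case by (blast intro: perm.sym)
next
  case trans then show ?case by (blast intro: perm.trans)
next
  case (cong_lp f g S Y b b')
  show ?case
  proof (rule cut_strip_left[OF _ _ _ cong_lp.prems])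
    fix Z h a assume "deriv C Z h (Plus f S) a" "\<not> ends_left a"
    then obtain h' a' where "a = Rp f a'" "h = h' \<cdot> f" "seq C h' f" "deriv C Z h' S a'"
      using deriv_to_plus by blast
    then show "perm C Z (h \<cdot> g) Y (cut_drv C a (Lp f g b)) (cut_drv C a (Lp f g b'))"
      using cong_lp by (simp add: Comp_assoc)
  qed (use cong_lp perm_deriv in \<open>blast intro: deriv.lp\<close>)+
next
  case (cong_lm g k T Y b b')
  show ?case
  proof (rule cut_strip_left[OF _ _ _ cong_lm.prems])
    fix Z h a assume "deriv C Z h (Minus g T) a" "\<not> ends_left a"
    then obtain a' where "a = Rm h g a'" "seq C h g" "deriv C Z (h \<cdot> g) T a'"
      using deriv_to_minus by blast
    then show "perm C Z (h \<cdot> (g \<cdot> k)) Y (cut_drv C a (Lm g b)) (cut_drv C a (Lm g b'))"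
      using cong_lm by (simp add: Comp_assoc[symmetric])
  qed (use cong_lm perm_deriv in \<open>blast intro: deriv.lm\<close>)+
next
  case (cong_rp k f W S b b')
  have s: "seq C h k" using deriv_seq cong_rp perm_deriv by blast
  have d: "deriv C W k S b" "deriv C W k S b'" using cong_rp perm_deriv by blast+
  have "perm C Z (h \<cdot> k \<cdot> f) (Plus f S) (Rp f (cut_drv C a b)) (Rp f (cut_drv C a b'))"
    using cong_rp s by (intro perm.cong_rp) (auto simp: seq_comp_left)
  then show ?case
    using cut_drv_rp[OF cong_rp.prems d(1) cong_rp(1)] cut_drv_rp[OF cong_rp.prems d(2) cong_rp(1)]
      cong_rp(1) s by (metis Comp_assoc perm.sym perm.trans)
next
  case (cong_rm k g W T b b')
  have d: "deriv C W (k \<cdot> g) T b" "deriv C W (k \<cdot> g) T b'" using cong_rm perm_deriv by blast+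
  have s: "seq C h k" using deriv_seq[OF cong_rm.prems d(1)] cong_rm(1) seq_comp_right by blast
  have "perm C Z (h \<cdot> k) (Minus g T) (Rm (h \<cdot> k) g (cut_drv C a b)) (Rm (h \<cdot> k) g (cut_drv C a b'))"
    using cong_rm s by (intro perm.cong_rm) (auto simp: seq_comp_left Comp_assoc)
  then show ?case
    using cut_drv_rm[OF cong_rm.prems cong_rm(1) d(1)] cut_drv_rm[OF cong_rm.prems cong_rm(1) d(2)]
    by (metis perm.sym perm.trans)
next
  case (rp_lm f g h' T Y b)
  note d = perm_deriv[OF perm_rp_lm[OF rp_lm(1-3)]]
  show ?case
  proof (rule cut_strip_left[OF _ _ _ rp_lm.prems])
    fix Z h a assume a: "deriv C Z h (Minus f T) a" "\<not> ends_left a"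
    then obtain a' where a': "a = Rm h f a'" "seq C h f" "deriv C Z (h \<cdot> f) T a'"
      using deriv_to_minus by blast
    show "perm C Z (h \<cdot> (f \<cdot> (g \<cdot> h'))) (Plus h' Y)
      (cut_drv C a (Rp h' (Lm f b))) (cut_drv C a (Lm f (Rp h' b)))"
      using perm.sym[OF cut_drv_rp[OF a'(3) rp_lm(3,2)]] a' rp_lm
      by (simp add: Comp_assoc seq_comp_right)
  qed (use d in blast)+
next
  case (rp_lp f g h' S Y b)
  note d = perm_deriv[OF perm_rp_lp[OF rp_lp(1-3)]]
  show ?case
  proof (rule cut_strip_left[OF _ _ _ rp_lp.prems])
    fix Z h a assume a: "deriv C Z h (Plus f S) a" "\<not> ends_left a"
    then obtain h0 a' where a': "a = Rp f a'" "h = h0 \<cdot> f" "seq C h0 f" "deriv C Z h0 S a'"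
      using deriv_to_plus by blast
    show "perm C Z (h \<cdot> (g \<cdot> h')) (Plus h' Y)
      (cut_drv C a (Rp h' (Lp f g b))) (cut_drv C a (Lp f (g \<cdot> h') (Rp h' b)))"
      using perm.sym[OF cut_drv_rp[OF a'(4) rp_lp(3), of h']] a' rp_lp
      by (simp add: Comp_assoc seq_comp_right seq_comp_left)
  qed (use d in blast)+
next
  case (rm_lm f g h' T Y b)
  note d = perm_deriv[OF perm_rm_lm[OF rm_lm(1-3)]]
  show ?case
  proof (rule cut_strip_left[OF _ _ _ rm_lm.prems])
    fix Z h a assume a: "deriv C Z h (Minus f T) a" "\<not> ends_left a"
    then obtain a' where a': "a = Rm h f a'" "seq C h f" "deriv C Z (h \<cdot> f) T a'"
      using deriv_to_minus by blast
    show "perm C Z (h \<cdot> (f \<cdot> g)) (Minus h' Y)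
      (cut_drv C a (Rm (f \<cdot> g) h' (Lm f b))) (cut_drv C a (Lm f (Rm g h' b)))"
      using perm.sym[OF cut_drv_rm[OF a'(3) rm_lm(2,3)]] a' rm_lm
      by (simp add: Comp_assoc)
  qed (use d in blast)+
next
  case (rm_lp f g h' S Y b)
  note d = perm_deriv[OF perm_rm_lp[OF rm_lp(1-3)]]
  show ?case
  proof (rule cut_strip_left[OF _ _ _ rm_lp.prems])
    fix Z h a assume a: "deriv C Z h (Plus f S) a" "\<not> ends_left a"
    then obtain h0 a' where a': "a = Rp f a'" "h = h0 \<cdot> f" "seq C h0 f" "deriv C Z h0 S a'"
      using deriv_to_plus by blast
    show "perm C Z (h \<cdot> g) (Minus h' Y)
      (cut_drv C a (Rm g h' (Lp f (g \<cdot> h') b))) (cut_drv C a (Lp f g (Rm (f \<cdot> g) h' b)))"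
      using perm.sym[OF cut_drv_rm[OF a'(4), of "f \<cdot> g" h' Y b]] a' rm_lp
      by (simp add: Comp_assoc seq_comp_left over_deriv)
  qed (use d in blast)+
qed

text \<open>Cut is well defined on permutation classes.\<close>
lemma cut_drv_cong:
  assumes "perm C Z h W a a'" "perm C W k Y b b'"
  shows "perm C Z (h \<cdot> k) Y (cut_drv C a b) (cut_drv C a' b')"
  using cut_drv_cong_left[OF assms(1)] cut_drv_cong_right[OF assms(2)] perm_deriv assms
  by (blast intro: perm.trans)

lemma cut_total: "deriv C Z h W a \<Longrightarrow> deriv C W k Y b \<Longrightarrow> cut C a b (cut_drv C a b)"
proof (induction rule: cut_induct)
  case (rm Z h W a k g T b)
  then show ?case using cut.rm[OF rm(5,3)] by (simp add: cut_drv_right over_deriv)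
next
  case (lp S f g W a k Y b)
  then show ?case using cut.lp[OF lp(4,3)] by (simp add: over_deriv)
qed (auto simp: cut_drv_right intro: cut.intros)

text \<open>All ways of applying the overlapping clauses for cut agree up to permutation
  equivalence.\<close>
lemma cut_sound:
  "cut C a b c \<Longrightarrow> deriv C Z h W a \<Longrightarrow> deriv C W k Y b \<Longrightarrow>
    perm C Z (h \<cdot> k) Y c (cut_drv C a b)"
proof (induction arbitrary: Z h W k Y rule: cut.induct)
  case (axioms f g)
  then have "deriv C Z (h \<cdot> k) Y (cut_drv C (Ax f) (Ax g))" using cut_drv_deriv by blast
  then show ?case by (auto intro: perm.refl)
next
  case (rp_lp a b c f k')
  from rp_lp.prems(1) obtain S h' where 1: "W = Plus f S" "h = h' \<cdot> f" "seq C h' f"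
    "deriv C Z h' S a" by (auto elim: deriv_RpE)
  with rp_lp.prems(2) have "k' = k" "seq C f k" "deriv C S (f \<cdot> k) Y b"
    by (auto elim: deriv_LpE)
  then show ?case using rp_lp.IH 1 by (simp add: Comp_assoc)
next
  case (rm_lm a b c h' f)
  from rm_lm.prems(1) obtain S where 1: "W = Minus f S" "h' = h" "seq C h f"
    "deriv C Z (h \<cdot> f) S a" by (auto elim: deriv_RmE)
  with rm_lm.prems(2) obtain k' where "k = f \<cdot> k'" "seq C f k'" "deriv C S k' Y b"
    by (auto elim: deriv_LmE)
  then show ?case using rm_lm.IH[of Z "h \<cdot> f" S k' Y] 1 by (simp add: Comp_assoc)
next
  case (lm a b c f)
  from lm.prems(1) obtain T h' where 1: "Z = Minus f T" "h = f \<cdot> h'" "seq C f h'"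
    "deriv C T h' W a" by (auto elim: deriv_LmE)
  have "seq C h' k" using deriv_seq 1 lm.prems by blast
  then show ?case using lm.IH[OF 1(4) lm.prems(2)] 1
    by (auto simp: Comp_assoc seq_comp_right intro!: perm.cong_lm)
next
  case (lp a b c V j V' f g)
  have j: "j = k" using over_deriv lp by blast
  from lp.prems(1) obtain S where 1: "Z = Plus f S" "g = h" "seq C f h"
    "deriv C S (f \<cdot> h) W a" by (auto elim: deriv_LpE)
  have "seq C h k" using deriv_seq lp.prems by blast
  then show ?case using lp.IH[OF 1(4) lp.prems(2)] 1 lp.prems(2) j
    by (auto simp: Comp_assoc seq_comp_right over_deriv intro!: perm.cong_lp)
next
  case (rp a b c f)
  from rp.prems(2) obtain S k' where 1: "Y = Plus f S" "k = k' \<cdot> f" "seq C k' f"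
    "deriv C W k' S b" by (auto elim: deriv_RpE)
  have s: "seq C h k'" using deriv_seq 1 rp.prems by blast
  have "perm C Z (h \<cdot> k' \<cdot> f) (Plus f S) (Rp f c) (Rp f (cut_drv C a b))"
    using rp.IH[OF rp.prems(1) 1(4)] 1 s by (intro perm.cong_rp) (auto simp: seq_comp_left)
  then show ?case using cut_drv_rp[OF rp.prems(1) 1(4,3)] 1 s
    by (metis Comp_assoc perm.sym perm.trans)
next
  case (rm a b c V j V' k' f)
  have j: "j = h" using over_deriv rm by blast
  from rm.prems(2) obtain S where 1: "Y = Minus f S" "k' = k" "seq C k f"
    "deriv C W (k \<cdot> f) S b" by (auto elim: deriv_RmE)
  have s: "seq C h k" using deriv_seq[OF rm.prems(1) 1(4)] 1 seq_comp_right by blast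
  have "perm C Z (h \<cdot> k) (Minus f S) (Rm (h \<cdot> k) f c) (Rm (h \<cdot> k) f (cut_drv C a b))"
    using rm.IH[OF rm.prems(1) 1(4)] 1 s
    by (intro perm.cong_rm) (auto simp: seq_comp_left Comp_assoc)
  then show ?case using cut_drv_rm[OF rm.prems(1) 1(3,4)] 1 j
    by (metis perm.sym perm.trans)
qed

section \<open>Unit and associativity laws for cut\<close>

lemma axiom_cut_drv:
  "deriv C Z h W a \<Longrightarrow> deriv C W k Y b \<Longrightarrow>
    axiom_of (cut_drv C a b) = axiom_of a \<cdot> axiom_of b"
  by (induction rule: cut_induct) (auto simp: cut_drv_right)

lemma ident_deriv: "zform C A Z B \<Longrightarrow> deriv C Z (Ident C B) Z (ident_drv C Z)"
proof (induction rule: zform.induct)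
  case (atom A)
  then show ?case by (auto simp: Ident_closed intro: deriv.ax)
next
  case (plus A Z B f B')
  then have f: "f \<in> Arr C" "Dom C f = B" "Cod C f = B'" "B \<in> Obj C" "B' \<in> Obj C"
    using Dom_closed Cod_closed by (auto simp: hom_def)
  then have s: "seq C (Ident C B) f" "seq C f (Ident C B')" by (auto simp: seq_def ident_arr)
  have "deriv C Z f (Plus f Z) (Rp f (ident_drv C Z))"
    using deriv.rp[OF s(1) plus.IH] Ident_left[of f] f by simp
  then show ?case using deriv.lp[OF s(2)] Ident_right[of f] f by simp
next
  case (minus A Z B' g B)
  then have f: "g \<in> Arr C" "Dom C g = B" "Cod C g = B'" "B \<in> Obj C" "B' \<in> Obj C"
    using Dom_closed Cod_closed by (auto simp: hom_def)
  then have s: "seq C (Ident C B) g" "seq C g (Ident C B')" by (auto simp: seq_def ident_arr)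
  have "deriv C (Minus g Z) g Z (Lm g (ident_drv C Z))"
    using deriv.lm[OF s(2) minus.IH] Ident_right[of g] f by simp
  then show ?case using deriv.rm[OF s(1)] Ident_left[of g] f by simp
qed

lemma deriv_zform:
  assumes "deriv C Z h W a"
  shows "zform C (zsrc Z) Z (Dom C h)" "zform C (zsrc W) W (Cod C h)"
  using deriv_formulas[OF category_axioms assms] by auto

lemma deriv_ident:
  assumes "deriv C Z h W a"
  shows "deriv C Z (Ident C (Dom C h)) Z (ident_drv C Z)"
    and "deriv C W (Ident C (Cod C h)) W (ident_drv C W)"
  using deriv_zform[OF assms] ident_deriv by blast+

lemma cut_drv_ident_left: "deriv C Z h W a \<Longrightarrow> perm C Z h W (cut_drv C (ident_drv C Z) a) a"
proof (induction rule: deriv.induct)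
  case (ax f A A')
  then have "cut_drv C (ident_drv C (Atom A)) (Ax f) = Ax f" by (auto simp: hom_def Ident_left)
  then show ?case using ax by (auto intro: perm.refl deriv.ax)
next
  case (lp f g S T a)
  have f: "Ident C (Cod C f) \<cdot> g = g" using lp(1) Ident_left[of g] by (auto dest: seqD)
  show ?case using lp by (auto simp: f over_deriv intro: perm.cong_lp)
next
  case (lm g g' T T' a)
  then show ?case by (auto intro: perm.cong_lm)
next
  case (rp k f Z S a)
  have "k \<cdot> f = Ident C (Dom C k) \<cdot> (k \<cdot> f)"
    using Ident_left[of "k \<cdot> f"] comp_arr[OF rp(1)] by auto
  then have "perm C Z (k \<cdot> f) (Plus f S) (cut_drv C (ident_drv C Z) (Rp f a))
     (Rp f (cut_drv C (ident_drv C Z) a))"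
    using cut_drv_rp[OF deriv_ident(1)[OF rp(2)] rp(2,1)] by simp
  then show ?case using perm.cong_rp[OF rp(1) rp.IH] by (rule perm.trans)
next
  case (rm k g Z T a)
  have "Ident C (Dom C k) \<cdot> k = k" using Ident_left[of "k"] rm(1) by (auto dest: seqD)
  then have "perm C Z k (Minus g T) (cut_drv C (ident_drv C Z) (Rm k g a))
     (Rm k g (cut_drv C (ident_drv C Z) a))"
    using comp_arr[OF rm(1)] cut_drv_rm[of Z "Ident C (Dom C k)" Z "ident_drv C Z" k g T a]
      deriv_ident(1)[OF rm(2)] rm(1,2) by simp
  then show ?case using perm.cong_rm[OF rm(1) rm.IH] by (rule perm.trans)
qed

lemma cut_drv_ident_right: "deriv C Z h W a \<Longrightarrow> perm C Z h W (cut_drv C a (ident_drv C W)) a"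
proof (induction rule: deriv.induct)
  case (ax f A A')
  then have "cut_drv C (Ax f) (ident_drv C (Atom A')) = Ax f" by (auto simp: hom_def Ident_right)
  then show ?case using ax by (auto intro: perm.refl deriv.ax)
next
  case (lp f g S T a)
  have i: "over C (ident_drv C T) = Ident C (Cod C g)"
    using over_deriv deriv_ident(2)[OF lp(2)] comp_arr[OF lp(1)] by simp
  have f: "g \<cdot> Ident C (Cod C g) = g" using lp(1) Ident_right[of g] by (auto dest: seqD)
  show ?case using lp by (auto simp: f i intro: perm.cong_lp)
next
  case (lm g g' T T' a)
  then show ?case by (auto intro: perm.cong_lm)
next
  case (rp k f Z S a)
  have i: "deriv C S (Ident C (Dom C f)) S (ident_drv C S)"
    using deriv_ident(2)[OF rp(2)] rp(1) by (simp add: seq_def)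
  have s: "seq C (Ident C (Dom C f)) f"
    using rp(1) Dom_closed by (auto simp: seq_def ident_arr)
  have f: "Ident C (Dom C f) \<cdot> f = f" using rp(1) Ident_left[of f] by (auto dest: seqD)
  have "perm C Z (k \<cdot> f) (Plus f S) (cut_drv C a (Rp f (ident_drv C S)))
     (Rp f (cut_drv C a (ident_drv C S)))"
    using cut_drv_rp[OF rp(2) i s] f by simp
  then have "perm C Z (k \<cdot> f) (Plus f S) (cut_drv C a (Rp f (ident_drv C S))) (Rp f a)"
    using perm.cong_rp[OF rp(1) rp.IH] by (rule perm.trans)
  then show ?case by simp
next
  case (rm k g Z T a)
  have i: "deriv C T (Ident C (Cod C g)) T (ident_drv C T)"
    using deriv_ident(2)[OF rm(2)] comp_arr[OF rm(1)] by simp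
  have g: "g \<in> Arr C" "k \<in> Arr C" "Cod C k = Dom C g" using rm(1) by (auto simp: seq_def)
  have "k \<cdot> Ident C (Dom C g) = k" using Ident_right[of k] g by simp
  then have "cut_drv C (Rm k g a) (ident_drv C (Minus g T)) = Rm k g (cut_drv C a (ident_drv C T))"
    by simp
  then show ?case using perm.cong_rm[OF rm(1) rm.IH] by simp
qed

text \<open>The analogue of \<open>cut_strip_right\<close> for the associativity law.\<close>
lemma assoc_strip_right:
  assumes a: "deriv C Z h W a" and b: "deriv C W k Y b"
    and base: "\<And>l X c. deriv C Y l X c \<Longrightarrow> \<not> ends_right c \<Longrightarrow>
      perm C Z (h \<cdot> k \<cdot> l) X (cut_drv C (cut_drv C a b) c) (cut_drv C a (cut_drv C b c))"
    and c: "deriv C Y l X c"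
  shows "perm C Z (h \<cdot> k \<cdot> l) X (cut_drv C (cut_drv C a b) c) (cut_drv C a (cut_drv C b c))"
  using c b base
proof (induction rule: deriv.induct)
  case (rp l f Y S c)
  note ab = cut_drv_deriv[OF a rp(4)]
  have s: "seq C h k" "seq C k l" using deriv_seq a rp by blast+
  have 1: "perm C Z (h \<cdot> k \<cdot> (l \<cdot> f)) (Plus f S) (cut_drv C a (cut_drv C b (Rp f c)))
      (cut_drv C a (Rp f (cut_drv C b c)))"
    using cut_drv_cong_right[OF cut_drv_rp[OF rp(4,2,1)] a] s rp(1)
    by (simp add: Comp_assoc seq_comp_right)
  have 2: "perm C Z (h \<cdot> k \<cdot> (l \<cdot> f)) (Plus f S) (cut_drv C a (Rp f (cut_drv C b c)))
      (Rp f (cut_drv C a (cut_drv C b c)))"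
    using cut_drv_rp[OF a cut_drv_deriv[OF rp(4,2)], of f] s rp(1)
    by (simp add: Comp_assoc seq_comp_left seq_comp_right)
  have "perm C Z (h \<cdot> k \<cdot> l \<cdot> f) (Plus f S)
      (Rp f (cut_drv C (cut_drv C a b) c)) (Rp f (cut_drv C a (cut_drv C b c)))"
    using rp(3)[OF rp(4,5)] s rp(1)
    by (intro perm.cong_rp) (auto simp: seq_comp_left seq_comp_right)
  then have 3: "perm C Z (h \<cdot> k \<cdot> (l \<cdot> f)) (Plus f S)
      (Rp f (cut_drv C (cut_drv C a b) c)) (Rp f (cut_drv C a (cut_drv C b c)))"
    using s rp(1) by (simp add: Comp_assoc seq_comp_left seq_comp_right)
  have 4: "perm C Z (h \<cdot> k \<cdot> (l \<cdot> f)) (Plus f S)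
      (cut_drv C (cut_drv C a b) (Rp f c)) (Rp f (cut_drv C (cut_drv C a b) c))"
    using cut_drv_rp[OF ab rp(2,1)] .
  show ?case
    by (rule perm.trans[OF 4 perm.trans[OF 3 perm.sym[OF perm.trans[OF 1 2]]]])
next
  case (rm l g Y T c)
  note ab = cut_drv_deriv[OF a rm(4)]
  have s: "seq C h k" "seq C k l" using deriv_seq a rm seq_comp_right by blast+
  have 1: "perm C Z (h \<cdot> k \<cdot> l) (Minus g T) (cut_drv C a (cut_drv C b (Rm l g c)))
      (cut_drv C a (Rm (k \<cdot> l) g (cut_drv C b c)))"
    using cut_drv_cong_right[OF cut_drv_rm[OF rm(4,1,2)] a] s by (simp add: Comp_assoc)
  have 2: "perm C Z (h \<cdot> k \<cdot> l) (Minus g T) (cut_drv C a (Rm (k \<cdot> l) g (cut_drv C b c)))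
      (Rm (h \<cdot> k \<cdot> l) g (cut_drv C a (cut_drv C b c)))"
    using cut_drv_rm[OF a, of "k \<cdot> l" g T "cut_drv C b c"] cut_drv_deriv[OF rm(4,2)] s rm(1)
    by (simp add: seq_comp_left Comp_assoc)
  have 3: "perm C Z (h \<cdot> k \<cdot> l) (Minus g T)
      (Rm (h \<cdot> k \<cdot> l) g (cut_drv C (cut_drv C a b) c)) (Rm (h \<cdot> k \<cdot> l) g (cut_drv C a (cut_drv C b c)))"
    using rm(3)[OF rm(4,5)] s rm(1)
    by (intro perm.cong_rm) (auto simp: Comp_assoc seq_comp_left seq_comp_right)
  have 4: "perm C Z (h \<cdot> k \<cdot> l) (Minus g T)
      (cut_drv C (cut_drv C a b) (Rm l g c)) (Rm (h \<cdot> k \<cdot> l) g (cut_drv C (cut_drv C a b) c))"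
    using cut_drv_rm[OF ab rm(1,2)] .
  show ?case
    by (rule perm.trans[OF 4 perm.trans[OF 3 perm.sym[OF perm.trans[OF 1 2]]]])
next
  case ax
  show ?case by (rule ax(3)[OF deriv.ax[OF ax(1)]]) simp
next
  case lp
  show ?case by (rule lp(5)[OF deriv.lp[OF lp(1,2)]]) simp
next
  case lm
  show ?case by (rule lm(5)[OF deriv.lm[OF lm(1,2)]]) simp
qed

lemma cut_drv_assoc:
  "deriv C Z h W a \<Longrightarrow> deriv C W k Y b \<Longrightarrow> deriv C Y l X c \<Longrightarrow>
    perm C Z (h \<cdot> k \<cdot> l) X (cut_drv C (cut_drv C a b) c) (cut_drv C a (cut_drv C b c))"
proof (induction arbitrary: l X c rule: cut_induct)
  case (ax f g)
  have d: "deriv C (Atom (Dom C f)) f (Atom (Cod C f)) (Ax f)"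
    "deriv C (Atom (Cod C f)) g (Atom (Cod C g)) (Ax g)"
    using ax by (auto simp: seq_def hom_def intro!: deriv.ax)
  show ?case
  proof (rule assoc_strip_right[OF d _ ax(2)])
    fix l X c assume c: "deriv C (Atom (Cod C g)) l X c" "\<not> ends_right c"
    then have l: "c = Ax l" "seq C g l" using ax by (auto simp: seq_def elim: deriv_from_atom)
    then have eq: "cut_drv C (cut_drv C (Ax f) (Ax g)) c = cut_drv C (Ax f) (cut_drv C (Ax g) c)"
      using ax by (simp add: Comp_assoc)
    show "perm C (Atom (Dom C f)) (f \<cdot> g \<cdot> l) X
        (cut_drv C (cut_drv C (Ax f) (Ax g)) c) (cut_drv C (Ax f) (cut_drv C (Ax g) c))"
      using cut_drv_deriv[OF cut_drv_deriv[OF d] c(1)] unfolding eq by (rule perm.refl)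
  qed
next
  case (lp S f g W a k Y b)
  have d: "deriv C (Plus f S) g W (Lp f g a)" using lp by (blast intro: deriv.lp)
  have s: "seq C g k" "seq C k l" using deriv_seq[OF d] deriv_seq lp by blast+
  show ?case using lp.IH[OF lp.prems] lp.prems lp(1,3) s over_deriv[OF cut_drv_deriv[OF lp(3) lp.prems]]
    by (auto simp: over_deriv Comp_assoc seq_comp_left seq_comp_right intro!: perm.cong_lp)
next
  case (lm T g h W a k Y b)
  have s: "seq C h k" "seq C k l" using deriv_seq lm by blast+
  show ?case using lm.IH[OF lm.prems] lm(1,3) s
    by (auto simp: Comp_assoc seq_comp_left seq_comp_right intro!: perm.cong_lm)
next
  case (rp Z h W a k S f b)
  have s: "seq C h k" using deriv_seq rp by blast
  show ?case
  proof (rule assoc_strip_right[OF rp(3) deriv.rp[OF rp(2,4)] _ rp.prems])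
    fix l X c assume "deriv C (Plus f S) l X c" "\<not> ends_right c"
    then obtain c' where c: "c = Lp f l c'" "seq C f l" "deriv C S (f \<cdot> l) X c'"
      using deriv_from_plus by blast
    show "perm C Z (h \<cdot> (k \<cdot> f) \<cdot> l) X
      (cut_drv C (cut_drv C a (Rp f b)) c) (cut_drv C a (cut_drv C (Rp f b) c))"
      using rp.IH[OF c(3)] rp(1,2) c s
      by (simp add: cut_drv_right Comp_assoc seq_comp_left seq_comp_right)
  qed
next
  case (rm Z h W a k g T b)
  have s: "seq C h k" using deriv_seq rm seq_comp_right by blast
  show ?case
  proof (rule assoc_strip_right[OF rm(3) deriv.rm[OF rm(2,4)] _ rm.prems])
    fix l X c assume "deriv C (Minus g T) l X c" "\<not> ends_right c"
    then obtain l' c' where c: "c = Lm g c'" "l = g \<cdot> l'" "seq C g l'" "deriv C T l' X c'"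
      using deriv_from_minus by blast
    show "perm C Z (h \<cdot> k \<cdot> l) X
      (cut_drv C (cut_drv C a (Rm k g b)) c) (cut_drv C a (cut_drv C (Rm k g b) c))"
      using rm.IH[OF c(4)] rm(1,2) c s
      by (simp add: cut_drv_right Comp_assoc seq_comp_left seq_comp_right)
  qed
next
  case (rp_lp Z h f S a k Y b)
  have "deriv C (Plus f S) k Y (Lp f k b)" using rp_lp by (blast intro: deriv.lp)
  then have s: "seq C k l" using deriv_seq rp_lp.prems by blast
  show ?case using rp_lp.IH[OF rp_lp.prems] rp_lp(1,2) s
    by (simp add: Comp_assoc seq_comp_left seq_comp_right)
next
  case (rm_lm Z h g T a k Y b)
  have s: "seq C k l" using deriv_seq rm_lm by blast
  show ?case using rm_lm.IH[OF rm_lm.prems] rm_lm(1,2) s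
    by (simp add: Comp_assoc seq_comp_left seq_comp_right)
qed

section \<open>Substitution of formulas and derivations\<close>

lemma zsrc_zsubst [simp]: "zsrc (zsubst Z W) = zsrc Z"
  by (induction W) auto

lemma ztgt_zsubst: "ztgt C Z = zsrc W \<Longrightarrow> ztgt C (zsubst Z W) = ztgt C W"
  by (induction W) auto

lemma zsubst_assoc: "zsubst (zsubst Z W) Y = zsubst Z (zsubst W Y)"
  by (induction Y) auto

lemma zsubst_unit: "zsubst (Atom (zsrc Z)) Z = Z"
  by (induction Z) auto

lemma zform_zsubst: "zform C B W D \<Longrightarrow> zform C A Z B \<Longrightarrow> zform C A (zsubst Z W) D"
  by (induction rule: zform.induct) (auto intro: zform.intros)

lemma dsubst_assoc: "dsubst (dsubst a b) c = dsubst a (dsubst b c)"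
  by (induction c) auto

lemma dsubst_unit: "dsubst (Ax (axiom_of a)) a = a"
  by (induction a) auto

lemma axiom_dsubst: "axiom_of (dsubst a b) = axiom_of a"
  by (induction b) auto

lemma dsubst_deriv:
  "deriv C W k Y b \<Longrightarrow> deriv C Z (axiom_of b) Z' a \<Longrightarrow>
    deriv C (zsubst Z W) k (zsubst Z' Y) (dsubst a b)"
  by (induction rule: deriv.induct) (auto intro: deriv.intros)

lemma dsubst_cong_left:
  "deriv C W k Y b \<Longrightarrow> perm C Z (axiom_of b) Z' a a' \<Longrightarrow>
    perm C (zsubst Z W) k (zsubst Z' Y) (dsubst a b) (dsubst a' b)"
  by (induction rule: deriv.induct) (auto intro: perm.intros)

lemma dsubst_cong_right:
  "perm C W k Y b b' \<Longrightarrow> deriv C Z (axiom_of b) Z' a \<Longrightarrow>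
    perm C (zsubst Z W) k (zsubst Z' Y) (dsubst a b) (dsubst a b')"
proof (induction rule: perm_induct)
  case refl then show ?case by (blast intro: perm.refl dsubst_deriv)
next
  case (sym W k Y b b') then show ?case using perm_axiom by (metis perm.sym)
next
  case (trans W k Y b b' b'') then show ?case using perm_axiom by (metis perm.trans)
qed (auto intro: perm_rp_lm perm_rp_lp perm_rm_lm perm_rm_lp dsubst_deriv
    perm.cong_lp perm.cong_rp perm.cong_lm perm.cong_rm)

lemma dsubst_cong:
  assumes "perm C Z h Z' a a'" "perm C W k Y b b'" "axiom_of b = h"
  shows "perm C (zsubst Z W) k (zsubst Z' Y) (dsubst a b) (dsubst a' b')"
proof (rule perm.trans)
  show "perm C (zsubst Z W) k (zsubst Z' Y) (dsubst a b) (dsubst a' b)"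
    using dsubst_cong_left assms perm_deriv by blast
  show "perm C (zsubst Z W) k (zsubst Z' Y) (dsubst a' b) (dsubst a' b')"
    using dsubst_cong_right assms perm_deriv by blast
qed

lemma over_dsubst: "over C a = axiom_of b \<Longrightarrow> over C (dsubst a b) = over C b"
  by (induction b) auto

lemma dsubst_ident:
  "ztgt C Z = zsrc W \<Longrightarrow> ident_drv C (zsubst Z W) = dsubst (ident_drv C Z) (ident_drv C W)"
  by (induction W) auto

text \<open>The interchange law: the cut of two substitutions is the substitution of the two cuts.
  Moving right rules out of the cut on the left-hand side makes it hold only up to
  equivalence.\<close>
lemma dsubst_interchange:
  "deriv C W k Y b \<Longrightarrow> deriv C Y l X c \<Longrightarrow>
    deriv C Z (axiom_of b) V a \<Longrightarrow> deriv C V (axiom_of c) U a' \<Longrightarrow>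
    perm C (zsubst Z W) (k \<cdot> l) (zsubst U X)
      (cut_drv C (dsubst a b) (dsubst a' c)) (dsubst (cut_drv C a a') (cut_drv C b c))"
proof (induction rule: cut_induct)
  case (ax f g)
  then show ?case using cut_drv_deriv[OF ax(2,3)] by (auto intro: perm.refl)
next
  case (lp S f g W b k Y c)
  have d: "deriv C (Plus f S) g W (Lp f g b)" using lp by (blast intro: deriv.lp)
  have s: "seq C g k" using deriv_seq[OF d lp(3)] .
  have o: "over C (dsubst a' c) = k" using over_dsubst over_deriv lp by metis
  show ?case using lp.IH lp.prems lp(1,3) s o
    by (auto simp: over_deriv Comp_assoc seq_comp_left seq_comp_right intro!: perm.cong_lp)
next
  case (lm T g h W b k Y c)
  have s: "seq C h k" using deriv_seq lm by blast
  show ?case using lm.IH lm.prems lm(1,3) s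
    by (auto simp: Comp_assoc seq_comp_left seq_comp_right intro!: perm.cong_lm)
next
  case (rp W h Y b k S f c)
  have s: "seq C h k" using deriv_seq rp by blast
  have d: "deriv C (zsubst Z W) h (zsubst V Y) (dsubst a b)"
    "deriv C (zsubst V Y) k (zsubst U S) (dsubst a' c)"
    using rp by (auto intro: dsubst_deriv)
  have "perm C (zsubst Z W) (h \<cdot> k \<cdot> f) (Plus f (zsubst U S))
      (Rp f (cut_drv C (dsubst a b) (dsubst a' c))) (Rp f (dsubst (cut_drv C a a') (cut_drv C b c)))"
    using rp s by (intro perm.cong_rp) (auto simp: seq_comp_left)
  then show ?case using perm.trans[OF cut_drv_rp[OF d rp(2)]] rp(1,2) s
    by (simp add: cut_drv_right Comp_assoc)
next
  case (rm W h Y b k g S c)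
  have s: "seq C h k" using deriv_seq rm seq_comp_right by blast
  have d: "deriv C (zsubst Z W) h (zsubst V Y) (dsubst a b)"
    "deriv C (zsubst V Y) (k \<cdot> g) (zsubst U S) (dsubst a' c)"
    using rm by (auto intro: dsubst_deriv)
  have "perm C (zsubst Z W) (h \<cdot> k) (Minus g (zsubst U S))
      (Rm (h \<cdot> k) g (cut_drv C (dsubst a b) (dsubst a' c)))
      (Rm (h \<cdot> k) g (dsubst (cut_drv C a a') (cut_drv C b c)))"
    using rm s by (intro perm.cong_rm) (auto simp: seq_comp_left Comp_assoc)
  then show ?case using perm.trans[OF cut_drv_rm[OF d(1) rm(2) d(2)]] rm(1,3)
    by (simp add: cut_drv_right over_deriv)
next
  case (rp_lp W h f S b k Y c)
  then show ?case by (simp add: Comp_assoc)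
next
  case (rm_lm W h g T b k Y c)
  then show ?case by (simp add: Comp_assoc)
qed

section \<open>The zigzag double category\<close>

lemma zcell_of_simps [simp]:
  "zleft (zcell_of C Z h W a) = Z" "zright (zcell_of C Z h W a) = W"
  "ztop (zcell_of C Z h W a) = axiom_of a" "zbot (zcell_of C Z h W a) = h"
  by (simp_all add: zcell_of_def)

lemma zcell_eq: "perm C Z h W a b \<Longrightarrow> zcell_of C Z h W a = zcell_of C Z h W b"
  using perm_axiom by (auto simp: zcell_of_def perm_class_def intro: perm.sym perm.trans)

text \<open>The union over representatives and cut results in the definition of horizontal
  composition is a single permutation class.\<close>
lemma zhcomp_zcell:
  assumes a: "deriv C Z h W a" and b: "deriv C W k Y b"
  shows "zhcomp C (zcell_of C Z h W a) (zcell_of C W k Y b) =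
    zcell_of C Z (h \<cdot> k) Y (cut_drv C a b)"
proof -
  have "perm C Z (h \<cdot> k) Y (cut_drv C a b) c"
    if "perm C Z h W a a'" "perm C W k Y b b'" "cut C a' b' c" for a' b' c
    using perm.trans[OF cut_drv_cong[OF that(1,2)] perm.sym[OF cut_sound[OF that(3)]]]
      perm_deriv[OF that(1)] perm_deriv[OF that(2)] by blast
  moreover have "perm C Z h W a a" "perm C W k Y b b" "cut C a b (cut_drv C a b)"
    using perm.refl[OF a] perm.refl[OF b] cut_total[OF a b] by auto
  ultimately show ?thesis
    using axiom_cut_drv[OF a b] unfolding zcell_of_def perm_class_def zhcomp.simps
    by (auto intro: perm.trans)
qed

lemma zvcomp_zcell:
  assumes a: "deriv C Z (axiom_of b) Z' a" and b: "deriv C W k Y b"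
  shows "zvcomp C (zcell_of C Z (axiom_of b) Z' a) (zcell_of C W k Y b) =
    zcell_of C (zsubst Z W) k (zsubst Z' Y) (dsubst a b)"
proof -
  have "perm C (zsubst Z W) k (zsubst Z' Y) (dsubst a b) (dsubst a' b')"
    if "perm C Z (axiom_of b) Z' a a'" "perm C W k Y b b'" for a' b'
    using that dsubst_cong by blast
  moreover have "perm C Z (axiom_of b) Z' a a" "perm C W k Y b b"
    using perm.refl[OF a] perm.refl[OF b] by auto
  ultimately show ?thesis
    unfolding zcell_of_def perm_class_def zvcomp.simps axiom_dsubst
    by (auto intro: perm.trans)
qed

lemma ZZ_simps [simp]:
  "D0 (ZZ C) = C" "D1 (ZZ C) = ZZ1 C" "SrcV (ZZ C) = zsrc" "SrcC (ZZ C) = ztop"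
  "TgtV (ZZ C) = ztgt C" "TgtC (ZZ C) = zbot" "UnitV (ZZ C) = Atom"
  "UnitC (ZZ C) = (\<lambda>f. zcell_of C (Atom (Dom C f)) f (Atom (Cod C f)) (Ax f))"
  "VcompV (ZZ C) = zsubst" "VcompC (ZZ C) = zvcomp C"
  "Dom (ZZ1 C) = zleft" "Cod (ZZ1 C) = zright" "Comp (ZZ1 C) = zhcomp C"
  "Ident (ZZ1 C) = (\<lambda>Z. zcell_of C Z (Ident C (ztgt C Z)) Z (ident_drv C Z))"
  by (simp_all add: ZZ_def ZZ1_def)

lemma ZZ1_Obj: "Z \<in> Obj (ZZ1 C) \<longleftrightarrow> zform C (zsrc Z) Z (ztgt C Z)"
proof -
  have "(\<exists>A B. zform C A Z B) \<longleftrightarrow> zform C (zsrc Z) Z (ztgt C Z)" by (metis zform_iff)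
  then show ?thesis by (simp add: ZZ1_def)
qed

lemma ZZ1_ArrI: "deriv C Z h W a \<Longrightarrow> zcell_of C Z h W a \<in> Arr (ZZ1 C)"
  by (auto simp: ZZ1_def)

lemma ZZ1_ArrE:
  assumes "x \<in> Arr (ZZ1 C)"
  obtains Z h W a where "x = zcell_of C Z h W a" "deriv C Z h W a"
  using assms by (auto simp: ZZ1_def)

lemma deriv_Obj:
  assumes "deriv C Z h W a"
  shows "Z \<in> Obj (ZZ1 C)" "W \<in> Obj (ZZ1 C)"
  using deriv_zform[OF assms] deriv_bounds[OF assms] by (simp_all add: ZZ1_Obj)

lemma ident_deriv_Obj: "Z \<in> Obj (ZZ1 C) \<Longrightarrow> deriv C Z (Ident C (ztgt C Z)) Z (ident_drv C Z)"
  using ident_deriv by (simp add: ZZ1_Obj)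

lemma axiom_deriv: "f \<in> Arr C \<Longrightarrow> deriv C (Atom (Dom C f)) f (Atom (Cod C f)) (Ax f)"
  by (auto simp: hom_def intro: deriv.ax)

lemma zform_Obj: "zform C A Z B \<Longrightarrow> A \<in> Obj C \<and> B \<in> Obj C"
  by (induction rule: zform.induct) (auto simp: hom_def Dom_closed Cod_closed)

lemma axiom_ident: "axiom_of (ident_drv C Z) = Ident C (zsrc Z)"
  by (induction Z) auto

lemma ZZ1_category: "category (ZZ1 C)"
proof
  fix x assume "x \<in> Arr (ZZ1 C)"
  then obtain Z h W a where x: "x = zcell_of C Z h W a" and d: "deriv C Z h W a"
    by (rule ZZ1_ArrE)
  show "Dom (ZZ1 C) x \<in> Obj (ZZ1 C)" "Cod (ZZ1 C) x \<in> Obj (ZZ1 C)"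
    using deriv_Obj[OF d] x by simp_all
  show "Comp (ZZ1 C) (Ident (ZZ1 C) (Dom (ZZ1 C) x)) x = x"
    using zhcomp_zcell[OF ident_deriv_Obj[OF deriv_Obj(1)[OF d]] d]
      zcell_eq[OF cut_drv_ident_left[OF d]] Ident_left[of h] deriv_bounds[OF d] x by simp
  show "Comp (ZZ1 C) x (Ident (ZZ1 C) (Cod (ZZ1 C) x)) = x"
    using zhcomp_zcell[OF d ident_deriv_Obj[OF deriv_Obj(2)[OF d]]]
      zcell_eq[OF cut_drv_ident_right[OF d]] Ident_right[of h] deriv_bounds[OF d] x by simp
next
  fix Z assume "Z \<in> Obj (ZZ1 C)"
  then show "Ident (ZZ1 C) Z \<in> hom (ZZ1 C) Z Z"
    using ZZ1_ArrI[OF ident_deriv_Obj] by (simp add: hom_def)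
next
  fix x y assume "seq (ZZ1 C) x y"
  then obtain Z h W a k Y b where
    "x = zcell_of C Z h W a" "y = zcell_of C W k Y b" "deriv C Z h W a" "deriv C W k Y b"
    by (auto simp: seq_def elim!: ZZ1_ArrE)
  then show "Comp (ZZ1 C) x y \<in> hom (ZZ1 C) (Dom (ZZ1 C) x) (Cod (ZZ1 C) y)"
    using ZZ1_ArrI[OF cut_drv_deriv] by (simp add: hom_def zhcomp_zcell)
next
  fix x y z assume "seq (ZZ1 C) x y" "seq (ZZ1 C) y z"
  then obtain Z h W a k Y b l X c where
    xyz: "x = zcell_of C Z h W a" "y = zcell_of C W k Y b" "z = zcell_of C Y l X c" and
    d: "deriv C Z h W a" "deriv C W k Y b" "deriv C Y l X c"
    by (auto simp: seq_def elim!: ZZ1_ArrE)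
  have "seq C h k" "seq C k l" using d deriv_seq by blast+
  then show "Comp (ZZ1 C) (Comp (ZZ1 C) x y) z = Comp (ZZ1 C) x (Comp (ZZ1 C) y z)"
    using zcell_eq[OF cut_drv_assoc[OF d]] d cut_drv_deriv by (simp add: xyz zhcomp_zcell Comp_assoc)
qed

lemma vseqC_ZZ:
  assumes "vseqC (ZZ C) x y"
  obtains Z Z' a W k Y b where
    "x = zcell_of C Z (axiom_of b) Z' a" "y = zcell_of C W k Y b"
    "deriv C Z (axiom_of b) Z' a" "deriv C W k Y b"
  using assms by (auto simp: vseqC_def elim!: ZZ1_ArrE)

lemma vseqV_ZZ: "vseqV (ZZ C) v w \<longleftrightarrow>
    zform C (zsrc v) v (ztgt C v) \<and> zform C (zsrc w) w (ztgt C w) \<and> ztgt C v = zsrc w"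
  by (simp add: vseqV_def ZZ1_Obj)

lemma ZZ_Vcomp_functor:
  "is_functor (vpairs (ZZ C)) (ZZ1 C) (\<lambda>(v, w). zsubst v w) (\<lambda>(x, y). zvcomp C x y)"
  unfolding is_functor_def
proof (intro conjI ballI allI impI)
  fix p assume "p \<in> Obj (vpairs (ZZ C))"
  then obtain v w where p: "p = (v, w)" and vw: "vseqV (ZZ C) v w" by (auto simp: vpairs_def)
  have s: "zform C (zsrc v) v (zsrc w)" "zform C (zsrc w) w (ztgt C w)" "ztgt C v = zsrc w"
    using vw by (auto simp: vseqV_ZZ)
  show o: "(case p of (v, w) \<Rightarrow> zsubst v w) \<in> Obj (ZZ1 C)"
    using zform_zsubst[OF s(2,1)] ztgt_zsubst[OF s(3)] by (simp add: p ZZ1_Obj)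
  have "deriv C v (axiom_of (ident_drv C w)) v (ident_drv C v)"
    "deriv C w (Ident C (ztgt C w)) w (ident_drv C w)"
    using s ident_deriv axiom_ident by metis+
  from zvcomp_zcell[OF this] show "(case Ident (vpairs (ZZ C)) p of (x, y) \<Rightarrow> zvcomp C x y) =
      Ident (ZZ1 C) (case p of (v, w) \<Rightarrow> zsubst v w)"
    using s by (simp add: p vpairs_def dsubst_ident ztgt_zsubst axiom_ident)
next
  fix p assume "p \<in> Arr (vpairs (ZZ C))"
  then obtain x y where p: "p = (x, y)" and xy: "vseqC (ZZ C) x y" by (auto simp: vpairs_def)
  from xy obtain Z Z' a W k Y b where c:
    "x = zcell_of C Z (axiom_of b) Z' a" "y = zcell_of C W k Y b"
    "deriv C Z (axiom_of b) Z' a" "deriv C W k Y b" by (rule vseqC_ZZ)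
  show "(case p of (x, y) \<Rightarrow> zvcomp C x y) \<in> hom (ZZ1 C)
      (case Dom (vpairs (ZZ C)) p of (v, w) \<Rightarrow> zsubst v w)
      (case Cod (vpairs (ZZ C)) p of (v, w) \<Rightarrow> zsubst v w)"
    using ZZ1_ArrI[OF dsubst_deriv[OF c(4,3)]] c
    by (simp add: p vpairs_def hom_def zvcomp_zcell)
next
  fix p q assume pq: "seq (vpairs (ZZ C)) p q"
  obtain x y x' y' where p: "p = (x, y)" "q = (x', y')" by (cases p, cases q)
  have s: "vseqC (ZZ C) x y" "vseqC (ZZ C) x' y'" "zright x = zleft x'" "zright y = zleft y'"
    using pq by (auto simp: p vpairs_def seq_def)
  from s(1) obtain Z Z' a W k Y b where c:
    "x = zcell_of C Z (axiom_of b) Z' a" "y = zcell_of C W k Y b"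
    "deriv C Z (axiom_of b) Z' a" "deriv C W k Y b" by (rule vseqC_ZZ)
  from s(2) obtain X X' a' V k' U b' where c':
    "x' = zcell_of C X (axiom_of b') X' a'" "y' = zcell_of C V k' U b'"
    "deriv C X (axiom_of b') X' a'" "deriv C V k' U b'" by (rule vseqC_ZZ)
  have eq: "X = Z'" "V = Y" using s(3,4) c c' by auto
  note d = c(3,4) c'(3,4)[unfolded eq]
  have "zvcomp C (zhcomp C x x') (zhcomp C y y') =
      zcell_of C (zsubst Z W) (k \<cdot> k') (zsubst X' U) (dsubst (cut_drv C a a') (cut_drv C b b'))"
    using zvcomp_zcell[of Z "cut_drv C b b'" X' "cut_drv C a a'" W "k \<cdot> k'" U]
      cut_drv_deriv[OF d(1,3)] cut_drv_deriv[OF d(2,4)] axiom_cut_drv[OF d(2,4)]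
    by (simp add: c(1,2) c'(1,2) eq zhcomp_zcell[OF d(1,3)] zhcomp_zcell[OF d(2,4)])
  also have "\<dots> = zhcomp C (zvcomp C x y) (zvcomp C x' y')"
    using zcell_eq[OF dsubst_interchange[OF d(2,4,1,3)]]
    by (simp add: c(1,2) c'(1,2) eq zvcomp_zcell[OF d(1,2)] zvcomp_zcell[OF d(3,4)]
        zhcomp_zcell[OF dsubst_deriv[OF d(2,1)] dsubst_deriv[OF d(4,3)]])
  finally show "(case Comp (vpairs (ZZ C)) p q of (x, y) \<Rightarrow> zvcomp C x y) =
      Comp (ZZ1 C) (case p of (x, y) \<Rightarrow> zvcomp C x y) (case q of (x, y) \<Rightarrow> zvcomp C x y)"
    by (simp add: p vpairs_def)
qed

lemma ZZ_double_category: "double_category (ZZ C)"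
proof (rule double_category.intro)
  show "is_functor (D1 (ZZ C)) (D0 (ZZ C)) (SrcV (ZZ C)) (SrcC (ZZ C))"
    unfolding is_functor_def
  proof (intro conjI ballI allI impI; simp)
    fix x y assume "seq (ZZ1 C) x y"
    then obtain Z h W a k Y b where
      "x = zcell_of C Z h W a" "y = zcell_of C W k Y b" "deriv C Z h W a" "deriv C W k Y b"
      by (auto simp: seq_def elim!: ZZ1_ArrE)
    then show "ztop (zhcomp C x y) = ztop x \<cdot> ztop y"
      by (simp add: zhcomp_zcell axiom_cut_drv)
  qed (auto simp: ZZ1_Obj hom_def axiom_ident deriv_bounds dest: zform_Obj elim!: ZZ1_ArrE)
  show "is_functor (D1 (ZZ C)) (D0 (ZZ C)) (TgtV (ZZ C)) (TgtC (ZZ C))"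
    unfolding is_functor_def
  proof (intro conjI ballI allI impI; simp)
    fix x y assume "seq (ZZ1 C) x y"
    then obtain Z h W a k Y b where
      "x = zcell_of C Z h W a" "y = zcell_of C W k Y b" "deriv C Z h W a" "deriv C W k Y b"
      by (auto simp: seq_def elim!: ZZ1_ArrE)
    then show "zbot (zhcomp C x y) = zbot x \<cdot> zbot y"
      by (simp add: zhcomp_zcell)
  qed (auto simp: ZZ1_Obj hom_def deriv_bounds dest: zform_Obj elim!: ZZ1_ArrE)
  show "is_functor (D0 (ZZ C)) (D1 (ZZ C)) (UnitV (ZZ C)) (UnitC (ZZ C))"
    unfolding is_functor_def
  proof (intro conjI ballI allI impI; simp)
    fix f g assume s: "seq C f g"
    have "deriv C (Atom (Dom C f)) f (Atom (Dom C g)) (Ax f)"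
      "deriv C (Atom (Dom C g)) g (Atom (Cod C g)) (Ax g)"
      using axiom_deriv[of f] axiom_deriv[of g] s by (auto simp: seq_def)
    from zhcomp_zcell[OF this] s
    show "zcell_of C (Atom (Dom C (f \<cdot> g))) (f \<cdot> g) (Atom (Cod C (f \<cdot> g))) (Ax (f \<cdot> g)) =
      zhcomp C (zcell_of C (Atom (Dom C f)) f (Atom (Cod C f)) (Ax f))
               (zcell_of C (Atom (Dom C g)) g (Atom (Cod C g)) (Ax g))"
      by (simp add: comp_arr seqD)
  qed (auto simp: ZZ1_Obj hom_def ident_arr intro: zform.atom ZZ1_ArrI axiom_deriv)
  show "is_functor (vpairs (ZZ C)) (D1 (ZZ C))
      (\<lambda>(v, w). VcompV (ZZ C) v w) (\<lambda>(x, y). VcompC (ZZ C) x y)"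
    using ZZ_Vcomp_functor by simp
next
  fix x y assume "vseqC (ZZ C) x y"
  then show "SrcC (ZZ C) (VcompC (ZZ C) x y) = SrcC (ZZ C) x \<and>
      TgtC (ZZ C) (VcompC (ZZ C) x y) = TgtC (ZZ C) y"
    by (elim vseqC_ZZ) (simp add: zvcomp_zcell axiom_dsubst)
next
  fix x assume "x \<in> Arr (D1 (ZZ C))"
  then obtain Z h W a where x: "x = zcell_of C Z h W a" and d: "deriv C Z h W a"
    by (auto elim: ZZ1_ArrE)
  have t: "deriv C (Atom (zsrc Z)) (axiom_of a) (Atom (zsrc W)) (Ax (axiom_of a))"
    and b: "deriv C (Atom (ztgt C Z)) h (Atom (ztgt C W)) (Ax h)"
    using axiom_deriv[of "axiom_of a"] axiom_deriv[of h] deriv_bounds[OF d] by simp_all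
  show "VcompC (ZZ C) (UnitC (ZZ C) (SrcC (ZZ C) x)) x = x \<and>
      VcompC (ZZ C) x (UnitC (ZZ C) (TgtC (ZZ C) x)) = x"
    using zvcomp_zcell[OF t d] zvcomp_zcell[of Z "Ax h" W a "Atom (ztgt C Z)" h "Atom (ztgt C W)"]
      d b by (simp add: x deriv_bounds[OF d] zsubst_unit dsubst_unit)
next
  fix x y z assume xy: "vseqC (ZZ C) x y" and yz: "vseqC (ZZ C) y z"
  from xy obtain Z Z' a W k Y b where c:
    "x = zcell_of C Z (axiom_of b) Z' a" "y = zcell_of C W k Y b"
    "deriv C Z (axiom_of b) Z' a" "deriv C W k Y b" by (rule vseqC_ZZ)
  from yz obtain V l U e where e: "z = zcell_of C V l U e" "deriv C V l U e" "k = axiom_of e"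
    by (auto simp: vseqC_def c(2) elim!: ZZ1_ArrE)
  note b = c(4)[unfolded e(3)]
  have "zvcomp C (zvcomp C x y) z =
      zcell_of C (zsubst (zsubst Z W) V) l (zsubst (zsubst Z' Y) U) (dsubst (dsubst a b) e)"
    using zvcomp_zcell[OF dsubst_deriv[OF b c(3)] e(2)] zvcomp_zcell[OF c(3) b]
    by (simp add: c(1,2) e(1,3))
  also have "\<dots> = zvcomp C x (zvcomp C y z)"
    using zvcomp_zcell[of Z "dsubst b e" Z' a] c(3) dsubst_deriv[OF e(2) b]
      zvcomp_zcell[OF b e(2)]
    by (simp add: c(1,2) e(1,3) axiom_dsubst zsubst_assoc dsubst_assoc)
  finally show "VcompC (ZZ C) (VcompC (ZZ C) x y) z = VcompC (ZZ C) x (VcompC (ZZ C) y z)"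
    by simp
qed (auto simp: category_axioms ZZ1_category ZZ1_Obj vseqV_ZZ ztgt_zsubst zsubst_assoc
    zsubst_unit)

end

section \<open>Companion and conjoint pairs\<close>

text \<open>A companion \<open>v\<close> of \<open>f\<close> with its structure cell
  \<open>\<alpha>\<close> and the complementary cell \<open>\<alpha>'\<close>, so that
  \<open>is_companion\<close> asserts that some \<open>\<alpha>'\<close> completes the pair.\<close>
definition companion_pair ::
  "('o, 'a, 'v, 'c) dblcat \<Rightarrow> 'a \<Rightarrow> 'v \<Rightarrow> 'c \<Rightarrow> 'c \<Rightarrow> bool" where
  "companion_pair D f v \<alpha> \<alpha>' \<longleftrightarrow>
     v \<in> ver D (Dom (D0 D) f) (Cod (D0 D) f) \<and>
     \<alpha> \<in> cells D (UnitV D (Dom (D0 D) f)) v (Ident (D0 D) (Dom (D0 D) f)) f \<and>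
     \<alpha>' \<in> cells D v (UnitV D (Cod (D0 D) f)) f (Ident (D0 D) (Cod (D0 D) f)) \<and>
     \<alpha> \<cdot>\<^bsub>D1 D\<^esub> \<alpha>' = UnitC D f \<and> VcompC D \<alpha> \<alpha>' = Ident (D1 D) v"

text \<open>A conjoint \<open>v\<close> of \<open>f\<close> with its structure cell
  \<open>\<beta>\<close> and the complementary cell \<open>\<beta>'\<close>.\<close>
definition conjoint_pair ::
  "('o, 'a, 'v, 'c) dblcat \<Rightarrow> 'a \<Rightarrow> 'v \<Rightarrow> 'c \<Rightarrow> 'c \<Rightarrow> bool" where
  "conjoint_pair D f v \<beta> \<beta>' \<longleftrightarrow>
     v \<in> ver D (Cod (D0 D) f) (Dom (D0 D) f) \<and>
     \<beta> \<in> cells D v (UnitV D (Cod (D0 D) f)) (Ident (D0 D) (Cod (D0 D) f)) f \<and>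
     \<beta>' \<in> cells D (UnitV D (Dom (D0 D) f)) v f (Ident (D0 D) (Dom (D0 D) f)) \<and>
     \<beta>' \<cdot>\<^bsub>D1 D\<^esub> \<beta> = UnitC D f \<and> VcompC D \<beta> \<beta>' = Ident (D1 D) v"

lemma is_companion_iff: "is_companion D f v \<alpha> \<longleftrightarrow> (\<exists>\<alpha>'. companion_pair D f v \<alpha> \<alpha>')"
  by (auto simp: is_companion_def companion_pair_def Let_def)

lemma is_conjoint_iff: "is_conjoint D f v \<beta> \<longleftrightarrow> (\<exists>\<beta>'. conjoint_pair D f v \<beta> \<beta>')"
  by (auto simp: is_conjoint_def conjoint_pair_def Let_def)

context category
begin

lemma ZZ_companion_pair:
  assumes f: "f \<in> Arr C"
  shows "companion_pair (ZZ C) f (Plus f (Atom (Dom C f)))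
    (zcell_of C (Atom (Dom C f)) f (Plus f (Atom (Dom C f))) (Rp f (Ax (Ident C (Dom C f)))))
    (zcell_of C (Plus f (Atom (Dom C f))) (Ident C (Cod C f)) (Atom (Cod C f))
      (Lp f (Ident C (Cod C f)) (Ax f)))"
proof -
  let ?A = "Dom C f" and ?B = "Cod C f"
  have ob: "?A \<in> Obj C" "?B \<in> Obj C" using f Dom_closed Cod_closed by auto
  have s: "seq C (Ident C ?A) f" "seq C f (Ident C ?B)" using f ob by (auto simp: seq_def ident_arr)
  have 1: "deriv C (Atom ?A) f (Plus f (Atom ?A)) (Rp f (Ax (Ident C ?A)))"
    using deriv.rp[OF s(1) deriv.ax[OF Ident_closed[OF ob(1)]]] f by (simp add: Ident_left)
  have 2: "deriv C (Plus f (Atom ?A)) (Ident C ?B) (Atom ?B) (Lp f (Ident C ?B) (Ax f))"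
    using deriv.lp[OF s(2), of "Atom ?A" "Atom ?B" "Ax f"] axiom_deriv[OF f] f
    by (simp add: Ident_right)
  have z: "zform C ?A (Plus f (Atom ?A)) ?B"
    using f ob by (auto simp: hom_def intro!: zform.intros)
  show ?thesis
    using 1 2 z f
      zvcomp_zcell[of "Atom ?A" "Lp f (Ident C ?B) (Ax f)" "Plus f (Atom ?A)" _
        "Plus f (Atom ?A)" "Ident C ?B" "Atom ?B"]
    by (simp add: companion_pair_def ver_def cells_def hom_def[of "ZZ1 C"] ZZ1_ArrI ZZ1_Obj
        zhcomp_zcell Ident_left Ident_right)
qed

lemma ZZ_conjoint_pair:
  assumes f: "f \<in> Arr C"
  shows "conjoint_pair (ZZ C) f (Minus f (Atom (Cod C f)))
    (zcell_of C (Minus f (Atom (Cod C f))) f (Atom (Cod C f)) (Lm f (Ax (Ident C (Cod C f)))))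
    (zcell_of C (Atom (Dom C f)) (Ident C (Dom C f)) (Minus f (Atom (Cod C f)))
      (Rm (Ident C (Dom C f)) f (Ax f)))"
proof -
  let ?A = "Dom C f" and ?B = "Cod C f"
  have ob: "?A \<in> Obj C" "?B \<in> Obj C" using f Dom_closed Cod_closed by auto
  have s: "seq C (Ident C ?A) f" "seq C f (Ident C ?B)" using f ob by (auto simp: seq_def ident_arr)
  have 1: "deriv C (Minus f (Atom ?B)) f (Atom ?B) (Lm f (Ax (Ident C ?B)))"
    using deriv.lm[OF s(2) deriv.ax[OF Ident_closed[OF ob(2)]]] f by (simp add: Ident_right)
  have 2: "deriv C (Atom ?A) (Ident C ?A) (Minus f (Atom ?B)) (Rm (Ident C ?A) f (Ax f))"
    using deriv.rm[OF s(1), of "Atom ?A" "Atom ?B" "Ax f"] axiom_deriv[OF f] f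
    by (simp add: Ident_left)
  have z: "zform C ?B (Minus f (Atom ?B)) ?A"
    using f ob by (auto simp: hom_def intro!: zform.intros)
  show ?thesis
    using 1 2 z f
      zvcomp_zcell[of "Minus f (Atom ?B)" "Rm (Ident C ?A) f (Ax f)" "Atom ?B" _
        "Atom ?A" "Ident C ?A" "Minus f (Atom ?B)"]
    by (simp add: conjoint_pair_def ver_def cells_def hom_def[of "ZZ1 C"] ZZ1_ArrI ZZ1_Obj
        zhcomp_zcell Ident_left Ident_right)
qed

lemma ZZ_choice: "choice_of_fibrancy (ZZ C) (ZZ_choice C)"
  unfolding choice_of_fibrancy_def is_companion_iff is_conjoint_iff
  using ZZ_companion_pair ZZ_conjoint_pair by (auto simp: ZZ_choice_def)

lemma ZZ_fibrant: "fibrant_double_category (ZZ C)"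
  using ZZ_double_category ZZ_choice
  by (auto simp: fibrant_double_category_def fibrant_double_category_axioms_def
      choice_of_fibrancy_def)

end

section \<open>Calculus of cells in a double category\<close>

lemma cellsD:
  assumes "x \<in> cells D l r t b"
  shows "x \<in> Arr (D1 D)" "Dom (D1 D) x = l" "Cod (D1 D) x = r" "SrcC D x = t" "TgtC D x = b"
  using assms by (auto simp: cells_def hom_def)

context double_category
begin

sublocale H: category "D0 D" by (rule D0_category)
sublocale V: category "D1 D" by (rule D1_category)

lemma cells_boundary:
  assumes "x \<in> cells D l r t b"
  shows "l \<in> Obj (D1 D)" "r \<in> Obj (D1 D)" "t \<in> Arr (D0 D)" "b \<in> Arr (D0 D)"
    "SrcV D l = Dom (D0 D) t" "SrcV D r = Cod (D0 D) t"
    "TgtV D l = Dom (D0 D) b" "TgtV D r = Cod (D0 D) b"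
proof -
  note x = cellsD[OF assms]
  show "l \<in> Obj (D1 D)" "r \<in> Obj (D1 D)" using x V.Dom_closed V.Cod_closed by blast+
  show "t \<in> Arr (D0 D)" "SrcV D l = Dom (D0 D) t" "SrcV D r = Cod (D0 D) t"
    using Src_functor x by (auto simp: is_functor_def hom_def)
  show "b \<in> Arr (D0 D)" "TgtV D l = Dom (D0 D) b" "TgtV D r = Cod (D0 D) b"
    using Tgt_functor x by (auto simp: is_functor_def hom_def)
qed

lemma hcomp_cells:
  assumes "x \<in> cells D l m t b" "y \<in> cells D m r t' b'"
  shows "x \<cdot>\<^bsub>D1 D\<^esub> y \<in> cells D l r (t \<cdot>\<^bsub>D0 D\<^esub> t') (b \<cdot>\<^bsub>D0 D\<^esub> b')"
proof -
  have s: "seq (D1 D) x y" using cellsD[OF assms(1)] cellsD[OF assms(2)] by (simp add: seq_def)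
  then show ?thesis
    using V.Comp_closed[OF s] cellsD[OF assms(1)] cellsD[OF assms(2)] Src_functor Tgt_functor
    by (auto simp: cells_def is_functor_def hom_def)
qed

lemma hcomp_assoc:
  assumes "x \<in> cells D l m t b" "y \<in> cells D m n t' b'" "z \<in> cells D n r t'' b''"
  shows "(x \<cdot>\<^bsub>D1 D\<^esub> y) \<cdot>\<^bsub>D1 D\<^esub> z = x \<cdot>\<^bsub>D1 D\<^esub> (y \<cdot>\<^bsub>D1 D\<^esub> z)"
  using V.Comp_assoc cellsD[OF assms(1)] cellsD[OF assms(2)] cellsD[OF assms(3)]
  by (simp add: seq_def)

lemma hcomp_ident:
  assumes "x \<in> cells D l r t b"
  shows "Ident (D1 D) l \<cdot>\<^bsub>D1 D\<^esub> x = x" "x \<cdot>\<^bsub>D1 D\<^esub> Ident (D1 D) r = x"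
  using V.Ident_left V.Ident_right cellsD[OF assms] by auto

lemma vcomp_vseq:
  assumes "x \<in> cells D l r t m" "y \<in> cells D l' r' m b"
  shows "vseqC D x y" "vseqV D l l'" "vseqV D r r'"
  using cellsD[OF assms(1)] cellsD[OF assms(2)] cells_boundary[OF assms(1)]
    cells_boundary[OF assms(2)] by (auto simp: vseqC_def vseqV_def)

lemma vcomp_cells:
  assumes "x \<in> cells D l r t m" "y \<in> cells D l' r' m b"
  shows "VcompC D x y \<in> cells D (VcompV D l l') (VcompV D r r') t b"
proof -
  have "VcompC D x y \<in> hom (D1 D) (VcompV D l l') (VcompV D r r')"
    using Vcomp_functor vcomp_vseq[OF assms] cellsD[OF assms(1)] cellsD[OF assms(2)]
    by (auto simp: is_functor_def vpairs_def)
  then show ?thesis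
    using VcompC_bounds[OF vcomp_vseq(1)[OF assms]] cellsD[OF assms(1)] cellsD[OF assms(2)]
    by (simp add: cells_def)
qed

lemma vcomp_assoc:
  assumes "x \<in> cells D l r t m" "y \<in> cells D l' r' m n" "z \<in> cells D l'' r'' n b"
  shows "VcompC D (VcompC D x y) z = VcompC D x (VcompC D y z)"
  using VcompC_assoc vcomp_vseq assms by blast

lemma interchange:
  assumes "x \<in> cells D l m t b" "x' \<in> cells D m r t' b'"
    and "y \<in> cells D l2 m2 b c" "y' \<in> cells D m2 r2 b' c'"
  shows "VcompC D (x \<cdot>\<^bsub>D1 D\<^esub> x') (y \<cdot>\<^bsub>D1 D\<^esub> y') = VcompC D x y \<cdot>\<^bsub>D1 D\<^esub> VcompC D x' y'"
proof -
  have "seq (vpairs D) (x, y) (x', y')"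
    using vcomp_vseq(1)[OF assms(1,3)] vcomp_vseq(1)[OF assms(2,4)] cellsD[OF assms(1)]
      cellsD[OF assms(2)] cellsD[OF assms(3)] cellsD[OF assms(4)]
    by (simp add: seq_def vpairs_def)
  then show ?thesis using Vcomp_functor by (force simp: is_functor_def vpairs_def)
qed

lemma vcomp_unit:
  assumes "x \<in> cells D l r t b"
  shows "VcompC D (UnitC D t) x = x" "VcompC D x (UnitC D b) = x"
  using VcompC_unit cellsD[OF assms] by auto

lemma unit_cells:
  "f \<in> Arr (D0 D) \<Longrightarrow>
    UnitC D f \<in> cells D (UnitV D (Dom (D0 D) f)) (UnitV D (Cod (D0 D) f)) f f"
  using Unit_functor UnitC_bounds by (auto simp: is_functor_def cells_def)

lemma unit_comp:
  "seq (D0 D) f g \<Longrightarrow> UnitC D (f \<cdot>\<^bsub>D0 D\<^esub> g) = UnitC D f \<cdot>\<^bsub>D1 D\<^esub> UnitC D g"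
  using Unit_functor by (auto simp: is_functor_def)

lemma unit_ident: "A \<in> Obj (D0 D) \<Longrightarrow> UnitC D (Ident (D0 D) A) = Ident (D1 D) (UnitV D A)"
  using Unit_functor by (auto simp: is_functor_def)

lemma unit_ver: "A \<in> Obj (D0 D) \<Longrightarrow> UnitV D A \<in> ver D A A"
  using Unit_functor UnitV_bounds by (auto simp: is_functor_def ver_def)

lemma ident_cells:
  "v \<in> ver D A B \<Longrightarrow> Ident (D1 D) v \<in> cells D v v (Ident (D0 D) A) (Ident (D0 D) B)"
  using Src_functor Tgt_functor V.Ident_closed
  by (auto simp: is_functor_def ver_def cells_def hom_def)

lemma ver_unit:
  "v \<in> ver D A B \<Longrightarrow> VcompV D (UnitV D A) v = v \<and> VcompV D v (UnitV D B) = v"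
  using VcompV_unit by (auto simp: ver_def)

lemma ver_comp:
  assumes "v \<in> ver D A B" "w \<in> ver D B E"
  shows "VcompV D v w \<in> ver D A E"
proof -
  have s: "vseqV D v w" using assms by (auto simp: ver_def vseqV_def)
  then show ?thesis using VcompV_bounds[OF s] Vcomp_functor assms
    by (auto simp: is_functor_def ver_def vpairs_def)
qed

lemma ver_assoc:
  "u \<in> ver D A B \<Longrightarrow> v \<in> ver D B E \<Longrightarrow> w \<in> ver D E F \<Longrightarrow>
    VcompV D (VcompV D u v) w = VcompV D u (VcompV D v w)"
  using VcompV_assoc by (auto simp: ver_def vseqV_def)

lemma ident_vcomp:
  assumes "v \<in> ver D A B" "w \<in> ver D B E"
  shows "VcompC D (Ident (D1 D) v) (Ident (D1 D) w) = Ident (D1 D) (VcompV D v w)"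
proof -
  have "vseqV D v w" using assms by (auto simp: ver_def vseqV_def)
  then show ?thesis using Vcomp_functor by (force simp: is_functor_def vpairs_def)
qed

text \<open>For a cell \<open>x\<close> whose right boundary is a vertical identity, a cell
  \<open>y\<close> whose left boundary is one, and an arrow \<open>g\<close> between the two
  objects, both sides equal \<open>x \<cdot> U_g \<cdot> y\<close>: it does not matter which of
  \<open>x\<close> and \<open>y\<close> is placed above the other. With \<open>x\<close> the cell of
  a left rule and \<open>y\<close> the cell of a right rule, this yields all four
  permutations.\<close>
lemma cells_exchange:
  assumes x: "x \<in> cells D l (UnitV D M) t b" and y: "y \<in> cells D (UnitV D N) r t' b'"
    and g: "g \<in> hom (D0 D) M N"
  shows "VcompC D (x \<cdot>\<^bsub>D1 D\<^esub> UnitC D (g \<cdot>\<^bsub>D0 D\<^esub> t')) (UnitC D (b \<cdot>\<^bsub>D0 D\<^esub> g) \<cdot>\<^bsub>D1 D\<^esub> y) =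
    VcompC D (UnitC D (t \<cdot>\<^bsub>D0 D\<^esub> g) \<cdot>\<^bsub>D1 D\<^esub> y) (x \<cdot>\<^bsub>D1 D\<^esub> UnitC D (g \<cdot>\<^bsub>D0 D\<^esub> b'))"
proof -
  have MN: "M \<in> Obj (D0 D)" "N \<in> Obj (D0 D)" and gA: "g \<in> Arr (D0 D)" "Dom (D0 D) g = M" "Cod (D0 D) g = N"
    using g H.Dom_closed H.Cod_closed by (auto simp: hom_def)
  have bx: "t \<in> Arr (D0 D)" "b \<in> Arr (D0 D)" "Cod (D0 D) t = M" "Cod (D0 D) b = M"
    using cells_boundary[OF x] UnitV_bounds[OF MN(1)] by auto
  have by': "t' \<in> Arr (D0 D)" "b' \<in> Arr (D0 D)" "Dom (D0 D) t' = N" "Dom (D0 D) b' = N"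
    using cells_boundary[OF y] UnitV_bounds[OF MN(2)] by auto
  have s: "seq (D0 D) g t'" "seq (D0 D) g b'" "seq (D0 D) t g" "seq (D0 D) b g"
    using gA bx by' by (auto simp: seq_def)
  note Ug = unit_cells[OF gA(1), unfolded gA(2,3)]
  note Ut = unit_cells[OF bx(1), unfolded bx(3)] and Ub = unit_cells[OF bx(2), unfolded bx(4)]
  note Ut' = unit_cells[OF by'(1), unfolded by'(3)] and Ub' = unit_cells[OF by'(2), unfolded by'(4)]
  have "VcompC D (x \<cdot>\<^bsub>D1 D\<^esub> UnitC D (g \<cdot>\<^bsub>D0 D\<^esub> t')) (UnitC D (b \<cdot>\<^bsub>D0 D\<^esub> g) \<cdot>\<^bsub>D1 D\<^esub> y) =
      VcompC D (x \<cdot>\<^bsub>D1 D\<^esub> (UnitC D g \<cdot>\<^bsub>D1 D\<^esub> UnitC D t')) (UnitC D b \<cdot>\<^bsub>D1 D\<^esub> (UnitC D g \<cdot>\<^bsub>D1 D\<^esub> y))"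
    by (simp add: unit_comp s hcomp_assoc[OF Ub Ug y])
  also have "\<dots> = VcompC D x (UnitC D b) \<cdot>\<^bsub>D1 D\<^esub>
      VcompC D (UnitC D g \<cdot>\<^bsub>D1 D\<^esub> UnitC D t') (UnitC D g \<cdot>\<^bsub>D1 D\<^esub> y)"
    by (rule interchange[OF x hcomp_cells[OF Ug Ut'] Ub hcomp_cells[OF Ug y]])
  also have "\<dots> = x \<cdot>\<^bsub>D1 D\<^esub> (UnitC D g \<cdot>\<^bsub>D1 D\<^esub> y)"
    by (simp add: interchange[OF Ug Ut' Ug y] vcomp_unit[OF x] vcomp_unit(1)[OF Ug] vcomp_unit[OF y])
  also have "\<dots> = VcompC D (UnitC D t) x \<cdot>\<^bsub>D1 D\<^esub>
      VcompC D (UnitC D g \<cdot>\<^bsub>D1 D\<^esub> y) (UnitC D g \<cdot>\<^bsub>D1 D\<^esub> UnitC D b')"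
    by (simp add: interchange[OF Ug y Ug Ub'] vcomp_unit[OF x] vcomp_unit(1)[OF Ug] vcomp_unit[OF y])
  also have "\<dots> = VcompC D (UnitC D t \<cdot>\<^bsub>D1 D\<^esub> (UnitC D g \<cdot>\<^bsub>D1 D\<^esub> y)) (x \<cdot>\<^bsub>D1 D\<^esub> (UnitC D g \<cdot>\<^bsub>D1 D\<^esub> UnitC D b'))"
    by (rule interchange[OF Ut hcomp_cells[OF Ug y] x hcomp_cells[OF Ug Ub'], symmetric])
  also have "\<dots> = VcompC D (UnitC D (t \<cdot>\<^bsub>D0 D\<^esub> g) \<cdot>\<^bsub>D1 D\<^esub> y) (x \<cdot>\<^bsub>D1 D\<^esub> UnitC D (g \<cdot>\<^bsub>D0 D\<^esub> b'))"
    by (simp add: unit_comp s hcomp_assoc[OF Ut Ug y])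
  finally show ?thesis .
qed

text \<open>Complementary cells are unique: expand \<open>\<alpha>''\<close> as \<open>(\<alpha>
  \<odot> \<alpha>') \<cdot> (\<alpha>'' \<odot> U)\<close> and interchange.\<close>
lemma companion_pair_unique:
  assumes "f \<in> Arr (D0 D)" "companion_pair D f v \<alpha> \<alpha>'" "companion_pair D f v \<alpha> \<alpha>''"
  shows "\<alpha>'' = \<alpha>'"
proof -
  let ?A = "Dom (D0 D) f" and ?B = "Cod (D0 D) f"
  have v: "v \<in> ver D ?A ?B"
    and a: "\<alpha> \<in> cells D (UnitV D ?A) v (Ident (D0 D) ?A) f"
    and a': "\<alpha>' \<in> cells D v (UnitV D ?B) f (Ident (D0 D) ?B)"
    and a'': "\<alpha>'' \<in> cells D v (UnitV D ?B) f (Ident (D0 D) ?B)"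
    and eq: "\<alpha> \<cdot>\<^bsub>D1 D\<^esub> \<alpha>'' = UnitC D f" "VcompC D \<alpha> \<alpha>' = Ident (D1 D) v"
    using assms by (auto simp: companion_pair_def)
  have B: "?B \<in> Obj (D0 D)" using assms(1) H.Cod_closed by blast
  have i: "UnitC D (Ident (D0 D) ?B) \<in> cells D (UnitV D ?B) (UnitV D ?B) (Ident (D0 D) ?B) (Ident (D0 D) ?B)"
    using unit_cells[of "Ident (D0 D) ?B"] H.ident_arr[OF B] by simp
  have "\<alpha>'' = VcompC D \<alpha> \<alpha>' \<cdot>\<^bsub>D1 D\<^esub> VcompC D \<alpha>'' (UnitC D (Ident (D0 D) ?B))"
    using hcomp_ident[OF a''] vcomp_unit[OF a''] eq(2) by simp
  also have "\<dots> = VcompC D (\<alpha> \<cdot>\<^bsub>D1 D\<^esub> \<alpha>'') (\<alpha>' \<cdot>\<^bsub>D1 D\<^esub> UnitC D (Ident (D0 D) ?B))"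
    by (rule interchange[OF a a'' a' i, symmetric])
  also have "\<dots> = \<alpha>'"
    using hcomp_ident[OF a'] vcomp_unit[OF a'] eq(1) by (simp add: unit_ident[OF B])
  finally show ?thesis .
qed

lemma conjoint_pair_unique:
  assumes "f \<in> Arr (D0 D)" "conjoint_pair D f v \<beta> \<beta>'" "conjoint_pair D f v \<beta> \<beta>''"
  shows "\<beta>'' = \<beta>'"
proof -
  let ?A = "Dom (D0 D) f" and ?B = "Cod (D0 D) f"
  have v: "v \<in> ver D ?B ?A"
    and a: "\<beta> \<in> cells D v (UnitV D ?B) (Ident (D0 D) ?B) f"
    and a': "\<beta>' \<in> cells D (UnitV D ?A) v f (Ident (D0 D) ?A)"
    and a'': "\<beta>'' \<in> cells D (UnitV D ?A) v f (Ident (D0 D) ?A)"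
    and eq: "\<beta>'' \<cdot>\<^bsub>D1 D\<^esub> \<beta> = UnitC D f" "VcompC D \<beta> \<beta>' = Ident (D1 D) v"
    using assms by (auto simp: conjoint_pair_def)
  have A: "?A \<in> Obj (D0 D)" using assms(1) H.Dom_closed by blast
  have i: "UnitC D (Ident (D0 D) ?A) \<in> cells D (UnitV D ?A) (UnitV D ?A) (Ident (D0 D) ?A) (Ident (D0 D) ?A)"
    using unit_cells[of "Ident (D0 D) ?A"] H.ident_arr[OF A] by simp
  have "\<beta>'' = VcompC D \<beta>'' (UnitC D (Ident (D0 D) ?A)) \<cdot>\<^bsub>D1 D\<^esub> VcompC D \<beta> \<beta>'"
    using hcomp_ident[OF a''] vcomp_unit[OF a''] eq(2) by simp
  also have "\<dots> = VcompC D (\<beta>'' \<cdot>\<^bsub>D1 D\<^esub> \<beta>) (UnitC D (Ident (D0 D) ?A) \<cdot>\<^bsub>D1 D\<^esub> \<beta>')"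
    by (rule interchange[OF a'' a i a', symmetric])
  also have "\<dots> = \<beta>'"
    using hcomp_ident[OF a'] vcomp_unit[OF a'] eq(1) by (simp add: unit_ident[OF A])
  finally show ?thesis .
qed

end

section \<open>Double functors and the chosen pairs\<close>

lemma double_functor_cells:
  assumes "double_functor D E F" "x \<in> cells D l r t b"
  shows "mapC F x \<in> cells E (mapV F l) (mapV F r) (mapH F t) (mapH F b)"
  using assms(1) cellsD[OF assms(2)] by (auto simp: double_functor_def is_functor_def cells_def)

lemma (in double_category)
  assumes F: "double_functor D E F" and f: "f \<in> Arr (D0 D)"
  shows double_functor_companion_pair: "companion_pair D f v x x' \<Longrightarrow>
      companion_pair E (mapH F f) (mapV F v) (mapC F x) (mapC F x')"
    and double_functor_conjoint_pair: "conjoint_pair D f v x x' \<Longrightarrow>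
      conjoint_pair E (mapH F f) (mapV F v) (mapC F x) (mapC F x')"
proof -
  have o: "Dom (D0 D) f \<in> Obj (D0 D)" "Cod (D0 D) f \<in> Obj (D0 D)"
    using f H.Dom_closed H.Cod_closed by auto
  have H: "Dom (D0 E) (mapH F f) = mapO F (Dom (D0 D) f)"
    "Cod (D0 E) (mapH F f) = mapO F (Cod (D0 D) f)"
    "mapC F (UnitC D f) = UnitC E (mapH F f)"
    and A: "mapV F (UnitV D A) = UnitV E (mapO F A)"
    "mapH F (Ident (D0 D) A) = Ident (D0 E) (mapO F A)" if "A \<in> Obj (D0 D)" for A
    using F f that by (auto simp: double_functor_def is_functor_def hom_def)
  have V: "mapV F v \<in> ver E (mapO F A) (mapO F B) \<and> mapC F (Ident (D1 D) v) = Ident (D1 E) (mapV F v)"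
    if "v \<in> ver D A B" for A B
    using F that by (auto simp: double_functor_def is_functor_def ver_def)
  have h: "mapC F (x \<cdot>\<^bsub>D1 D\<^esub> y) = mapC F x \<cdot>\<^bsub>D1 E\<^esub> mapC F y"
    if "x \<in> cells D l m t b" "y \<in> cells D m r t' b'" for x y l m r t b t' b'
    using F cellsD[OF that(1)] cellsD[OF that(2)]
    by (auto simp: double_functor_def is_functor_def seq_def)
  have w: "mapC F (VcompC D x y) = VcompC E (mapC F x) (mapC F y)"
    if "x \<in> cells D l r t m" "y \<in> cells D l' r' m b" for x y l r t m l' r' b
    using F vcomp_vseq(1)[OF that] by (auto simp: double_functor_def)
  note H = H[OF o(1)]
  show "companion_pair E (mapH F f) (mapV F v) (mapC F x) (mapC F x')"
    if p: "companion_pair D f v x x'"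
  proof -
    note p = p[unfolded companion_pair_def, THEN conjunct1]
      p[unfolded companion_pair_def, THEN conjunct2, THEN conjunct1]
      p[unfolded companion_pair_def, THEN conjunct2, THEN conjunct2, THEN conjunct1]
      p[unfolded companion_pair_def, THEN conjunct2, THEN conjunct2, THEN conjunct2]
    show ?thesis
      using V[OF p(1)] double_functor_cells[OF F p(2)] double_functor_cells[OF F p(3)]
        h[OF p(2,3)] w[OF p(2,3)] p(4) A[OF o(1)] A[OF o(2)] H
      by (simp add: companion_pair_def)
  qed
  show "conjoint_pair E (mapH F f) (mapV F v) (mapC F x) (mapC F x')"
    if p: "conjoint_pair D f v x x'"
  proof -
    note p = p[unfolded conjoint_pair_def, THEN conjunct1]
      p[unfolded conjoint_pair_def, THEN conjunct2, THEN conjunct1]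
      p[unfolded conjoint_pair_def, THEN conjunct2, THEN conjunct2, THEN conjunct1]
      p[unfolded conjoint_pair_def, THEN conjunct2, THEN conjunct2, THEN conjunct2]
    show ?thesis
      using V[OF p(1)] double_functor_cells[OF F p(2)] double_functor_cells[OF F p(3)]
        h[OF p(3,2)] w[OF p(2,3)] p(4) A[OF o(1)] A[OF o(2)] H
      by (simp add: conjoint_pair_def)
  qed
qed

section \<open>Interpretation of derivations in a fibrant double category\<close>

text \<open>A double category with chosen companions and conjoints. It is fibrant, and its
  underlying horizontal category is the category over which derivations are interpreted.\<close>
locale chosen_fibrancy = double_category D for D :: "('o, 'a, 'v, 'c) dblcat" +
  fixes K :: "('a, 'v, 'c) fib_choice"
  assumes choice: "choice_of_fibrancy D K"
begin

text \<open>The complementary cells of the chosen companions and conjoints. They are unique on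
  arrows of the horizontal category, so nothing is chosen there.\<close>
definition cmpC' :: "'a \<Rightarrow> 'c" where
  "cmpC' f = (SOME \<alpha>'. companion_pair D f (cmpV K f) (cmpC K f) \<alpha>')"

definition cnjC' :: "'a \<Rightarrow> 'c" where
  "cnjC' f = (SOME \<beta>'. conjoint_pair D f (cnjV K f) (cnjC K f) \<beta>')"

lemma cmp_pair: "f \<in> Arr (D0 D) \<Longrightarrow> companion_pair D f (cmpV K f) (cmpC K f) (cmpC' f)"
  using choice someI_ex[of "companion_pair D f (cmpV K f) (cmpC K f)"]
  by (simp add: cmpC'_def choice_of_fibrancy_def is_companion_iff)

lemma cnj_pair: "f \<in> Arr (D0 D) \<Longrightarrow> conjoint_pair D f (cnjV K f) (cnjC K f) (cnjC' f)"
  using choice someI_ex[of "conjoint_pair D f (cnjV K f) (cnjC K f)"]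
  by (simp add: cnjC'_def choice_of_fibrancy_def is_conjoint_iff)

text \<open>The interpretation of zigzag formulas: \<open>f\<^sup>+\<close> and
  \<open>g\<^sup>-\<close> compose with the chosen companion and conjoint.\<close>
fun vint :: "('o, 'a) zz \<Rightarrow> 'v" where
  "vint (Atom A) = UnitV D A"
| "vint (Plus f Z) = VcompV D (vint Z) (cmpV K f)"
| "vint (Minus g Z) = VcompV D (vint Z) (cnjV K g)"

text \<open>The interpretation of derivations. Each rule composes the interpretation of its premise
  vertically with a cell whose top is the arrow that the premise lies over and whose bottom is the
  arrow that the conclusion lies over.\<close>
fun cint :: "'a drv \<Rightarrow> 'c" where
  "cint (Ax f) = UnitC D f"
| "cint (Lp f g a) = VcompC D (cint a) (cmpC' f \<cdot>\<^bsub>D1 D\<^esub> UnitC D g)"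
| "cint (Rp f a) = VcompC D (cint a) (UnitC D (over (D0 D) a) \<cdot>\<^bsub>D1 D\<^esub> cmpC K f)"
| "cint (Lm g a) = VcompC D (cint a) (cnjC K g \<cdot>\<^bsub>D1 D\<^esub> UnitC D (over (D0 D) a))"
| "cint (Rm f g a) = VcompC D (cint a) (UnitC D f \<cdot>\<^bsub>D1 D\<^esub> cnjC' g)"

lemma cmp_ver: "f \<in> Arr (D0 D) \<Longrightarrow> cmpV K f \<in> ver D (Dom (D0 D) f) (Cod (D0 D) f)"
  using cmp_pair by (auto simp: companion_pair_def)

lemma cnj_ver: "f \<in> Arr (D0 D) \<Longrightarrow> cnjV K f \<in> ver D (Cod (D0 D) f) (Dom (D0 D) f)"
  using cnj_pair by (auto simp: conjoint_pair_def)

lemma vint_ver: "zform (D0 D) A Z B \<Longrightarrow> vint Z \<in> ver D A B"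
proof (induction rule: zform.induct)
  case (atom A) then show ?case by (simp add: unit_ver)
next
  case (plus A Z B f B')
  then show ?case using ver_comp[OF _ cmp_ver] by (auto simp: hom_def)
next
  case (minus A Z B' g B)
  then show ?case using ver_comp[OF _ cnj_ver] by (auto simp: hom_def)
qed

text \<open>The boundaries of the cells that interpret the four rules.\<close>
lemma rule_cells:
  assumes "seq (D0 D) f g"
  shows lp_cell: "cmpC' f \<cdot>\<^bsub>D1 D\<^esub> UnitC D g \<in>
      cells D (cmpV K f) (UnitV D (Cod (D0 D) g)) (f \<cdot>\<^bsub>D0 D\<^esub> g) g"
    and rp_cell: "UnitC D f \<cdot>\<^bsub>D1 D\<^esub> cmpC K g \<in>
      cells D (UnitV D (Dom (D0 D) f)) (cmpV K g) f (f \<cdot>\<^bsub>D0 D\<^esub> g)"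
    and lm_cell: "cnjC K f \<cdot>\<^bsub>D1 D\<^esub> UnitC D g \<in>
      cells D (cnjV K f) (UnitV D (Cod (D0 D) g)) g (f \<cdot>\<^bsub>D0 D\<^esub> g)"
    and rm_cell: "UnitC D f \<cdot>\<^bsub>D1 D\<^esub> cnjC' g \<in>
      cells D (UnitV D (Dom (D0 D) f)) (cnjV K g) (f \<cdot>\<^bsub>D0 D\<^esub> g) f"
proof -
  have fg: "f \<in> Arr (D0 D)" "g \<in> Arr (D0 D)" "Cod (D0 D) f = Dom (D0 D) g"
    using assms by (auto simp: seq_def)
  note f = cmp_pair[OF fg(1), unfolded companion_pair_def]
    cnj_pair[OF fg(1), unfolded conjoint_pair_def]
  note g = cmp_pair[OF fg(2), unfolded companion_pair_def]
    cnj_pair[OF fg(2), unfolded conjoint_pair_def]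
  have "cmpC' f \<in> cells D (cmpV K f) (UnitV D (Dom (D0 D) g)) f (Ident (D0 D) (Dom (D0 D) g))"
    using f fg(3) by simp
  from hcomp_cells[OF this unit_cells[OF fg(2)]]
  show "cmpC' f \<cdot>\<^bsub>D1 D\<^esub> UnitC D g \<in>
      cells D (cmpV K f) (UnitV D (Cod (D0 D) g)) (f \<cdot>\<^bsub>D0 D\<^esub> g) g"
    using H.Ident_left[OF fg(2)] by simp
  have "cmpC K g \<in> cells D (UnitV D (Cod (D0 D) f)) (cmpV K g) (Ident (D0 D) (Cod (D0 D) f)) g"
    using g fg(3) by simp
  from hcomp_cells[OF unit_cells[OF fg(1)] this]
  show "UnitC D f \<cdot>\<^bsub>D1 D\<^esub> cmpC K g \<in>
      cells D (UnitV D (Dom (D0 D) f)) (cmpV K g) f (f \<cdot>\<^bsub>D0 D\<^esub> g)"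
    using H.Ident_right[OF fg(1)] by simp
  have "cnjC K f \<in> cells D (cnjV K f) (UnitV D (Dom (D0 D) g)) (Ident (D0 D) (Dom (D0 D) g)) f"
    using f fg(3) by simp
  from hcomp_cells[OF this unit_cells[OF fg(2)]]
  show "cnjC K f \<cdot>\<^bsub>D1 D\<^esub> UnitC D g \<in>
      cells D (cnjV K f) (UnitV D (Cod (D0 D) g)) g (f \<cdot>\<^bsub>D0 D\<^esub> g)"
    using H.Ident_left[OF fg(2)] by simp
  have "cnjC' g \<in> cells D (UnitV D (Cod (D0 D) f)) (cnjV K g) g (Ident (D0 D) (Cod (D0 D) f))"
    using g fg(3) by simp
  from hcomp_cells[OF unit_cells[OF fg(1)] this]
  show "UnitC D f \<cdot>\<^bsub>D1 D\<^esub> cnjC' g \<in>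
      cells D (UnitV D (Dom (D0 D) f)) (cnjV K g) (f \<cdot>\<^bsub>D0 D\<^esub> g) f"
    using H.Ident_right[OF fg(1)] by simp
qed

lemma vint_deriv:
  assumes "deriv (D0 D) Z h W a"
  shows "vint Z \<in> ver D (zsrc Z) (Dom (D0 D) h)" "vint W \<in> ver D (zsrc W) (Cod (D0 D) h)"
  using H.deriv_zform[OF assms] vint_ver by blast+

lemma cint_cells:
  "deriv (D0 D) Z h W a \<Longrightarrow> cint a \<in> cells D (vint Z) (vint W) (axiom_of a) h"
proof (induction rule: deriv.induct)
  case (ax f A A')
  then show ?case using unit_cells by (auto simp: hom_def)
next
  case (lp f g S T a)
  then show ?case
    using vcomp_cells[OF lp.IH lp_cell[OF lp(1)]] ver_unit[OF vint_deriv(2)[OF lp(2)]]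
      H.comp_arr[OF lp(1)] by simp
next
  case (rp k f Z S a)
  then show ?case
    using vcomp_cells[OF rp.IH rp_cell[OF rp(1)]] ver_unit[OF vint_deriv(1)[OF rp(2)]]
    by (simp add: H.over_deriv)
next
  case (lm g k T W a)
  then show ?case
    using vcomp_cells[OF lm.IH lm_cell[OF lm(1)]] ver_unit[OF vint_deriv(2)[OF lm(2)]]
    by (simp add: H.over_deriv)
next
  case (rm f g S T a)
  then show ?case
    using vcomp_cells[OF rm.IH rm_cell[OF rm(1)]] ver_unit[OF vint_deriv(1)[OF rm(2)]]
      H.comp_arr[OF rm(1)] by simp
qed

lemma cmp_cells:
  assumes "f \<in> Arr (D0 D)"
  shows "cmpC K f \<in> cells D (UnitV D (Dom (D0 D) f)) (cmpV K f) (Ident (D0 D) (Dom (D0 D) f)) f"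
    and "cmpC' f \<in> cells D (cmpV K f) (UnitV D (Cod (D0 D) f)) f (Ident (D0 D) (Cod (D0 D) f))"
    and "cmpC K f \<cdot>\<^bsub>D1 D\<^esub> cmpC' f = UnitC D f"
    and "VcompC D (cmpC K f) (cmpC' f) = Ident (D1 D) (cmpV K f)"
  using cmp_pair[OF assms] by (simp_all add: companion_pair_def)

lemma cnj_cells:
  assumes "f \<in> Arr (D0 D)"
  shows "cnjC K f \<in> cells D (cnjV K f) (UnitV D (Cod (D0 D) f)) (Ident (D0 D) (Cod (D0 D) f)) f"
    and "cnjC' f \<in> cells D (UnitV D (Dom (D0 D) f)) (cnjV K f) f (Ident (D0 D) (Dom (D0 D) f))"
    and "cnjC' f \<cdot>\<^bsub>D1 D\<^esub> cnjC K f = UnitC D f"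
    and "VcompC D (cnjC K f) (cnjC' f) = Ident (D1 D) (cnjV K f)"
  using cnj_pair[OF assms] by (simp_all add: conjoint_pair_def)

lemma seq_facts:
  assumes "seq (D0 D) f g"
  shows "f \<in> Arr (D0 D)" "g \<in> Arr (D0 D)" "Dom (D0 D) g = Cod (D0 D) f"
  using assms by (auto simp: seq_def)

section \<open>Functoriality of the interpretation\<close>

lemma cint_perm: "perm (D0 D) Z h W a b \<Longrightarrow> cint a = cint b"
proof (induction rule: H.perm_induct)
  case (cong_rp k f Z S a b)
  then show ?case using H.over_deriv H.perm_deriv by (metis cint.simps(3))
next
  case (cong_lm g k T W a b)
  then show ?case using H.over_deriv H.perm_deriv by (metis cint.simps(4))
next
  case (rp_lm f g h T W a)
  note f = seq_facts[OF rp_lm(1)] and g = seq_facts[OF rp_lm(2)]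
  note a = cint_cells[OF rp_lm(3)]
  have s: "seq (D0 D) (f \<cdot>\<^bsub>D0 D\<^esub> g) h" "seq (D0 D) f (g \<cdot>\<^bsub>D0 D\<^esub> h)"
    using rp_lm by (simp_all add: H.seq_comp_left H.seq_comp_right)
  have "g \<in> hom (D0 D) (Cod (D0 D) f) (Dom (D0 D) h)" using f g by (simp add: hom_def)
  from cells_exchange[OF cnj_cells(1)[OF f(1)] cmp_cells(1)[OF g(2)] this]
  show ?case
    using vcomp_assoc[OF a lm_cell[OF rp_lm(1)] rp_cell[OF s(1)]]
      vcomp_assoc[OF a rp_cell[OF rp_lm(2)] lm_cell[OF s(2)]] rp_lm(3) f g
      H.Ident_left[OF f(2)] H.Ident_right[OF f(2)]
    by (simp add: H.over_deriv)
next
  case (rp_lp f g h S W a)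
  note f = seq_facts[OF rp_lp(1)] and g = seq_facts[OF rp_lp(2)]
  note a = cint_cells[OF rp_lp(3)]
  have s: "seq (D0 D) (f \<cdot>\<^bsub>D0 D\<^esub> g) h" "seq (D0 D) f (g \<cdot>\<^bsub>D0 D\<^esub> h)"
    using rp_lp by (simp_all add: H.seq_comp_left H.seq_comp_right)
  have "g \<in> hom (D0 D) (Cod (D0 D) f) (Dom (D0 D) h)" using f g by (simp add: hom_def)
  from cells_exchange[OF cmp_cells(2)[OF f(1)] cmp_cells(1)[OF g(2)] this]
  show ?case
    using vcomp_assoc[OF a lp_cell[OF rp_lp(1)] rp_cell[OF rp_lp(2)]]
      vcomp_assoc[OF a rp_cell[OF s(1)], of "cmpC' f \<cdot>\<^bsub>D1 D\<^esub> UnitC D (g \<cdot>\<^bsub>D0 D\<^esub> h)"]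
      lp_cell[OF s(2)] rp_lp(1-3) f g
      H.Ident_left[OF f(2)] H.Ident_right[OF f(2)]
    by (simp add: H.over_deriv H.Comp_assoc)
next
  case (rm_lm f g h T W a)
  note f = seq_facts[OF rm_lm(1)] and g = seq_facts[OF rm_lm(2)]
  note a = cint_cells[OF rm_lm(3)]
  have s: "seq (D0 D) (f \<cdot>\<^bsub>D0 D\<^esub> g) h" "seq (D0 D) f (g \<cdot>\<^bsub>D0 D\<^esub> h)"
    using rm_lm by (simp_all add: H.seq_comp_left H.seq_comp_right)
  have "g \<in> hom (D0 D) (Cod (D0 D) f) (Dom (D0 D) h)" using f g by (simp add: hom_def)
  from cells_exchange[OF cnj_cells(1)[OF f(1)] cnj_cells(2)[OF g(2)] this]
  show ?case
    using vcomp_assoc[OF a rm_cell[OF rm_lm(2)] lm_cell[OF rm_lm(1)]]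
      vcomp_assoc[OF a lm_cell[OF s(2)], of "UnitC D (f \<cdot>\<^bsub>D0 D\<^esub> g) \<cdot>\<^bsub>D1 D\<^esub> cnjC' h"]
      rm_cell[OF s(1)] rm_lm(1-3) f g
      H.Ident_left[OF f(2)] H.Ident_right[OF f(2)]
    by (simp add: H.over_deriv H.Comp_assoc)
next
  case (rm_lp f g h S W a)
  note f = seq_facts[OF rm_lp(1)] and g = seq_facts[OF rm_lp(2)]
  note a = cint_cells[OF rm_lp(3)]
  have s: "seq (D0 D) (f \<cdot>\<^bsub>D0 D\<^esub> g) h" "seq (D0 D) f (g \<cdot>\<^bsub>D0 D\<^esub> h)"
    using rm_lp by (simp_all add: H.seq_comp_left H.seq_comp_right)
  have "g \<in> hom (D0 D) (Cod (D0 D) f) (Dom (D0 D) h)" using f g by (simp add: hom_def)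
  from cells_exchange[OF cmp_cells(2)[OF f(1)] cnj_cells(2)[OF g(2)] this]
  show ?case
    using vcomp_assoc[OF a lp_cell[OF s(2)] rm_cell[OF rm_lp(2)]]
      vcomp_assoc[OF a, of "UnitC D (f \<cdot>\<^bsub>D0 D\<^esub> g) \<cdot>\<^bsub>D1 D\<^esub> cnjC' h"]
      rm_cell[OF s(1)] lp_cell[OF rm_lp(1)] rm_lp(1-3) f g
      H.Ident_left[OF f(2)] H.Ident_right[OF f(2)]
    by (simp add: H.over_deriv H.Comp_assoc)
qed simp_all

text \<open>Placing a cell that ends in a unit cell below a horizontal composite affects only the
  left factor; \<open>vcomp_right\<close> is the mirror image. These interpret the clauses of cut
  that move a rule outwards.\<close>
lemma vcomp_left:
  assumes x: "x \<in> cells D l m t b" and y: "y \<in> cells D m r t' b'"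
    and z: "z \<in> cells D c (UnitV D (Dom (D0 D) b')) b e"
  shows "VcompC D (x \<cdot>\<^bsub>D1 D\<^esub> y) (z \<cdot>\<^bsub>D1 D\<^esub> UnitC D b') = VcompC D x z \<cdot>\<^bsub>D1 D\<^esub> y"
  using interchange[OF x y z unit_cells[OF cells_boundary(4)[OF y]]] vcomp_unit(2)[OF y] by simp

lemma vcomp_right:
  assumes x: "x \<in> cells D l m t b" and y: "y \<in> cells D m r t' b'"
    and z: "z \<in> cells D (UnitV D (Cod (D0 D) b)) c b' e"
  shows "VcompC D (x \<cdot>\<^bsub>D1 D\<^esub> y) (UnitC D b \<cdot>\<^bsub>D1 D\<^esub> z) = x \<cdot>\<^bsub>D1 D\<^esub> VcompC D y z"
  using interchange[OF x y unit_cells[OF cells_boundary(4)[OF x]] z] vcomp_unit(2)[OF x] by simp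

lemma hcomp_unit_right:
  assumes "x \<in> cells D l (UnitV D (Dom (D0 D) f)) t b" "seq (D0 D) f g"
  shows "(x \<cdot>\<^bsub>D1 D\<^esub> UnitC D f) \<cdot>\<^bsub>D1 D\<^esub> UnitC D g = x \<cdot>\<^bsub>D1 D\<^esub> UnitC D (f \<cdot>\<^bsub>D0 D\<^esub> g)"
proof -
  note f = seq_facts[OF assms(2)]
  have "UnitC D f \<in> cells D (UnitV D (Dom (D0 D) f)) (UnitV D (Dom (D0 D) g)) f f"
    using unit_cells[OF f(1)] f(3) by simp
  from hcomp_assoc[OF assms(1) this unit_cells[OF f(2)]] show ?thesis
    using unit_comp[OF assms(2)] by simp
qed

lemma hcomp_unit_left:
  assumes "x \<in> cells D (UnitV D (Cod (D0 D) g)) r t b" "seq (D0 D) f g"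
  shows "UnitC D f \<cdot>\<^bsub>D1 D\<^esub> (UnitC D g \<cdot>\<^bsub>D1 D\<^esub> x) = UnitC D (f \<cdot>\<^bsub>D0 D\<^esub> g) \<cdot>\<^bsub>D1 D\<^esub> x"
proof -
  note f = seq_facts[OF assms(2)]
  have "UnitC D f \<in> cells D (UnitV D (Dom (D0 D) f)) (UnitV D (Dom (D0 D) g)) f f"
    using unit_cells[OF f(1)] f(3) by simp
  from hcomp_assoc[OF this unit_cells[OF f(2)] assms(1)] show ?thesis
    using unit_comp[OF assms(2)] by simp
qed

lemma cint_cut_drv:
  "deriv (D0 D) Z h W a \<Longrightarrow> deriv (D0 D) W k Y b \<Longrightarrow>
    cint (cut_drv (D0 D) a b) = cint a \<cdot>\<^bsub>D1 D\<^esub> cint b"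
proof (induction rule: H.cut_induct)
  case (ax f g)
  then show ?case by (simp add: unit_comp)
next
  case (lp S f g W a k Y b)
  note f = seq_facts[OF lp(1)]
  have s: "seq (D0 D) g k" using H.deriv_seq[OF deriv.lp[OF lp(1,2)] lp(3)] .
  note g = seq_facts[OF s]
  have c: "cmpC' f \<in> cells D (cmpV K f) (UnitV D (Dom (D0 D) g)) f (Ident (D0 D) (Dom (D0 D) g))"
    using cmp_cells(2)[OF f(1)] f by simp
  have z: "cmpC' f \<cdot>\<^bsub>D1 D\<^esub> UnitC D g \<in>
      cells D (cmpV K f) (UnitV D (Dom (D0 D) k)) (f \<cdot>\<^bsub>D0 D\<^esub> g) g"
    using lp_cell[OF lp(1)] g by simp
  show ?case
    using vcomp_left[OF cint_cells[OF lp(2)] cint_cells[OF lp(3)] z] lp(3,4)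
      hcomp_unit_right[OF c s] by (simp add: H.over_deriv)
next
  case (lm T g h W a k Y b)
  have s: "seq (D0 D) h k" using H.deriv_seq lm by blast
  note g = seq_facts[OF lm(1)] and h = seq_facts[OF s]
  have c: "cnjC K g \<in> cells D (cnjV K g) (UnitV D (Dom (D0 D) h)) (Ident (D0 D) (Dom (D0 D) h)) g"
    using cnj_cells(1)[OF g(1)] g by simp
  have z: "cnjC K g \<cdot>\<^bsub>D1 D\<^esub> UnitC D h \<in>
      cells D (cnjV K g) (UnitV D (Dom (D0 D) k)) h (g \<cdot>\<^bsub>D0 D\<^esub> h)"
    using lm_cell[OF lm(1)] h by simp
  show ?case
    using vcomp_left[OF cint_cells[OF lm(2)] cint_cells[OF lm(3)] z] lm(2,3,4)
      hcomp_unit_right[OF c s] H.over_deriv[OF H.cut_drv_deriv[OF lm(2,3)]]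
    by (simp add: H.over_deriv)
next
  case (rp Z h W a k S f b)
  have s: "seq (D0 D) h k" using H.deriv_seq rp by blast
  note k = seq_facts[OF rp(2)] and h = seq_facts[OF s]
  have c: "cmpC K f \<in> cells D (UnitV D (Cod (D0 D) k)) (cmpV K f) (Ident (D0 D) (Cod (D0 D) k)) f"
    using cmp_cells(1)[OF k(2)] k by simp
  have z: "UnitC D k \<cdot>\<^bsub>D1 D\<^esub> cmpC K f \<in>
      cells D (UnitV D (Cod (D0 D) h)) (cmpV K f) k (k \<cdot>\<^bsub>D0 D\<^esub> f)"
    using rp_cell[OF rp(2)] h by simp
  show ?case
    using vcomp_right[OF cint_cells[OF rp(3)] cint_cells[OF rp(4)] z] rp(1,3,4,5)
      hcomp_unit_left[OF c s] H.over_deriv[OF H.cut_drv_deriv[OF rp(3,4)]]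
    by (simp add: H.over_deriv cut_drv_right)
next
  case (rm Z h W a k g T b)
  have s: "seq (D0 D) h k" using H.deriv_seq rm H.seq_comp_right by blast
  note k = seq_facts[OF rm(2)] and h = seq_facts[OF s]
  have c: "cnjC' g \<in> cells D (UnitV D (Cod (D0 D) k)) (cnjV K g) g (Ident (D0 D) (Cod (D0 D) k))"
    using cnj_cells(2)[OF k(2)] k by simp
  have z: "UnitC D k \<cdot>\<^bsub>D1 D\<^esub> cnjC' g \<in>
      cells D (UnitV D (Cod (D0 D) h)) (cnjV K g) (k \<cdot>\<^bsub>D0 D\<^esub> g) k"
    using rm_cell[OF rm(2)] h by simp
  show ?case
    using vcomp_right[OF cint_cells[OF rm(3)] cint_cells[OF rm(4)] z] rm(1,3,5)
      hcomp_unit_left[OF c s]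
    by (simp add: H.over_deriv cut_drv_right)
next
  case (rp_lp Z h f S a k Y b)
  note h = seq_facts[OF rp_lp(1)] and f = seq_facts[OF rp_lp(2)]
  have s: "seq (D0 D) h (f \<cdot>\<^bsub>D0 D\<^esub> k)" using rp_lp by (simp add: H.seq_comp_right)
  have c: "cmpC K f \<in> cells D (UnitV D (Cod (D0 D) h)) (cmpV K f) (Ident (D0 D) (Cod (D0 D) h)) f"
    using cmp_cells(1)[OF h(2)] h by simp
  have c': "cmpC' f \<in> cells D (cmpV K f) (UnitV D (Dom (D0 D) k)) f (Ident (D0 D) (Dom (D0 D) k))"
    using cmp_cells(2)[OF f(1)] f by simp
  note Uh = unit_cells[OF h(1)] and Uk = unit_cells[OF f(2)]
  \<comment> \<open>In a principal cut the middle two cells cancel, leaving a unit cell.\<close>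
  have "(UnitC D h \<cdot>\<^bsub>D1 D\<^esub> cmpC K f) \<cdot>\<^bsub>D1 D\<^esub> (cmpC' f \<cdot>\<^bsub>D1 D\<^esub> UnitC D k) =
      UnitC D (h \<cdot>\<^bsub>D0 D\<^esub> (f \<cdot>\<^bsub>D0 D\<^esub> k))"
    using hcomp_assoc[OF Uh c hcomp_cells[OF c' Uk]] hcomp_assoc[OF c c' Uk] cmp_cells(3)[OF h(2)]
      unit_comp[OF s] unit_comp[OF rp_lp(2)] by simp
  then show ?case
    using interchange[OF cint_cells[OF rp_lp(3)] cint_cells[OF rp_lp(4)]
        rp_cell[OF rp_lp(1)] lp_cell[OF rp_lp(2)]]
      vcomp_unit(2)[OF hcomp_cells[OF cint_cells[OF rp_lp(3)] cint_cells[OF rp_lp(4)]]] rp_lp(3,5)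
    by (simp add: H.over_deriv)
next
  case (rm_lm Z h f T a k Y b)
  note h = seq_facts[OF rm_lm(1)] and f = seq_facts[OF rm_lm(2)]
  have s: "seq (D0 D) (h \<cdot>\<^bsub>D0 D\<^esub> f) k" using rm_lm by (simp add: H.seq_comp_left)
  have c: "cnjC K f \<in> cells D (cnjV K f) (UnitV D (Dom (D0 D) k)) (Ident (D0 D) (Dom (D0 D) k)) f"
    using cnj_cells(1)[OF h(2)] f by simp
  have c': "cnjC' f \<in> cells D (UnitV D (Cod (D0 D) h)) (cnjV K f) f (Ident (D0 D) (Cod (D0 D) h))"
    using cnj_cells(2)[OF f(1)] h by simp
  note Uh = unit_cells[OF h(1)] and Uk = unit_cells[OF f(2)]
  \<comment> \<open>As above, with the conjoint cells in the opposite order.\<close>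
  have "(UnitC D h \<cdot>\<^bsub>D1 D\<^esub> cnjC' f) \<cdot>\<^bsub>D1 D\<^esub> (cnjC K f \<cdot>\<^bsub>D1 D\<^esub> UnitC D k) =
      UnitC D (h \<cdot>\<^bsub>D0 D\<^esub> f \<cdot>\<^bsub>D0 D\<^esub> k)"
    using hcomp_assoc[OF Uh c' hcomp_cells[OF c Uk]] hcomp_assoc[OF c' c Uk] cnj_cells(3)[OF h(2)]
      unit_comp[of h "f \<cdot>\<^bsub>D0 D\<^esub> k"] unit_comp[OF rm_lm(2)] rm_lm(1,2)
    by (simp add: H.Comp_assoc H.seq_comp_right)
  then show ?case
    using interchange[OF cint_cells[OF rm_lm(3)] cint_cells[OF rm_lm(4)]
        rm_cell[OF rm_lm(1)] lm_cell[OF rm_lm(2)]]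
      vcomp_unit(2)[OF hcomp_cells[OF cint_cells[OF rm_lm(3)] cint_cells[OF rm_lm(4)]]] rm_lm(4,5)
    by (simp add: H.over_deriv)
qed

lemma cint_ident: "zform (D0 D) A Z B \<Longrightarrow> cint (ident_drv (D0 D) Z) = Ident (D1 D) (vint Z)"
proof (induction rule: zform.induct)
  case (atom A)
  then show ?case by (simp add: unit_ident)
next
  case (plus A Z B f B')
  then have f: "f \<in> Arr (D0 D)" "Dom (D0 D) f = B" "Cod (D0 D) f = B'"
    "B \<in> Obj (D0 D)" "B' \<in> Obj (D0 D)"
    using H.Dom_closed H.Cod_closed by (auto simp: hom_def)
  note c = cmp_cells[OF f(1), unfolded f(2,3)] and v = vint_ver[OF plus(1)]
  have "over (D0 D) (ident_drv (D0 D) Z) = Ident (D0 D) B"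
    using H.over_deriv[OF H.ident_deriv[OF plus(1)]] .
  then have "cint (ident_drv (D0 D) (Plus f Z)) =
      VcompC D (VcompC D (Ident (D1 D) (vint Z)) (cmpC K f)) (cmpC' f)"
    using plus.IH f(3) hcomp_ident(1)[OF c(1)] hcomp_ident(2)[OF c(2)] f(4,5)
    by (simp add: unit_ident)
  also have "\<dots> = Ident (D1 D) (vint (Plus f Z))"
    using vcomp_assoc[OF ident_cells[OF v] c(1,2)] c(4)
      ident_vcomp[OF v cmp_ver[OF f(1), unfolded f(2,3)]] by simp
  finally show ?case .
next
  case (minus A Z B' g B)
  then have g: "g \<in> Arr (D0 D)" "Dom (D0 D) g = B" "Cod (D0 D) g = B'"
    "B \<in> Obj (D0 D)" "B' \<in> Obj (D0 D)"
    using H.Dom_closed H.Cod_closed by (auto simp: hom_def)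
  note c = cnj_cells[OF g(1), unfolded g(2,3)] and v = vint_ver[OF minus(1)]
  have "over (D0 D) (ident_drv (D0 D) Z) = Ident (D0 D) B'"
    using H.over_deriv[OF H.ident_deriv[OF minus(1)]] .
  then have "cint (ident_drv (D0 D) (Minus g Z)) =
      VcompC D (VcompC D (Ident (D1 D) (vint Z)) (cnjC K g)) (cnjC' g)"
    using minus.IH g(2) hcomp_ident(2)[OF c(1)] hcomp_ident(1)[OF c(2)] g(4,5)
    by (simp add: unit_ident)
  also have "\<dots> = Ident (D1 D) (vint (Minus g Z))"
    using vcomp_assoc[OF ident_cells[OF v] c(1,2)] c(4)
      ident_vcomp[OF v cnj_ver[OF g(1), unfolded g(2,3)]] by simp
  finally show ?case .
qed

lemma vint_zsubst:
  "zform (D0 D) B W E \<Longrightarrow> zform (D0 D) A Z B \<Longrightarrow>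
    vint (zsubst Z W) = VcompV D (vint Z) (vint W)"
proof (induction rule: zform.induct)
  case (atom B)
  then show ?case using ver_unit[OF vint_ver] by simp
next
  case (plus B W E f E')
  then show ?case
    using ver_assoc[OF vint_ver[OF plus.prems] vint_ver[OF plus(1)]] cmp_ver[of f]
    by (auto simp: hom_def)
next
  case (minus B W E' g E)
  then show ?case
    using ver_assoc[OF vint_ver[OF minus.prems] vint_ver[OF minus(1)]] cnj_ver[of g]
    by (auto simp: hom_def)
qed

lemma cint_dsubst:
  "deriv (D0 D) W k Y b \<Longrightarrow> deriv (D0 D) Z (axiom_of b) Z' a \<Longrightarrow>
    cint (dsubst a b) = VcompC D (cint a) (cint b)"
proof (induction rule: deriv.induct)
  case (ax f A A')
  then show ?case using vcomp_unit(2)[OF cint_cells[OF ax(2)]] by simp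
next
  case (lp f g S T b)
  then show ?case
    using vcomp_assoc[OF cint_cells[of Z "axiom_of b" Z' a] cint_cells[OF lp(2)] lp_cell[OF lp(1)]]
    by simp
next
  case (rp k f S T b)
  have "over (D0 D) (dsubst a b) = over (D0 D) b"
    using H.over_dsubst[of a b] H.over_deriv[OF rp.prems] by simp
  then show ?case
    using vcomp_assoc[OF cint_cells[of Z "axiom_of b" Z' a] cint_cells[OF rp(2)] rp_cell[OF rp(1)]] rp
    by (simp add: H.over_deriv)
next
  case (lm g k S T b)
  have "over (D0 D) (dsubst a b) = over (D0 D) b"
    using H.over_dsubst[of a b] H.over_deriv[OF lm.prems] by simp
  then show ?case
    using vcomp_assoc[OF cint_cells[of Z "axiom_of b" Z' a] cint_cells[OF lm(2)] lm_cell[OF lm(1)]] lm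
    by (simp add: H.over_deriv)
next
  case (rm f g S T b)
  then show ?case
    using vcomp_assoc[OF cint_cells[of Z "axiom_of b" Z' a] cint_cells[OF rm(2)] rm_cell[OF rm(1)]]
    by simp
qed

text \<open>The comparison double functor. It is computed on an arbitrary representative of a cell;
  the value does not depend on it, by \<open>cint_perm\<close>.\<close>
definition interp :: "('o, 'a, ('o, 'a) zz, ('o, 'a) zcell, 'o, 'a, 'v, 'c) dblmap" where
  "interp = \<lparr> mapO = (\<lambda>A. A), mapH = (\<lambda>f. f), mapV = vint,
     mapC = (\<lambda>x. cint (SOME a. a \<in> zcls x)) \<rparr>"

lemma interp_simps [simp]:
  "mapO interp A = A" "mapH interp f = f" "mapV interp Z = vint Z"
  by (simp_all add: interp_def)

lemma interp_zcell [simp]: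
  assumes "deriv (D0 D) Z h W a"
  shows "mapC interp (zcell_of (D0 D) Z h W a) = cint a"
proof -
  \<comment> \<open>Derivations of the same class have the same interpretation.\<close>
  have "\<exists>b. b \<in> perm_class (D0 D) Z h W a" using perm.refl[OF assms] by (auto simp: perm_class_def)
  from someI_ex[OF this] show ?thesis
    using cint_perm by (auto simp: interp_def zcell_of_def perm_class_def)
qed

lemma interp_double_functor: "double_functor (ZZ (D0 D)) D interp"
  unfolding double_functor_def
proof (intro conjI)
  show "is_functor (D0 (ZZ (D0 D))) (D0 D) (mapO interp) (mapH interp)"
    by (auto simp: is_functor_def hom_def)
  show "is_functor (D1 (ZZ (D0 D))) (D1 D) (mapV interp) (mapC interp)"
    unfolding is_functor_def
  proof (intro conjI ballI allI impI)
    fix Z assume "Z \<in> Obj (D1 (ZZ (D0 D)))"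
    then have z: "zform (D0 D) (zsrc Z) Z (ztgt (D0 D) Z)" by (simp add: H.ZZ1_Obj)
    show "mapV interp Z \<in> Obj (D1 D)" using vint_ver[OF z] by (simp add: ver_def)
    show "mapC interp (Ident (D1 (ZZ (D0 D))) Z) = Ident (D1 D) (mapV interp Z)"
      using H.ident_deriv[OF z] cint_ident[OF z] by simp
  next
    fix x assume "x \<in> Arr (D1 (ZZ (D0 D)))"
    then obtain Z h W a where "x = zcell_of (D0 D) Z h W a" "deriv (D0 D) Z h W a"
      by (auto elim: H.ZZ1_ArrE)
    then show "mapC interp x \<in> hom (D1 D) (mapV interp (Dom (D1 (ZZ (D0 D))) x))
        (mapV interp (Cod (D1 (ZZ (D0 D))) x))"
      using cint_cells by (auto simp: cells_def)
  next
    fix x y assume "seq (D1 (ZZ (D0 D))) x y"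
    then obtain Z h W a k Y b where
      "x = zcell_of (D0 D) Z h W a" "y = zcell_of (D0 D) W k Y b"
      "deriv (D0 D) Z h W a" "deriv (D0 D) W k Y b"
      by (auto simp: seq_def elim!: H.ZZ1_ArrE)
    then show "mapC interp (x \<cdot>\<^bsub>D1 (ZZ (D0 D))\<^esub> y) = mapC interp x \<cdot>\<^bsub>D1 D\<^esub> mapC interp y"
      using H.cut_drv_deriv cint_cut_drv by (simp add: H.zhcomp_zcell)
  qed
  show "\<forall>v \<in> Obj (D1 (ZZ (D0 D))). SrcV D (mapV interp v) = mapO interp (SrcV (ZZ (D0 D)) v) \<and>
      TgtV D (mapV interp v) = mapO interp (TgtV (ZZ (D0 D)) v)"
    using vint_ver by (auto simp: H.ZZ1_Obj ver_def)
  show "\<forall>x \<in> Arr (D1 (ZZ (D0 D))). SrcC D (mapC interp x) = mapH interp (SrcC (ZZ (D0 D)) x) \<and>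
      TgtC D (mapC interp x) = mapH interp (TgtC (ZZ (D0 D)) x)"
    using cint_cells by (auto simp: cells_def elim!: H.ZZ1_ArrE)
  show "\<forall>A \<in> Obj (D0 (ZZ (D0 D))). mapV interp (UnitV (ZZ (D0 D)) A) = UnitV D (mapO interp A)"
    by simp
  show "\<forall>f \<in> Arr (D0 (ZZ (D0 D))). mapC interp (UnitC (ZZ (D0 D)) f) = UnitC D (mapH interp f)"
    using H.axiom_deriv by simp
  show "\<forall>v w. vseqV (ZZ (D0 D)) v w \<longrightarrow>
      mapV interp (VcompV (ZZ (D0 D)) v w) = VcompV D (mapV interp v) (mapV interp w)"
    using vint_zsubst by (auto simp: H.vseqV_ZZ)
  show "\<forall>x y. vseqC (ZZ (D0 D)) x y \<longrightarrow>
      mapC interp (VcompC (ZZ (D0 D)) x y) = VcompC D (mapC interp x) (mapC interp y)"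
  proof (intro allI impI)
    fix x y assume "vseqC (ZZ (D0 D)) x y"
    then obtain Z Z' a W k Y b where
      "x = zcell_of (D0 D) Z (axiom_of b) Z' a" "y = zcell_of (D0 D) W k Y b"
      "deriv (D0 D) Z (axiom_of b) Z' a" "deriv (D0 D) W k Y b" by (rule H.vseqC_ZZ)
    then show "mapC interp (VcompC (ZZ (D0 D)) x y) = VcompC D (mapC interp x) (mapC interp y)"
      using H.dsubst_deriv cint_dsubst by (simp add: H.zvcomp_zcell)
  qed
qed

lemma interp_preserves_choice: "preserves_choice (ZZ (D0 D)) (ZZ_choice (D0 D)) K interp"
proof -
  have "VcompV D (UnitV D (Dom (D0 D) f)) (cmpV K f) = cmpV K f \<and>
      VcompV D (UnitV D (Cod (D0 D) f)) (cnjV K f) = cnjV K f"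
    if "f \<in> Arr (D0 D)" for f
    using ver_unit[OF cmp_ver[OF that]] ver_unit[OF cnj_ver[OF that]] by simp
  moreover have "mapC interp (cmpC (ZZ_choice (D0 D)) f) = cmpC K f \<and>
      mapC interp (cnjC (ZZ_choice (D0 D)) f) = cnjC K f" if f: "f \<in> Arr (D0 D)" for f
  proof -
    have o: "Dom (D0 D) f \<in> Obj (D0 D)" "Cod (D0 D) f \<in> Obj (D0 D)"
      using f H.Dom_closed H.Cod_closed by auto
    have s: "seq (D0 D) (Ident (D0 D) (Dom (D0 D) f)) f" "seq (D0 D) f (Ident (D0 D) (Cod (D0 D) f))"
      using f o by (auto simp: seq_def H.ident_arr)
    note d = deriv.rp[OF s(1) deriv.ax[OF H.Ident_closed[OF o(1)]]]
      deriv.lm[OF s(2) deriv.ax[OF H.Ident_closed[OF o(2)]]]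
    note c = cmp_cells(1)[OF f] cnj_cells(1)[OF f]
    show ?thesis
      using interp_zcell[OF d(1)] interp_zcell[OF d(2)] f hcomp_ident(1)[OF c(1)]
        hcomp_ident(2)[OF c(2)] vcomp_unit(1)[OF c(1)] vcomp_unit(1)[OF c(2)] unit_ident[OF o(1)]
        unit_ident[OF o(2)]
      by (simp add: ZZ_choice_def H.Ident_left H.Ident_right)
  qed
  ultimately show ?thesis
    by (simp add: preserves_choice_def) (simp add: ZZ_choice_def)
qed

section \<open>Uniqueness\<close>

text \<open>Let \<open>G\<close> be any double functor over the horizontal category that preserves
  the chosen companions and conjoints with their structure cells.\<close>
context
  fixes G :: "('o, 'a, ('o, 'a) zz, ('o, 'a) zcell, 'o, 'a, 'v, 'c) dblmap"
  assumes G: "double_functor (ZZ (D0 D)) D G"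
    and G_O: "\<And>A. A \<in> Obj (D0 D) \<Longrightarrow> mapO G A = A"
    and G_H: "\<And>f. f \<in> Arr (D0 D) \<Longrightarrow> mapH G f = f"
    and G_choice: "preserves_choice (ZZ (D0 D)) (ZZ_choice (D0 D)) K G"
begin

lemma functor_hcomp:
  assumes "deriv (D0 D) Z h W a" "deriv (D0 D) W k Y b"
  shows "mapC G (zcell_of (D0 D) Z (h \<cdot>\<^bsub>D0 D\<^esub> k) Y (cut_drv (D0 D) a b)) =
    mapC G (zcell_of (D0 D) Z h W a) \<cdot>\<^bsub>D1 D\<^esub> mapC G (zcell_of (D0 D) W k Y b)"
proof -
  have "seq (ZZ1 (D0 D)) (zcell_of (D0 D) Z h W a) (zcell_of (D0 D) W k Y b)"
    using assms by (simp add: seq_def H.ZZ1_ArrI)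
  moreover have "mapC G (zhcomp (D0 D) x y) = mapC G x \<cdot>\<^bsub>D1 D\<^esub> mapC G y"
    if "seq (ZZ1 (D0 D)) x y" for x y
    using G that by (auto simp: double_functor_def is_functor_def)
  ultimately show ?thesis by (simp flip: H.zhcomp_zcell[OF assms])
qed

lemma functor_vcomp:
  assumes "deriv (D0 D) Z (axiom_of b) Z' a" "deriv (D0 D) W k Y b"
  shows "mapC G (zcell_of (D0 D) (zsubst Z W) k (zsubst Z' Y) (dsubst a b)) =
    VcompC D (mapC G (zcell_of (D0 D) Z (axiom_of b) Z' a)) (mapC G (zcell_of (D0 D) W k Y b))"
proof -
  have "vseqC (ZZ (D0 D)) (zcell_of (D0 D) Z (axiom_of b) Z' a) (zcell_of (D0 D) W k Y b)"
    using assms by (simp add: vseqC_def H.ZZ1_ArrI)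
  moreover have "mapC G (zvcomp (D0 D) x y) = VcompC D (mapC G x) (mapC G y)"
    if "vseqC (ZZ (D0 D)) x y" for x y
    using G that by (auto simp: double_functor_def)
  ultimately show ?thesis by (simp flip: H.zvcomp_zcell[OF assms])
qed

lemma functor_zsubst:
  "vseqV (ZZ (D0 D)) Z W \<Longrightarrow> mapV G (zsubst Z W) = VcompV D (mapV G Z) (mapV G W)"
  using G by (auto simp: double_functor_def)

lemma functor_unit:
  "f \<in> Arr (D0 D) \<Longrightarrow>
    mapC G (zcell_of (D0 D) (Atom (Dom (D0 D) f)) f (Atom (Cod (D0 D) f)) (Ax f)) = UnitC D f"
  using G G_H by (auto simp: double_functor_def)

lemma functor_chosen:
  assumes "f \<in> Arr (D0 D)"
  shows "mapV G (Plus f (Atom (Dom (D0 D) f))) = cmpV K f"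
    "mapV G (Minus f (Atom (Cod (D0 D) f))) = cnjV K f"
    "mapC G (zcell_of (D0 D) (Atom (Dom (D0 D) f)) f (Plus f (Atom (Dom (D0 D) f)))
       (Rp f (Ax (Ident (D0 D) (Dom (D0 D) f))))) = cmpC K f"
    "mapC G (zcell_of (D0 D) (Minus f (Atom (Cod (D0 D) f))) f (Atom (Cod (D0 D) f))
       (Lm f (Ax (Ident (D0 D) (Cod (D0 D) f))))) = cnjC K f"
  using G_choice G_H assms by (auto simp: preserves_choice_def ZZ_choice_def)

text \<open>The complementary cells are preserved as well, being determined by the preserved
  data.\<close>
lemma functor_complementary:
  assumes f: "f \<in> Arr (D0 D)"
  shows "mapC G (zcell_of (D0 D) (Plus f (Atom (Dom (D0 D) f))) (Ident (D0 D) (Cod (D0 D) f))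
      (Atom (Cod (D0 D) f)) (Lp f (Ident (D0 D) (Cod (D0 D) f)) (Ax f))) = cmpC' f"
    and "mapC G (zcell_of (D0 D) (Atom (Dom (D0 D) f)) (Ident (D0 D) (Dom (D0 D) f))
      (Minus f (Atom (Cod (D0 D) f))) (Rm (Ident (D0 D) (Dom (D0 D) f)) f (Ax f))) = cnjC' f"
proof -
  have f': "f \<in> Arr (D0 (ZZ (D0 D)))" using f by simp
  show "mapC G (zcell_of (D0 D) (Plus f (Atom (Dom (D0 D) f))) (Ident (D0 D) (Cod (D0 D) f))
      (Atom (Cod (D0 D) f)) (Lp f (Ident (D0 D) (Cod (D0 D) f)) (Ax f))) = cmpC' f"
    using companion_pair_unique[OF f cmp_pair[OF f]] functor_chosen[OF f] G_H[OF f]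
      double_category.double_functor_companion_pair[OF H.ZZ_double_category G f'
        H.ZZ_companion_pair[OF f]] by simp
  show "mapC G (zcell_of (D0 D) (Atom (Dom (D0 D) f)) (Ident (D0 D) (Dom (D0 D) f))
      (Minus f (Atom (Cod (D0 D) f))) (Rm (Ident (D0 D) (Dom (D0 D) f)) f (Ax f))) = cnjC' f"
    using conjoint_pair_unique[OF f cnj_pair[OF f]] functor_chosen[OF f] G_H[OF f]
      double_category.double_functor_conjoint_pair[OF H.ZZ_double_category G f'
        H.ZZ_conjoint_pair[OF f]] by simp
qed

lemma functor_vint: "zform (D0 D) A Z B \<Longrightarrow> mapV G Z = vint Z"
proof (induction rule: zform.induct)
  case (atom A)
  then show ?case using G G_O by (auto simp: double_functor_def)
next
  case (plus A Z B f B')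
  have f: "f \<in> Arr (D0 D)" "Dom (D0 D) f = B" "B \<in> Obj (D0 D)"
    using plus H.Dom_closed by (auto simp: hom_def)
  have "vseqV (ZZ (D0 D)) Z (Plus f (Atom B))"
    using plus zform_iff[of "D0 D" A Z B] f
    by (auto simp: H.vseqV_ZZ hom_def intro!: zform.intros)
  from functor_zsubst[OF this] show ?case using plus.IH functor_chosen(1)[OF f(1)] f(2) by simp
next
  case (minus A Z B' g B)
  have g: "g \<in> Arr (D0 D)" "Cod (D0 D) g = B'" "B' \<in> Obj (D0 D)"
    using minus H.Cod_closed by (auto simp: hom_def)
  have "vseqV (ZZ (D0 D)) Z (Minus g (Atom B'))"
    using minus zform_iff[of "D0 D" A Z B'] g
    by (auto simp: H.vseqV_ZZ hom_def intro!: zform.intros)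
  from functor_zsubst[OF this] show ?case using minus.IH functor_chosen(2)[OF g(1)] g(2) by simp
qed

text \<open>A derivation that ends with a rule is the substitution of its premise into that rule
  applied to an axiom. The latter is the cut of an axiom with one of the four companion and conjoint
  cells (fact \<open>c\<close> in the case of each rule), so its image under \<open>G\<close> is
  forced.\<close>
lemma functor_cint: "deriv (D0 D) Z h W a \<Longrightarrow> mapC G (zcell_of (D0 D) Z h W a) = cint a"
proof (induction rule: deriv.induct)
  case (ax f A A')
  then show ?case using functor_unit[of f] by (auto simp: hom_def)
next
  case (lp f g S T a)
  note f = seq_facts[OF lp(1)] and b = H.deriv_bounds[OF lp(2)] H.comp_arr[OF lp(1)]
  let ?i = "Ident (D0 D) (Cod (D0 D) f)"
  have s: "seq (D0 D) f ?i" using f H.Cod_closed by (auto simp: seq_def H.ident_arr)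
  have 1: "deriv (D0 D) (Plus f (Atom (Dom (D0 D) f))) ?i (Atom (Cod (D0 D) f)) (Lp f ?i (Ax f))"
    using deriv.lp[OF s] H.axiom_deriv[OF f(1)] H.Ident_right[OF f(1)] by simp
  have 2: "deriv (D0 D) (Atom (Cod (D0 D) f)) g (Atom (Cod (D0 D) g)) (Ax g)"
    using H.axiom_deriv[OF f(2)] f(3) by simp
  have c: "mapC G (zcell_of (D0 D) (Plus f (Atom (Dom (D0 D) f))) g (Atom (Cod (D0 D) g))
      (Lp f g (Ax (f \<cdot>\<^bsub>D0 D\<^esub> g)))) = cmpC' f \<cdot>\<^bsub>D1 D\<^esub> UnitC D g"
    using functor_hcomp[OF 1 2] functor_complementary(1)[OF f(1)] functor_unit[OF f(2)] H.Ident_left[OF f(2)] f(3) by simp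
  have d: "deriv (D0 D) (Plus f (Atom (Dom (D0 D) f))) g (Atom (Cod (D0 D) g))
      (Lp f g (Ax (f \<cdot>\<^bsub>D0 D\<^esub> g)))"
    using H.cut_drv_deriv[OF 1 2] H.Ident_left[OF f(2)] f(3) by simp
  show ?case using functor_vcomp[OF _ d, of S T a] lp(2) lp.IH c b by simp
next
  case (rp k f Z S a)
  note k = seq_facts[OF rp(1)] and b = H.deriv_bounds[OF rp(2)]
  let ?i = "Ident (D0 D) (Dom (D0 D) f)"
  have o: "Dom (D0 D) f \<in> Obj (D0 D)" using k(2) H.Dom_closed by blast
  have s: "seq (D0 D) ?i f" using k o by (auto simp: seq_def H.ident_arr)
  have 1: "deriv (D0 D) (Atom (Dom (D0 D) f)) f (Plus f (Atom (Dom (D0 D) f))) (Rp f (Ax ?i))"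
    using deriv.rp[OF s deriv.ax[OF H.Ident_closed[OF o]]] H.Ident_left[OF k(2)] by simp
  have 2: "deriv (D0 D) (Atom (Dom (D0 D) k)) k (Atom (Dom (D0 D) f)) (Ax k)"
    using H.axiom_deriv[OF k(1)] k(3) by simp
  have c: "mapC G (zcell_of (D0 D) (Atom (Dom (D0 D) k)) (k \<cdot>\<^bsub>D0 D\<^esub> f)
      (Plus f (Atom (Dom (D0 D) f))) (Rp f (Ax k))) = UnitC D k \<cdot>\<^bsub>D1 D\<^esub> cmpC K f"
    using functor_hcomp[OF 2 1] functor_chosen(3)[OF k(2)] functor_unit[OF k(1)] H.Ident_right[OF k(1)] k(3) by simp
  have d: "deriv (D0 D) (Atom (Dom (D0 D) k)) (k \<cdot>\<^bsub>D0 D\<^esub> f) (Plus f (Atom (Dom (D0 D) f))) (Rp f (Ax k))"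
    using H.cut_drv_deriv[OF 2 1] H.Ident_right[OF k(1)] k(3) by simp
  show ?case using functor_vcomp[OF _ d, of Z S a] rp(2) rp.IH c b by (simp add: H.over_deriv)
next
  case (lm g k T W a)
  note g = seq_facts[OF lm(1)] and b = H.deriv_bounds[OF lm(2)]
  let ?i = "Ident (D0 D) (Cod (D0 D) g)"
  have o: "Cod (D0 D) g \<in> Obj (D0 D)" using g(1) H.Cod_closed by blast
  have s: "seq (D0 D) g ?i" using g o by (auto simp: seq_def H.ident_arr)
  have 1: "deriv (D0 D) (Minus g (Atom (Cod (D0 D) g))) g (Atom (Cod (D0 D) g)) (Lm g (Ax ?i))"
    using deriv.lm[OF s deriv.ax[OF H.Ident_closed[OF o]]] H.Ident_right[OF g(1)] by simp
  have 2: "deriv (D0 D) (Atom (Cod (D0 D) g)) k (Atom (Cod (D0 D) k)) (Ax k)"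
    using H.axiom_deriv[OF g(2)] g(3) by simp
  have c: "mapC G (zcell_of (D0 D) (Minus g (Atom (Cod (D0 D) g))) (g \<cdot>\<^bsub>D0 D\<^esub> k)
      (Atom (Cod (D0 D) k)) (Lm g (Ax k))) = cnjC K g \<cdot>\<^bsub>D1 D\<^esub> UnitC D k"
    using functor_hcomp[OF 1 2] functor_chosen(4)[OF g(1)] functor_unit[OF g(2)] H.Ident_left[OF g(2)] g(3) by simp
  have d: "deriv (D0 D) (Minus g (Atom (Cod (D0 D) g))) (g \<cdot>\<^bsub>D0 D\<^esub> k) (Atom (Cod (D0 D) k)) (Lm g (Ax k))"
    using H.cut_drv_deriv[OF 1 2] H.Ident_left[OF g(2)] g(3) by simp
  show ?case using functor_vcomp[OF _ d, of T W a] lm(2) lm.IH c b g(3) by (simp add: H.over_deriv)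
next
  case (rm f g S T a)
  note f = seq_facts[OF rm(1)] and b = H.deriv_bounds[OF rm(2)] H.comp_arr[OF rm(1)]
  let ?i = "Ident (D0 D) (Dom (D0 D) g)"
  have s: "seq (D0 D) ?i g" using f H.Cod_closed by (auto simp: seq_def H.ident_arr)
  have 1: "deriv (D0 D) (Atom (Dom (D0 D) g)) ?i (Minus g (Atom (Cod (D0 D) g))) (Rm ?i g (Ax g))"
    using deriv.rm[OF s] H.axiom_deriv[OF f(2)] H.Ident_left[OF f(2)] by simp
  have 2: "deriv (D0 D) (Atom (Dom (D0 D) f)) f (Atom (Dom (D0 D) g)) (Ax f)"
    using H.axiom_deriv[OF f(1)] f(3) by simp
  have c: "mapC G (zcell_of (D0 D) (Atom (Dom (D0 D) f)) f (Minus g (Atom (Cod (D0 D) g)))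
      (Rm f g (Ax (f \<cdot>\<^bsub>D0 D\<^esub> g)))) = UnitC D f \<cdot>\<^bsub>D1 D\<^esub> cnjC' g"
    using functor_hcomp[OF 2 1] functor_complementary(2)[OF f(2)] functor_unit[OF f(1)] H.Ident_right[OF f(1)] f(3) by simp
  have d: "deriv (D0 D) (Atom (Dom (D0 D) f)) f (Minus g (Atom (Cod (D0 D) g)))
      (Rm f g (Ax (f \<cdot>\<^bsub>D0 D\<^esub> g)))"
    using H.cut_drv_deriv[OF 2 1] H.Ident_right[OF f(1)] f(3) by simp
  show ?case using functor_vcomp[OF _ d, of S T a] rm(2) rm.IH c b by simp
qed

lemma interp_unique: "dblmap_eq (ZZ (D0 D)) G interp"
  using G_O G_H functor_vint functor_cint by (auto simp: dblmap_eq_def H.ZZ1_Obj elim!: H.ZZ1_ArrE)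

end

end

theorem theorem2p8:
  fixes C :: "('o, 'a) cat"
  assumes "category C"
  shows "fibrant_double_category (ZZ C) \<and> D0 (ZZ C) = C \<and>
    choice_of_fibrancy (ZZ C) (ZZ_choice C) \<and>
    (\<forall>(E :: ('o, 'a, 'v, 'c) dblcat) (K :: ('a, 'v, 'c) fib_choice).
       fibrant_double_category E \<longrightarrow> D0 E = C \<longrightarrow> choice_of_fibrancy E K \<longrightarrow>
       (let over_C = (\<lambda>F. double_functor (ZZ C) E F \<and>
              (\<forall>A \<in> Obj C. mapO F A = A) \<and> (\<forall>f \<in> Arr C. mapH F f = f) \<and>
              preserves_choice (ZZ C) (ZZ_choice C) K F)
        in \<exists>F. over_C F \<and> (\<forall>G. over_C G \<longrightarrow> dblmap_eq (ZZ C) G F)))"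
proof -
  interpret category C by fact
  have "\<exists>F. (double_functor (ZZ C) E F \<and> (\<forall>A \<in> Obj C. mapO F A = A) \<and>
        (\<forall>f \<in> Arr C. mapH F f = f) \<and> preserves_choice (ZZ C) (ZZ_choice C) K F) \<and>
      (\<forall>G. double_functor (ZZ C) E G \<and> (\<forall>A \<in> Obj C. mapO G A = A) \<and>
        (\<forall>f \<in> Arr C. mapH G f = f) \<and> preserves_choice (ZZ C) (ZZ_choice C) K G \<longrightarrow>
        dblmap_eq (ZZ C) G F)"
    if E: "fibrant_double_category E" "D0 E = C" "choice_of_fibrancy E K"
    for E :: "('o, 'a, 'v, 'c) dblcat" and K :: "('a, 'v, 'c) fib_choice"
  proof -
    interpret E: chosen_fibrancy E K
      using E by (simp add: chosen_fibrancy_def chosen_fibrancy_axioms_def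
          fibrant_double_category_def)
    show ?thesis
      using E.interp_double_functor E.interp_preserves_choice E.interp_unique
      by (intro exI[of _ E.interp]) (simp add: E(2))
  qed
  then show ?thesis using ZZ_fibrant ZZ_choice unfolding Let_def by simp
qed

end
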